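(* Let $F:\Omega\times J\to SL(2,\mathbb{R})$ be a random parameter-dependent family of matrices satisfying the Furstenberg condition, $C^1$-boundedness, non-uniform hyperbolicity and monotonicity (assumptions (A1)--(A4) spelled out in the context). Then: (1) For $\mu^{\mathbb{N}}$-almost all $\bar\omega\in\Omega^{\mathbb{N}}$, for all $a\in J$ the following holds. If $$\limsup_{n\to+\infty}\frac1n\log\left|T_{n,a,\bar\omega}\begin{pmatrix}1\\0\end{pmatrix}\right|<\lambda_F(a),$$ then in fact $\left|T_{n,a,\bar\omega}\begin{pmatrix}1\\0\end{pmatrix}\right|$ tends to zero exponentially as $n\to\infty$; namely, $$\lim_{n\to+\infty}\frac1n\log\left|T_{n,a,\bar\omega}\begin{pmatrix}1\\0\end{pmatrix}\right|=-\lambda_F(a).$$ (2) For $\mu^{\mathbb{Z}}$-almost all $\bar\omega\in\Omega^{\mathbb{Z}}$, for all $a\in J$ the following holds. If for some $\bar v\in\mathbb{R}^2\setminus\{0\}$ $$\limsup_{n\to+\infty}\frac1n\log|T_{n,a,\bar\omega}\bar v|<\lambda_F(a)\quad\text{and}\quad\limsup_{n\to+\infty}\frac1n\log|T_{-n,a,\bar\omega}\bar v|<\lambda_F(a),$$ then both $|T_{n,a,\bar\omega}\bar v|$ and $|T_{-n,a,\bar\omega}\bar v|$ tend to zero exponentially; namely, $$\lim_{n\to+\infty}\frac1n\log|T_{n,a,\bar\omega}\bar v|=-\lambda_F(a)\quad\text{and}\quad\lim_{n\to+\infty}\frac1n\log|T_{-n,a,\bar\omega}\bar v|=-\lambda_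F(a).$$
   Context: Setting. $(\Omega,\mu)$ is a probability space, $J\subset\mathbb{R}$ is a compact interval of parameters, and $F:\Omega\times J\to SL(2,\mathbb{R})$ is a bounded measurable map, continuous in the second argument; write $F_a(\omega)=F(\omega,a)$. For $\bar\omega=(\omega_n)$ in $\Omega^{\mathbb{N}}$ or $\Omega^{\mathbb{Z}}$ (with product measures $\mu^{\mathbb{N}}$, $\mu^{\mathbb{Z}}$) and $n\ge1$ put $T_{n,a,\bar\omega}=F_a(\omega_n)F_a(\omega_{n-1})\cdots F_a(\omega_1)$; for $\bar\omega\in\Omega^{\mathbb{Z}}$ put $T_{-n,a,\bar\omega}=F_a(\omega_{-n})^{-1}\cdots F_a(\omega_{-1})^{-1}F_a(\omega_0)^{-1}$. A collection $\{M_\alpha\}_{\alpha\in\mathcal{A}}\subset SL(2,\mathbb{R})$ is called uniformly hyperbolic if there is a constant $\eta>1$ such that $\|M_{\alpha_1}M_{\alpha_2}\cdots M_{\alpha_n}\|>\eta^n$ for every finite sequence $M_{\alpha_1},\dots,M_{\alpha_n}$ of its elements. Assumptions: (A1) (Furstenberg condition) For each $a\in J$ let $\mu_a=(F_a)_*\mu$. The support of $\mu_a$ is not contained in any compact subgroup of $SL(2,\mathbb{R})$, and there is no finite union of proper subspaces of $\mathbb{R}^2$ invariant under $\operatorname{supp}\mu_a$. (A2) ($C^1$-boundedness) The maps $F_a(\omega)$ are $C^1$-smooth in $a\in J$ and there is $M>0$ such that $\|F_a(\omega)\|,\ \|\frac{d}{da}F_a(\omega)\|\le M$ for all $\omega\in\Omega$,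 $a\in J$. (A3) (Non-uniform hyperbolicity) For each $a\in J$ the collection $\{F_a(\omega)\}_{\omega\in\Omega}$ is not uniformly hyperbolic. (A4) (Monotonicity) There is $\delta>0$ such that $\frac{d}{da}\arg(F_a(\omega)\bar v)>\delta>0$ for all $a\in J$, $\omega\in\Omega$, $\bar v\in\mathbb{R}^2\setminus\{0\}$ ($\arg$ is the polar angle, followed continuously in $a$). The Furstenberg Lyapunov exponent $\lambda_F(a)>0$ is the number such that, for each fixed $a\in J$, $\lim_{n\to\infty}\frac1n\log\|T_{n,a,\bar\omega}\|=\lambda_F(a)$ for $\mu^{\mathbb{N}}$-a.e. $\bar\omega$ (it exists by the Furstenberg--Kesten and Furstenberg theorems). *)

theory Defs
  imports "HOL-Probability.Probability" "HOL-Algebra.Group"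
begin

definition SL2 :: "(real^2^2) monoid" where
  "SL2 = \<lparr>carrier = {A. det A = 1}, monoid.mult = (**), one = mat 1\<rparr>"

text \<open>The library norm on \<open>real^2^2\<close> is the Frobenius norm; the norm of a matrix is
  here always the operator norm with respect to the Euclidean norm.\<close>

definition op_norm :: "real^2^2 \<Rightarrow> real" where
  "op_norm A = onorm (\<lambda>v. A *v v)"

text \<open>Sequences are nonempty: for the empty one the inequality would read \<open>1 > 1\<close>.
  The operation \<open>*\<close> on \<open>real^2^2\<close> is componentwise, so \<open>prod_list\<close> is not
  the matrix product.\<close>

definition uniformly_hyperbolic :: "(real^2^2) set \<Rightarrow> bool" where
  "uniformly_hyperbolic S \<longleftrightarrow>
     (\<exists>\<eta>>1. \<forall>As. As \<noteq> [] \<and> set As \<subseteq> S \<longrightarrow> op_norm (foldr (**) As (mat 1)) > \<eta> ^ length As)"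

definition measure_support :: "'b::topological_space measure \<Rightarrow> 'b set" where
  "measure_support N = {x. \<forall>U. open U \<and> x \<in> U \<longrightarrow> emeasure N U > 0}"

definition SL2_family :: "'w measure \<Rightarrow> real set \<Rightarrow> ('w \<Rightarrow> real \<Rightarrow> real^2^2) \<Rightarrow> bool" where
  "SL2_family M J F \<longleftrightarrow>
     (\<forall>\<omega>\<in>space M. \<forall>a\<in>J. F \<omega> a \<in> carrier SL2) \<and>
     (\<lambda>(\<omega>, a). F \<omega> a) \<in> borel_measurable (M \<Otimes>\<^sub>M restrict_space borel J) \<and>
     bounded ((\<lambda>(\<omega>, a). F \<omega> a) ` (space M \<times> J)) \<and>
     (\<forall>\<omega>\<in>space M. continuous_on J (F \<omega>))"

text \<open>The zero subspace is excluded, as \<open>{0}\<close> is invariant under every matrix.\<close>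

definition furstenberg_condition ::
    "'w measure \<Rightarrow> real set \<Rightarrow> ('w \<Rightarrow> real \<Rightarrow> real^2^2) \<Rightarrow> bool" where
  "furstenberg_condition M J F \<longleftrightarrow>
     (\<forall>a\<in>J. let S = measure_support (distr M borel (\<lambda>\<omega>. F \<omega> a)) in
        (\<nexists>K. subgroup K SL2 \<and> compact K \<and> S \<subseteq> K) \<and>
        (\<nexists>\<V>. finite \<V> \<and> \<V> \<noteq> {} \<and>
             (\<forall>V\<in>\<V>. subspace V \<and> V \<noteq> {0} \<and> V \<noteq> UNIV) \<and>
             (\<forall>A\<in>S. (\<lambda>v. A *v v) ` (\<Union>\<V>) = \<Union>\<V>)))"

text \<open>Derivatives in the parameter are taken within \<open>J\<close>, hence one-sided at its endpoints.\<close>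

definition C1_bounded :: "'w measure \<Rightarrow> real set \<Rightarrow> ('w \<Rightarrow> real \<Rightarrow> real^2^2) \<Rightarrow> bool" where
  "C1_bounded M J F \<longleftrightarrow>
     (\<exists>C>0. \<forall>\<omega>\<in>space M. \<exists>F'. continuous_on J F' \<and>
        (\<forall>a\<in>J. (F \<omega> has_vector_derivative F' a) (at a within J) \<and>
               op_norm (F \<omega> a) \<le> C \<and> op_norm (F' a) \<le> C))"

definition nowhere_uniformly_hyperbolic ::
    "'w measure \<Rightarrow> real set \<Rightarrow> ('w \<Rightarrow> real \<Rightarrow> real^2^2) \<Rightarrow> bool" where
  "nowhere_uniformly_hyperbolic M J F \<longleftrightarrow>
     (\<forall>a\<in>J. \<not> uniformly_hyperbolic ((\<lambda>\<omega>. F \<omega> a) ` space M))"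

text \<open>The function \<open>\<theta>\<close> is the polar angle of \<open>F \<omega> a *v v\<close> followed continuously in \<open>a\<close>;
  it exists and is unique up to an additive constant, so its derivative does not depend
  on the choice.\<close>

definition monotone_in_parameter ::
    "'w measure \<Rightarrow> real set \<Rightarrow> ('w \<Rightarrow> real \<Rightarrow> real^2^2) \<Rightarrow> bool" where
  "monotone_in_parameter M J F \<longleftrightarrow>
     (\<exists>\<delta>>0. \<forall>\<omega>\<in>space M. \<forall>v. v \<noteq> 0 \<longrightarrow>
        (\<exists>\<theta>. continuous_on J \<theta> \<and>
           (\<forall>a\<in>J. is_Arg (Complex ((F \<omega> a *v v) $ 1) ((F \<omega> a *v v) $ 2)) (\<theta> a)) \<and>
           (\<forall>a\<in>J. \<exists>d>\<delta>. (\<theta> has_real_derivative d) (at a within J))))"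

text \<open>\<open>T F a \<omega> n\<close> is \<open>F\<^sub>a(\<omega>\<^sub>n) \<cdots> F\<^sub>a(\<omega>\<^sub>1)\<close>; the entry \<open>\<omega> 0\<close> is not used.\<close>

primrec T :: "('w \<Rightarrow> real \<Rightarrow> real^2^2) \<Rightarrow> real \<Rightarrow> (nat \<Rightarrow> 'w) \<Rightarrow> nat \<Rightarrow> real^2^2" where
  "T F a \<omega> 0 = mat 1"
| "T F a \<omega> (Suc n) = F (\<omega> (Suc n)) a ** T F a \<omega> n"

text \<open>\<open>T_neg F a \<omega> n\<close> is \<open>F\<^sub>a(\<omega>\<^sub>-\<^sub>n)\<^sup>-\<^sup>1 \<cdots> F\<^sub>a(\<omega>\<^sub>-\<^sub>1)\<^sup>-\<^sup>1 F\<^sub>a(\<omega>\<^sub>0)\<^sup>-\<^sup>1\<close>, a product of \<open>n + 1\<close>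
  factors.\<close>

primrec T_neg :: "('w \<Rightarrow> real \<Rightarrow> real^2^2) \<Rightarrow> real \<Rightarrow> (int \<Rightarrow> 'w) \<Rightarrow> nat \<Rightarrow> real^2^2" where
  "T_neg F a \<omega> 0 = matrix_inv (F (\<omega> 0) a)"
| "T_neg F a \<omega> (Suc n) = matrix_inv (F (\<omega> (- int (Suc n))) a) ** T_neg F a \<omega> n"

text \<open>The number \<open>l\<close> is unique if it exists; for a fixed parameter, existence is the content
  of the Furstenberg--Kesten theorem and positivity that of Furstenberg's theorem.\<close>

definition furstenberg_exponent ::
    "'w measure \<Rightarrow> ('w \<Rightarrow> real \<Rightarrow> real^2^2) \<Rightarrow> real \<Rightarrow> real \<Rightarrow> bool" where
  "furstenberg_exponent M F a l \<longleftrightarrow> l > 0 \<and>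
     (AE \<omega> in PiM {1::nat..} (\<lambda>_. M).
        (\<lambda>n. ln (op_norm (T F a \<omega> n)) / real n) \<longlonglongrightarrow> l)"

end

theory Submission
  imports Defs "HOL-Real_Asymp.Real_Asymp"
begin

text \<open>
  Let \<open>e = (1,0)\<close>. The size of a vector moved by a product of random matrices may go up and down. The
  proof looks at it on a logarithmic scale, in blocks of large equal length, for almost every sequence
  and all parameters at the same time. Up to one exceptional place on the time axis, an orbit that does
  not fall at almost the full speed \<open>\<lambda>\<close> in a block climbs at almost full speed in the next one.
  An orbit that is slower than \<open>\<lambda>\<close> in the long run therefore has to fall at full speed away from the
  exceptional place.

  \<^emph>\<open>One parameter.\<close> The contracted directions of the partial products converge, so for almost every
  sequence all slow vectors lie on one line. Hence only finitely many lines are slow with at least a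
  given positive probability, and the lines for which this probability is maximal form a finite family
  that almost every matrix maps into itself. The Furstenberg condition forbids this, so a fixed vector
  is almost surely not slow (\<open>prob_slow_eq_0\<close>). Its expected logarithmic growth therefore has rate \<open>\<lambda>\<close>,
  and compactness makes this uniform over unit vectors and nearby parameters. Restarting the walk
  again and again turns it into exponential bounds for negative moments
  (\<open>uniform_negative_moment\<close>): growth at a rate below \<open>\<lambda> - \<epsilon>\<close> is exponentially unlikely. Upper
  bounds hold uniformly in the parameter for a simpler reason (\<open>uniform_upper_bound\<close>).

  \<^emph>\<open>All parameters.\<close> Random exceptional parameters do exist, but they are few. By monotonicity the
  direction of \<open>T\<^sub>n e\<close> turns in one sense as the parameter increases, and it turns by \<open>O(n)\<close> in total
  (\<open>lift_mono\<close>, \<open>lift_total\<close>). If the parameter interval is cut into exponentially many cells, the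
  direction moves noticeably only in \<open>O(n)\<close> of them (\<open>rotation_count\<close>). In the other cells all
  parameters produce almost the same growth as the left end point (\<open>growth_if_not_exceptional\<close>). So
  the expected number of exceptional cells is polynomial in the length of the time window, while a
  given cell is exceptional with exponentially small probability. Disjoint time windows are independent,
  hence a cell that is exceptional for two of them is exponentially unlikely
  (\<open>common_slow_parameter\<close>). By the Borel--Cantelli lemma, almost surely for every parameter and all
  large \<open>p\<close>, two windows \<open>[jp, (j+2)p]\<close> with indices in a bounded range that differ by at least \<open>2\<close> are
  never both exceptional (\<open>AE_regular\<close>).

  \<^emph>\<open>From blocks to limits.\<close> Suppose that the window starting at \<open>jp\<close> is not exceptional and that an orbit
  does not fall at almost full speed during its first half. Then at half time the orbit is almost
  parallel to the image of \<open>e\<close>, and it climbs at almost full speed in the second half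
  (\<open>expansion_persists\<close>). Without exceptional windows it would then climb for ever. For the orbit of \<open>e\<close>,
  slowness says that the window at time \<open>0\<close> is exceptional, so all windows from index \<open>2\<close> on are not; if
  the orbit ever stopped falling there, it would be too large much later. A vector that is slow in both
  time directions has an exceptional window near or after time \<open>0\<close> and, by reflection, one near or
  before it; since these overlap, both are near \<open>0\<close>, and the orbit falls at full speed in both
  directions. The matching lower bound follows from the upper bound for the norm of the products.
\<close>

section \<open>Area form and operator norm in the plane\<close>

text \<open>The oriented area of the parallelogram spanned by two vectors. It is invariant under determinant one,
  and for unit vectors its absolute value measures the distance of the lines that they span.\<close>

definition cr :: "real^2 \<Rightarrow> real^2 \<Rightarrow> real" where
  "cr x y = x $ 1 * y $ 2 - x $ 2 * y $ 1"

lemma norm_sq_2: "(norm (x::real^2))\<^sup>2 = (x $ 1)\<^sup>2 + (x $ 2)\<^sup>2"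
  by (simp add: norm_vec_def L2_set_def sum_2)

lemma inner_2: "(x::real^2) \<bullet> y = x $ 1 * y $ 1 + x $ 2 * y $ 2"
  by (simp add: inner_vec_def sum_2)

lemma mv_2: "((A::real^2^2) *v x) $ i = A $ i $ 1 * x $ 1 + A $ i $ 2 * x $ 2"
  by (simp add: matrix_vector_mult_def sum_2)

lemma vec2_eq_iff: "(x::real^2) = y \<longleftrightarrow> x $ 1 = y $ 1 \<and> x $ 2 = y $ 2"
  by (simp add: vec_eq_iff forall_2)

lemma cr_simps [simp]: "cr x x = 0" "cr 0 x = 0" "cr x 0 = 0"
  by (simp_all add: cr_def)

lemma cr_commute: "cr y x = - cr x y"
  by (simp add: cr_def)

lemma cr_scale [simp]: "cr (c *\<^sub>R x) y = c * cr x y" "cr x (c *\<^sub>R y) = c * cr x y"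
  by (simp_all add: cr_def algebra_simps)

lemma cr_add: "cr (x + y) z = cr x z + cr y z" "cr x (y + z) = cr x y + cr x z"
  by (simp_all add: cr_def algebra_simps)

lemma cr_diff: "cr (x - y) z = cr x z - cr y z" "cr x (y - z) = cr x y - cr x z"
  by (simp_all add: cr_def algebra_simps)

lemma cr_matrix: "cr (A *v x) (A *v y) = det A * cr x y"
  by (simp add: cr_def mv_2 det_2 algebra_simps)

lemma cr_lagrange: "(cr x y)\<^sup>2 + (x \<bullet> y)\<^sup>2 = (norm x)\<^sup>2 * (norm y)\<^sup>2"
  unfolding norm_sq_2 inner_2 cr_def by algebra

lemma abs_cr_le: "\<bar>cr x y\<bar> \<le> norm x * norm y"
proof -
  have "(cr x y)\<^sup>2 \<le> (norm x * norm y)\<^sup>2"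
    using cr_lagrange[of x y] zero_le_power2[of "x \<bullet> y"] unfolding power_mult_distrib by linarith
  thus ?thesis by (simp add: abs_le_square_iff[symmetric] abs_mult)
qed

text \<open>For unit vectors this is the triangle inequality for the sines of angles between lines.\<close>

lemma cr_triangle: "\<bar>cr x z\<bar> * norm y \<le> \<bar>cr x y\<bar> * norm z + \<bar>cr y z\<bar> * norm x"
proof (cases "y = 0")
  case False
  have "cr x z * (norm y)\<^sup>2 = (y \<bullet> z) * cr x y + (x \<bullet> y) * cr y z"
    unfolding norm_sq_2 inner_2 cr_def by algebra
  hence "\<bar>cr x z\<bar> * (norm y)\<^sup>2 = \<bar>(y \<bullet> z) * cr x y + (x \<bullet> y) * cr y z\<bar>"
    by (metis abs_mult abs_power2)
  also have "\<dots> \<le> \<bar>y \<bullet> z\<bar> * \<bar>cr x y\<bar> + \<bar>x \<bullet> y\<bar> * \<bar>cr y z\<bar>"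
    by (metis abs_mult abs_triangle_ineq)
  also have "\<dots> \<le> (norm y * norm z) * \<bar>cr x y\<bar> + (norm x * norm y) * \<bar>cr y z\<bar>"
    by (intro add_mono mult_right_mono Cauchy_Schwarz_ineq2) auto
  also have "\<dots> = (\<bar>cr x y\<bar> * norm z + \<bar>cr y z\<bar> * norm x) * norm y"
    by (simp add: algebra_simps)
  finally have "(\<bar>cr x z\<bar> * norm y) * norm y \<le> (\<bar>cr x y\<bar> * norm z + \<bar>cr y z\<bar> * norm x) * norm y"
    by (simp add: power2_eq_square mult.assoc)
  thus ?thesis using False by simp
qed auto

lemma norm_mv_le: "norm (A *v x) \<le> op_norm A * norm x" for A :: "real^2^2"
  unfolding op_norm_def by (rule onorm) (simp add: linear_linear)

lemma op_norm_le: "(\<And>x. norm (A *v x) \<le> b * norm x) \<Longrightarrow> op_norm A \<le> b" for A :: "real^2^2"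
  unfolding op_norm_def by (rule onorm_le)

lemma op_norm_nonneg [simp]: "0 \<le> op_norm A"
  unfolding op_norm_def by (rule onorm_pos_le) (simp add: linear_linear)

lemma op_norm_mult: "op_norm (A ** B) \<le> op_norm A * op_norm B"
proof (rule op_norm_le)
  fix x :: "real^2"
  have "norm ((A ** B) *v x) = norm (A *v (B *v x))" by (simp add: matrix_vector_mul_assoc)
  also have "\<dots> \<le> op_norm A * norm (B *v x)" by (rule norm_mv_le)
  also have "\<dots> \<le> op_norm A * (op_norm B * norm x)"
    by (intro mult_left_mono norm_mv_le) auto
  finally show "norm ((A ** B) *v x) \<le> op_norm A * op_norm B * norm x" by (simp add: mult.assoc)
qed

lemma op_norm_triangle: "op_norm (A + B) \<le> op_norm A + op_norm B"
proof (rule op_norm_le)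
  fix x :: "real^2"
  have "norm ((A + B) *v x) \<le> norm (A *v x) + norm (B *v x)"
    by (simp add: matrix_vector_mult_add_rdistrib norm_triangle_ineq)
  also have "\<dots> \<le> op_norm A * norm x + op_norm B * norm x"
    by (intro add_mono norm_mv_le)
  finally show "norm ((A + B) *v x) \<le> (op_norm A + op_norm B) * norm x" by (simp add: algebra_simps)
qed

lemma op_norm_le_frob: "op_norm A \<le> norm A"
proof (rule op_norm_le)
  fix x :: "real^2"
  have a: "(norm A)\<^sup>2 = (norm (A $ 1))\<^sup>2 + (norm (A $ 2))\<^sup>2"
    by (simp add: norm_vec_def[of A] L2_set_def sum_2)
  have r: "(A *v x) $ i = A $ i \<bullet> x" for i by (simp add: mv_2 inner_2)
  have "(norm (A *v x))\<^sup>2 = (A $ 1 \<bullet> x)\<^sup>2 + (A $ 2 \<bullet> x)\<^sup>2"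
    by (simp add: norm_sq_2 r)
  also have "\<dots> \<le> (norm (A $ 1) * norm x)\<^sup>2 + (norm (A $ 2) * norm x)\<^sup>2"
    by (intro add_mono; simp add: abs_le_square_iff[symmetric] Cauchy_Schwarz_ineq2)
  also have "\<dots> = (norm A * norm x)\<^sup>2" unfolding power_mult_distrib a by algebra
  finally show "norm (A *v x) \<le> norm A * norm x"
    by (rule power2_le_imp_le) simp
qed

lemma continuous_on_op_norm [continuous_intros]: "continuous_on X op_norm"
proof (rule lipschitz_on_continuous_on[of 1])
  have *: "op_norm A - op_norm B \<le> norm (A - B)" for A B
    using op_norm_triangle[of "A - B" B] op_norm_le_frob[of "A - B"] by simp
  show "1-lipschitz_on X op_norm"
  proof (rule lipschitz_onI)
    fix A B :: "real^2^2"
    show "dist (op_norm A) (op_norm B) \<le> 1 * dist A B"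
      using *[of A B] *[of B A] by (simp add: dist_norm norm_minus_commute abs_le_iff)
  qed simp
qed

lemma borel_measurable_op_norm [measurable]: "op_norm \<in> borel_measurable borel"
  by (intro borel_measurable_continuous_onI continuous_on_op_norm)

definition rot :: "real^2 \<Rightarrow> real^2" where "rot x = vector [- (x $ 2), x $ 1]"

lemma norm_rot [simp]: "norm (rot x) = norm x"
  unfolding rot_def norm_vec_def L2_set_def by (simp add: sum_2 add.commute)

lemma cr_rot [simp]: "cr x (rot x) = (norm x)\<^sup>2"
  unfolding norm_sq_2 by (simp add: cr_def rot_def power2_eq_square)

lemma orthogonal_decomposition:
  "(norm x)\<^sup>2 *\<^sub>R y = (x \<bullet> y) *\<^sub>R x + cr x y *\<^sub>R rot x"
  unfolding vec2_eq_iff norm_sq_2 inner_2 cr_def rot_def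
  by (simp add: power2_eq_square algebra_simps)

text \<open>A matrix of determinant one preserves areas, so it cannot shrink a vector by more than it can stretch
  an orthogonal one: the norm of the inverse equals the norm.\<close>

lemma norm_le_op_norm_mv:
  assumes "det A = 1" shows "norm x \<le> op_norm A * norm (A *v x)"
proof (cases "x = 0")
  case False
  have "(norm x)\<^sup>2 = cr (A *v x) (A *v rot x)" using assms by (simp add: cr_matrix)
  also have "\<dots> \<le> norm (A *v x) * norm (A *v rot x)" using abs_cr_le by (meson abs_le_D1)
  also have "\<dots> \<le> norm (A *v x) * (op_norm A * norm x)"
    using norm_mv_le[of A "rot x"] by (intro mult_left_mono) auto
  finally show ?thesis using False by (simp add: power2_eq_square mult.commute)
qed simp

lemma op_norm_ge_1: assumes "det A = 1" shows "1 \<le> op_norm A"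
proof -
  have "norm (axis 1 1 :: real^2) \<le> op_norm A * (op_norm A * norm (axis 1 1 :: real^2))"
    using norm_le_op_norm_mv[OF assms] norm_mv_le[of A] mult_left_mono[OF _ op_norm_nonneg]
    by (meson order_trans)
  hence "1 \<le> (op_norm A)\<^sup>2" by (simp add: power2_eq_square)
  thus ?thesis by (metis one_power2 op_norm_nonneg power2_le_imp_le)
qed

lemma mv_nonzero: "det A = 1 \<Longrightarrow> x \<noteq> 0 \<Longrightarrow> A *v x \<noteq> 0" for A :: "real^2^2"
  using norm_le_op_norm_mv[of A x] by auto

text \<open>The rows of \<open>A\<close>, rotated, are the columns of the inverse; the longer one is mapped to a
  coordinate vector, so its direction is contracted almost as strongly as possible.\<close>

lemma contracted_direction:
  assumes "det A = 1"
  obtains s :: "real^2" where "norm s = 1" "norm (A *v s) * op_norm A \<le> 2"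
proof -
  have f: "(norm A)\<^sup>2 = (norm (A $ 1))\<^sup>2 + (norm (A $ 2))\<^sup>2"
    by (simp add: norm_vec_def[of A] L2_set_def sum_2)
  obtain i :: 2 where i: "(norm A)\<^sup>2 \<le> 2 * (norm (A $ i))\<^sup>2"
  proof (cases "(norm (A $ 1))\<^sup>2 \<le> (norm (A $ 2))\<^sup>2")
    case True thus ?thesis using f that[of 2] by linarith
  next
    case False thus ?thesis using f that[of 1] by linarith
  qed
  define r where "r = rot (A $ i)"
  have Ar: "norm (A *v r) = 1"
  proof -
    have "i = 1 \<or> i = 2" by (metis exhaust_2)
    moreover have "(norm (A *v r))\<^sup>2 = 1" if "i = 1"
    proof -
      have "(A *v r) $ 1 = 0" "(A *v r) $ 2 = 1" using assms that unfolding r_def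
        by (simp_all add: mv_2 rot_def det_2 algebra_simps)
      thus ?thesis unfolding norm_sq_2 by simp
    qed
    moreover have "(norm (A *v r))\<^sup>2 = 1" if "i = 2"
    proof -
      have "(A *v r) $ 1 = -1" "(A *v r) $ 2 = 0" using assms that unfolding r_def
        by (simp_all add: mv_2 rot_def det_2 algebra_simps)
      thus ?thesis unfolding norm_sq_2 by simp
    qed
    ultimately show ?thesis by (metis norm_ge_zero power2_eq_imp_eq one_power2 zero_le_one)
  qed
  have rn: "norm r = norm (A $ i)" by (simp add: r_def)
  have "norm A \<le> 2 * norm r"
  proof -
    have "(2 * norm r)\<^sup>2 = 4 * (norm (A $ i))\<^sup>2" by (simp add: rn power_mult_distrib)
    hence "(norm A)\<^sup>2 \<le> (2 * norm r)\<^sup>2" using i zero_le_power2[of "norm (A $ i)"] by linarith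
    thus ?thesis by (rule power2_le_imp_le) simp
  qed
  hence op: "op_norm A \<le> 2 * norm r" using op_norm_le_frob[of A] by simp
  have rp: "norm r > 0" using op op_norm_ge_1[OF assms] by linarith
  show ?thesis
  proof
    show "norm ((1 / norm r) *\<^sub>R r) = 1" using rp by simp
    show "norm (A *v ((1 / norm r) *\<^sub>R r)) * op_norm A \<le> 2"
      using op rp Ar by (simp add: matrix_vector_mult_scaleR field_simps)
  qed
qed

text \<open>If \<open>x\<close> and \<open>y\<close> are almost parallel, then \<open>B\<close> stretches \<open>x\<close> almost as much as \<open>y\<close>.\<close>

lemma norm_mv_parallel:
  "norm (B *v y) * norm x \<le> norm y * norm (B *v x) + \<bar>cr x y\<bar> * op_norm B"
proof (cases "x = 0")
  case False
  have "(norm x)\<^sup>2 *\<^sub>R (B *v y) = (x \<bullet> y) *\<^sub>R (B *v x) + cr x y *\<^sub>R (B *v rot x)"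
    by (metis orthogonal_decomposition matrix_vector_mult_scaleR matrix_vector_right_distrib)
  hence "(norm x)\<^sup>2 * norm (B *v y) = norm ((x \<bullet> y) *\<^sub>R (B *v x) + cr x y *\<^sub>R (B *v rot x))"
    by (metis norm_scaleR abs_power2)
  also have "\<dots> \<le> \<bar>x \<bullet> y\<bar> * norm (B *v x) + \<bar>cr x y\<bar> * norm (B *v rot x)"
    by (metis norm_scaleR norm_triangle_ineq)
  also have "\<dots> \<le> (norm x * norm y) * norm (B *v x) + \<bar>cr x y\<bar> * (op_norm B * norm x)"
    using norm_mv_le[of B "rot x"]
    by (intro add_mono mult_right_mono mult_left_mono Cauchy_Schwarz_ineq2) auto
  finally have "(norm (B *v y) * norm x) * norm x
      \<le> (norm y * norm (B *v x) + \<bar>cr x y\<bar> * op_norm B) * norm x"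
    by (simp add: power2_eq_square algebra_simps)
  thus ?thesis using False by simp
qed auto

section \<open>Products of matrices\<close>

primrec mprod :: "(nat \<Rightarrow> real^2^2) \<Rightarrow> nat \<Rightarrow> real^2^2" where
  "mprod A 0 = mat 1"
| "mprod A (Suc n) = A n ** mprod A n"

lemma mprod_add: "mprod A (m + n) = mprod (\<lambda>i. A (m + i)) n ** mprod A m"
  by (induction n) (simp_all add: matrix_mul_assoc)

lemma mprod_add_mv: "mprod A (m + n) *v v = mprod (\<lambda>i. A (m + i)) n *v (mprod A m *v v)"
  by (simp add: mprod_add matrix_vector_mul_assoc)

lemma mprod_Suc_mv: "mprod A (Suc n) *v v = A n *v (mprod A n *v v)"
  by (simp add: matrix_vector_mul_assoc)

lemma mprod_cong: "(\<And>i. i < n \<Longrightarrow> A i = B i) \<Longrightarrow> mprod A n = mprod B n"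
  by (induction n) auto

lemma det_mprod: "(\<And>i. det (A i) = 1) \<Longrightarrow> det (mprod A n) = 1"
  by (induction n) (auto simp: det_mul)

lemma op_norm_mat_1: "op_norm (mat 1) \<le> 1"
  by (rule op_norm_le) simp

lemma op_norm_mprod:
  assumes "\<And>i. op_norm (A i) \<le> C" shows "op_norm (mprod A n) \<le> C ^ n"
proof (induction n)
  case 0 show ?case using op_norm_mat_1 by simp
next
  case (Suc n)
  have "op_norm (mprod A (Suc n)) \<le> op_norm (A n) * op_norm (mprod A n)"
    by (simp add: op_norm_mult)
  also have "\<dots> \<le> C * C ^ n"
    using order_trans[OF op_norm_nonneg assms] by (intro mult_mono assms Suc) auto
  finally show ?case by simp
qed

lemma T_eq_mprod: "T F a \<omega> n = mprod (\<lambda>i. F (\<omega> (Suc i)) a) n"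
  by (induction n) auto

section \<open>Rotation of the image of a vector as the parameter varies\<close>

definition dir :: "real \<Rightarrow> real^2" where "dir t = vector [cos t, sin t]"

lemma dir_nth [simp]: "dir t $ 1 = cos t" "dir t $ 2 = sin t"
  by (simp_all add: dir_def)

lemma norm_dir [simp]: "norm (dir t) = 1"
proof -
  have "(norm (dir t))\<^sup>2 = 1" by (simp add: norm_sq_2)
  thus ?thesis by (metis norm_ge_zero power2_eq_imp_eq one_power2 zero_le_one)
qed

lemma cr_dir: "cr (dir s) (dir t) = sin (t - s)"
  by (simp add: cr_def sin_diff)

text \<open>The angle is the imaginary part of a continuous logarithm, which exists because an interval is
  contractible.\<close>

lemma polar_lift:
  fixes w :: "real \<Rightarrow> real^2"
  assumes c: "continuous_on {\<alpha>..\<beta>} w" and nz: "\<And>a. a \<in> {\<alpha>..\<beta>} \<Longrightarrow> w a \<noteq> 0"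
  obtains y where "continuous_on {\<alpha>..\<beta>} y" "\<And>a. a \<in> {\<alpha>..\<beta>} \<Longrightarrow> w a = norm (w a) *\<^sub>R dir (y a)"
proof -
  define f where "f a = Complex (w a $ 1) (w a $ 2)" for a
  have f_eq: "f a = of_real (w a $ 1) + \<i> * of_real (w a $ 2)" for a
    by (simp add: f_def complex_eq_iff)
  have "continuous_on {\<alpha>..\<beta>} f"
    unfolding f_eq by (intro continuous_intros c)
  moreover have "f a \<noteq> 0" if "a \<in> {\<alpha>..\<beta>}" for a
    using nz[OF that] by (auto simp: f_def complex_eq_iff vec2_eq_iff)
  ultimately obtain g where g: "continuous_on {\<alpha>..\<beta>} g" "\<And>a. a \<in> {\<alpha>..\<beta>} \<Longrightarrow> f a = exp (g a)"
    using continuous_logarithm_on_contractible[of "{\<alpha>..\<beta>}" f] convex_imp_contractible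
    by (metis convex_real_interval(5))
  show ?thesis
  proof
    show "continuous_on {\<alpha>..\<beta>} (\<lambda>a. Im (g a))" by (intro continuous_intros g)
    fix a assume a: "a \<in> {\<alpha>..\<beta>}"
    have 1: "w a $ 1 = exp (Re (g a)) * cos (Im (g a))" "w a $ 2 = exp (Re (g a)) * sin (Im (g a))"
      using g(2)[OF a] by (simp_all add: f_def complex_eq_iff Re_exp Im_exp)
    hence w: "w a = exp (Re (g a)) *\<^sub>R dir (Im (g a))" by (simp add: vec2_eq_iff)
    hence "norm (w a) = exp (Re (g a))" by (metis abs_exp_cancel mult.right_neutral norm_dir norm_scaleR)
    with w show "w a = norm (w a) *\<^sub>R dir (Im (g a))" by simp
  qed
qed

text \<open>By continuity the set of points in \<open>{a..b}\<close> at which \<open>y\<close> is at least \<open>y a\<close> has a greatest element;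
  local growth at that element shows that it is \<open>b\<close>.\<close>

lemma mono_on_if_locally_increasing:
  fixes y :: "real \<Rightarrow> real"
  assumes c: "continuous_on {\<alpha>..\<beta>} y"
    and loc: "\<And>a. \<alpha> \<le> a \<Longrightarrow> a < \<beta> \<Longrightarrow> eventually (\<lambda>x. y a \<le> y x) (at_right a)"
  shows "mono_on {\<alpha>..\<beta>} y"
proof (rule mono_onI)
  fix a b assume ab: "a \<in> {\<alpha>..\<beta>}" "b \<in> {\<alpha>..\<beta>}" "a \<le> b"
  show "y a \<le> y b"
  proof (rule ccontr)
    assume n: "\<not> y a \<le> y b"
    define S where "S = {x \<in> {a..b}. y a \<le> y x}"
    have "continuous_on {a..b} y" using c ab by (auto intro: continuous_on_subset)
    hence "closed ({a..b} \<inter> y -` {y a..})"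
      by (rule continuous_closed_preimage) auto
    hence "compact ({a..b} \<inter> ({a..b} \<inter> y -` {y a..}))" by (intro compact_Int_closed) auto
    moreover have "S = {a..b} \<inter> ({a..b} \<inter> y -` {y a..})" by (auto simp: S_def)
    ultimately have "compact S" by simp
    moreover have "S \<noteq> {}" using ab by (auto simp: S_def)
    ultimately obtain s where s: "s \<in> S" "\<And>x. x \<in> S \<Longrightarrow> x \<le> s"
      using compact_attains_sup by metis
    have "s < b" using s(1) n by (auto simp: S_def order.order_iff_strict)
    have "eventually (\<lambda>x. y s \<le> y x) (at_right s)"
      using s(1) \<open>s < b\<close> ab by (intro loc) (auto simp: S_def)
    moreover have "eventually (\<lambda>x. x \<in> {s<..<b}) (at_right s)"
      using \<open>s < b\<close> by (rule eventually_at_right_real)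
    ultimately have "eventually (\<lambda>x. y s \<le> y x \<and> x \<in> {s<..<b}) (at_right s)"
      by (rule eventually_conj)
    then obtain x where "y s \<le> y x" "s < x" "x < b"
      using eventually_happens by force
    moreover from this have "x \<in> S" using s(1) by (auto simp: S_def)
    ultimately show False using s(2) by force
  qed
qed

lemma at_right_quotient:
  fixes f :: "real \<Rightarrow> 'a::real_normed_vector"
  assumes f: "(f has_vector_derivative D) (at a within {\<alpha>..\<beta>})" and a: "\<alpha> \<le> a" "a < \<beta>"
  shows "((\<lambda>x. (1 / (x - a)) *\<^sub>R (f x - f a)) \<longlongrightarrow> D) (at_right a)"
proof -
  have "(f has_vector_derivative D) (at a within {a..\<beta>})"
    by (rule has_vector_derivative_within_subset[OF f]) (use a in auto)
  hence "(f has_vector_derivative D) (at_right a)"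
    using a by (simp add: at_within_Icc_at_right)
  hence 1: "((\<lambda>x. (f x - f a - (x - a) *\<^sub>R D) /\<^sub>R norm (x - a)) \<longlongrightarrow> 0) (at_right a)"
    unfolding has_vector_derivative_def has_derivative_at_within by simp
  have "(f x - f a - (x - a) *\<^sub>R D) /\<^sub>R norm (x - a) = (1 / (x - a)) *\<^sub>R (f x - f a) - D" if "x > a" for x
    using that by (simp add: scaleR_diff_right[of _ _ "(x - a) *\<^sub>R D"] divide_inverse)
  hence "((\<lambda>x. (1 / (x - a)) *\<^sub>R (f x - f a) - D) \<longlongrightarrow> 0) (at_right a)"
    by (intro Lim_transform_eventually[OF 1]) (auto simp: eventually_at_filter)
  thus ?thesis by (rule LIM_zero_cancel)
qed

lemma tendsto_cr [tendsto_intros]: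
  assumes "(f \<longlongrightarrow> x) G" "(g \<longlongrightarrow> y) G" shows "((\<lambda>t. cr (f t) (g t)) \<longlongrightarrow> cr x y) G"
  unfolding cr_def by (intro tendsto_intros assms)

lemma tendsto_mv [tendsto_intros]:
  assumes "(f \<longlongrightarrow> A) G" "(g \<longlongrightarrow> (y::real^2)) G" shows "((\<lambda>t. f t *v g t) \<longlongrightarrow> (A::real^2^2) *v y) G"
proof (rule vec_tendstoI)
  fix i show "((\<lambda>t. (f t *v g t) $ i) \<longlongrightarrow> (A *v y) $ i) G"
    unfolding mv_2 by (intro tendsto_intros assms)
qed

lemma continuous_on_mv [continuous_intros]:
  assumes "continuous_on X f" "continuous_on X (g :: _ \<Rightarrow> real^2)"
  shows "continuous_on X (\<lambda>t. (f t :: real^2^2) *v g t)"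
  using assms unfolding continuous_on_def by (auto intro: tendsto_mv)

text \<open>By \<open>pos\<close>, every factor turns every vector counterclockwise as the parameter increases; \<open>total\<close> bounds
  by how much a single factor turns the vector \<open>dir 0\<close>.\<close>

locale rotating_product =
  fixes \<alpha> \<beta> \<Theta> :: real and A D :: "nat \<Rightarrow> real \<Rightarrow> real^2^2" and w
  assumes ab: "\<alpha> < \<beta>"
    and det1: "\<And>i a. a \<in> {\<alpha>..\<beta>} \<Longrightarrow> det (A i a) = 1"
    and deriv: "\<And>i a. a \<in> {\<alpha>..\<beta>} \<Longrightarrow> (A i has_vector_derivative D i a) (at a within {\<alpha>..\<beta>})"
    and pos: "\<And>i a v. a \<in> {\<alpha>..\<beta>} \<Longrightarrow> v \<noteq> 0 \<Longrightarrow> cr (A i a *v v) (D i a *v v) > 0"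
    and total: "\<And>i. \<exists>\<theta>. continuous_on {\<alpha>..\<beta>} \<theta> \<and>
        (\<forall>a\<in>{\<alpha>..\<beta>}. A i a *v dir 0 = norm (A i a *v dir 0) *\<^sub>R dir (\<theta> a)) \<and> \<theta> \<beta> - \<theta> \<alpha> \<le> \<Theta>"
  defines "w \<equiv> \<lambda>n a. mprod (\<lambda>i. A i a) n *v dir 0"
begin

lemma w_0: "w 0 a = dir 0" by (simp add: w_def)

lemma w_Suc: "w (Suc n) a = A n a *v w n a" by (simp add: w_def mprod_Suc_mv del: mprod.simps)

lemma cont_A: "continuous_on {\<alpha>..\<beta>} (A i)"
  using deriv has_vector_derivative_continuous continuous_on_eq_continuous_within by blast

lemma cont_w: "continuous_on {\<alpha>..\<beta>} (w n)"
proof (induction n)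
  case (Suc n) thus ?case unfolding w_Suc by (intro continuous_intros cont_A)
qed (simp add: w_0)

lemma w_nz: "a \<in> {\<alpha>..\<beta>} \<Longrightarrow> w n a \<noteq> 0"
proof (induction n)
  case 0 thus ?case using norm_dir[of 0] by (auto simp: w_0 simp del: norm_dir)
next
  case (Suc n) thus ?case by (simp add: w_Suc mv_nonzero det1)
qed

lemma tendsto_w: assumes "\<alpha> \<le> a" "a < \<beta>" shows "(w n \<longlongrightarrow> w n a) (at_right a)"
proof -
  have "(w n \<longlongrightarrow> w n a) (at a within {\<alpha>..\<beta>})"
    using cont_w assms by (auto simp: continuous_on_def)
  hence "(w n \<longlongrightarrow> w n a) (at a within {a..\<beta>})"
    by (rule tendsto_within_subset) (use assms in auto)
  thus ?thesis using assms by (simp add: at_within_Icc_at_right)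
qed

text \<open>To first order, \<open>w (Suc n) a\<close> is turned by the turning of \<open>w n a\<close> and by the change of the
  last factor; both have the same sign.\<close>

lemma w_turns_left:
  assumes a: "\<alpha> \<le> a" "a < \<beta>"
  shows "eventually (\<lambda>x. cr (w n a) (w n x) \<ge> 0) (at_right a)"
proof (induction n)
  case 0 show ?case by (simp add: w_0)
next
  case (Suc n)
  let ?q = "\<lambda>x. cr (A n a *v w n a) (((1 / (x - a)) *\<^sub>R (A n x - A n a)) *v w n x)"
  have "(?q \<longlongrightarrow> cr (A n a *v w n a) (D n a *v w n a)) (at_right a)"
    using a by (intro tendsto_intros tendsto_w at_right_quotient[OF deriv]) auto
  hence "eventually (\<lambda>x. ?q x > 0) (at_right a)"
    by (rule order_tendstoD(1)) (use a w_nz pos in auto)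
  moreover have "eventually (\<lambda>x. x \<in> {a<..<\<beta>}) (at_right a)"
    using \<open>a < \<beta>\<close> by (rule eventually_at_right_real)
  ultimately show ?case using Suc.IH
  proof eventually_elim
    case (elim x)
    have 1: "0 < x - a" using elim by simp
    have "(A n x - A n a) *v w n x = (x - a) *\<^sub>R (((1 / (x - a)) *\<^sub>R (A n x - A n a)) *v w n x)"
      using 1 by (simp add: scaleR_matrix_vector_assoc)
    hence "cr (A n a *v w n a) ((A n x - A n a) *v w n x) = (x - a) * ?q x"
      by (metis cr_scale(2))
    hence 2: "cr (A n a *v w n a) ((A n x - A n a) *v w n x) > 0" using 1 elim by simp
    have "cr (w (Suc n) a) (w (Suc n) x)
        = cr (A n a *v w n a) (A n a *v w n x) + cr (A n a *v w n a) ((A n x - A n a) *v w n x)"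
      by (simp add: w_Suc cr_add[symmetric] matrix_vector_mult_diff_rdistrib)
    also have "cr (A n a *v w n a) (A n a *v w n x) = cr (w n a) (w n x)"
      using det1 a by (simp add: cr_matrix)
    finally show ?case using 2 elim by simp
  qed
qed

text \<open>An angle that fell slightly below \<open>y a\<close> to the right of \<open>a\<close> would make the area spanned by \<open>w n a\<close> and
  \<open>w n x\<close> negative, contrary to \<open>w_turns_left\<close>.\<close>

lemma lift_mono:
  assumes c: "continuous_on {\<alpha>..\<beta>} y" and y: "\<And>a. a \<in> {\<alpha>..\<beta>} \<Longrightarrow> w n a = norm (w n a) *\<^sub>R dir (y a)"
  shows "mono_on {\<alpha>..\<beta>} y"
proof (rule mono_on_if_locally_increasing[OF c])
  fix a assume a: "\<alpha> \<le> a" "a < \<beta>"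
  have "(y \<longlongrightarrow> y a) (at a within {\<alpha>..\<beta>})" using c a by (auto simp: continuous_on_def)
  hence "(y \<longlongrightarrow> y a) (at a within {a..\<beta>})" by (rule tendsto_within_subset) (use a in auto)
  hence "(y \<longlongrightarrow> y a) (at_right a)" using a by (simp add: at_within_Icc_at_right)
  hence "eventually (\<lambda>x. y x > y a - pi) (at_right a)"
    using order_tendstoD(1)[of y "y a" _ "y a - pi"] pi_gt_zero by simp
  moreover have "eventually (\<lambda>x. x \<in> {a<..<\<beta>}) (at_right a)"
    using \<open>a < \<beta>\<close> by (rule eventually_at_right_real)
  ultimately show "eventually (\<lambda>x. y a \<le> y x) (at_right a)" using w_turns_left[OF a, of n]
  proof eventually_elim
    case (elim x)
    show ?case
    proof (rule ccontr)
      assume "\<not> y a \<le> y x"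
      hence "sin (y a - y x) > 0" using elim by (intro sin_gt_zero) auto
      hence s: "sin (y x - y a) < 0" by (metis minus_diff_eq neg_less_0_iff_less sin_minus)
      have ax: "a \<in> {\<alpha>..\<beta>}" "x \<in> {\<alpha>..\<beta>}" using a elim by auto
      have "cr (w n a) (w n x) = norm (w n a) * (norm (w n x) * sin (y x - y a))"
        using y[OF ax(1)] y[OF ax(2)] by (metis cr_dir cr_scale)
      also have "\<dots> < 0" using s w_nz[OF ax(1)] w_nz[OF ax(2)] by (simp add: mult_pos_neg)
      finally show False using elim by simp
    qed
  qed
qed

text \<open>The angle of \<open>A n a *v w n a\<close> relative to \<open>A n a *v dir 0\<close> and the angle of \<open>w n a\<close> relative to
  \<open>dir 0\<close> never differ by an odd multiple of \<open>pi\<close>, because \<open>A n a\<close> is linear and preserves the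
  orientation. By continuity their difference changes by less than \<open>2 * pi\<close> over the interval, so each
  factor adds at most \<open>\<Theta> + 2 * pi\<close> to the total rotation.\<close>

lemma lift_total:
  "\<exists>y. continuous_on {\<alpha>..\<beta>} y \<and> (\<forall>a\<in>{\<alpha>..\<beta>}. w n a = norm (w n a) *\<^sub>R dir (y a)) \<and>
     y \<beta> - y \<alpha> \<le> real n * (\<Theta> + 2 * pi)"
proof (induction n)
  case 0 show ?case by (intro exI[of _ "\<lambda>_. 0"]) (simp add: w_0)
next
  case (Suc n)
  then obtain y where y: "continuous_on {\<alpha>..\<beta>} y" "\<And>a. a \<in> {\<alpha>..\<beta>} \<Longrightarrow> w n a = norm (w n a) *\<^sub>R dir (y a)"
    "y \<beta> - y \<alpha> \<le> real n * (\<Theta> + 2 * pi)" by blast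
  obtain \<theta> where th: "continuous_on {\<alpha>..\<beta>} \<theta>" "\<theta> \<beta> - \<theta> \<alpha> \<le> \<Theta>"
    "\<And>a. a \<in> {\<alpha>..\<beta>} \<Longrightarrow> A n a *v dir 0 = norm (A n a *v dir 0) *\<^sub>R dir (\<theta> a)" using total[of n] by blast
  obtain z where z: "continuous_on {\<alpha>..\<beta>} z"
    "\<And>a. a \<in> {\<alpha>..\<beta>} \<Longrightarrow> w (Suc n) a = norm (w (Suc n) a) *\<^sub>R dir (z a)"
    using polar_lift[OF cont_w w_nz] by metis
  define g where "g a = z a - \<theta> a - y a" for a
  have odd: "g a \<noteq> of_int (2 * m + 1) * pi" if a: "a \<in> {\<alpha>..\<beta>}" for a and m :: int
  proof
    assume "g a = of_int (2 * m + 1) * pi"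
    hence q: "z a - \<theta> a = (y a + pi) + 2 * of_int m * pi" by (simp add: g_def algebra_simps)
    have sn: "sin (z a - \<theta> a) = - sin (y a)" and cs: "cos (z a - \<theta> a) = - cos (y a)"
      using sin_int_2pin[of m] cos_int_2pin[of m] unfolding q
      by (simp_all add: sin_add cos_add mult.commute mult.left_commute)
    define p where "p = norm (A n a *v dir 0)"
    have dn: "dir 0 \<noteq> 0" using norm_dir[of 0] by (auto simp del: norm_dir)
    have p: "p > 0" using dn mv_nonzero[OF det1[OF a]] by (simp add: p_def)
    have r: "norm (w n a) > 0" "norm (w (Suc n) a) > 0" using w_nz[OF a] by simp_all
    have "p * (norm (w (Suc n) a) * sin (z a - \<theta> a)) = cr (A n a *v dir 0) (w (Suc n) a)"
      using th(3)[OF a] z(2)[OF a] unfolding p_def by (metis cr_dir cr_scale)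
    also have "\<dots> = cr (dir 0) (w n a)" unfolding w_Suc using det1[OF a] by (simp add: cr_matrix)
    also have "\<dots> = norm (w n a) * sin (y a)"
      using y(2)[OF a] by (metis cr_dir cr_scale(2) diff_zero)
    finally have s: "p * (norm (w (Suc n) a) * (- sin (y a))) = norm (w n a) * sin (y a)" unfolding sn .
    have s0: "sin (y a) = 0"
    proof -
      have "(p * norm (w (Suc n) a) + norm (w n a)) * sin (y a) = 0" using s by (simp add: algebra_simps)
      moreover have "p * norm (w (Suc n) a) + norm (w n a) > 0" using p r by (simp add: add_pos_pos)
      ultimately show ?thesis by simp
    qed
    have d: "dir (y a) = cos (y a) *\<^sub>R dir 0" using s0 by (simp add: vec2_eq_iff)
    have "w (Suc n) a = (norm (w n a) * cos (y a)) *\<^sub>R (A n a *v dir 0)"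
      unfolding w_Suc using y(2)[OF a] d by (metis matrix_vector_mult_scaleR scaleR_scaleR)
    hence e: "norm (w (Suc n) a) *\<^sub>R dir (z a) = (norm (w n a) * cos (y a) * p) *\<^sub>R dir (\<theta> a)"
      using z(2)[OF a] th(3)[OF a] unfolding p_def by (metis scaleR_scaleR)
    have "norm (w (Suc n) a) * cos (z a - \<theta> a) = norm (w n a) * cos (y a) * p"
    proof -
      have "norm (w (Suc n) a) * cos (z a) = (norm (w n a) * cos (y a) * p) * cos (\<theta> a)"
           "norm (w (Suc n) a) * sin (z a) = (norm (w n a) * cos (y a) * p) * sin (\<theta> a)"
        using arg_cong[OF e, of "\<lambda>v. v $ 1"] arg_cong[OF e, of "\<lambda>v. v $ 2"] by simp_all
      note zz = this
      have "norm (w (Suc n) a) * cos (z a - \<theta> a)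
          = (norm (w (Suc n) a) * cos (z a)) * cos (\<theta> a) + (norm (w (Suc n) a) * sin (z a)) * sin (\<theta> a)"
        by (simp add: cos_diff algebra_simps)
      also have "\<dots> = (norm (w n a) * cos (y a) * p) * ((cos (\<theta> a))\<^sup>2 + (sin (\<theta> a))\<^sup>2)"
        unfolding zz by algebra
      finally show ?thesis by simp
    qed
    hence "(norm (w (Suc n) a) + norm (w n a) * p) * cos (y a) = 0" unfolding cs by (simp add: algebra_simps)
    moreover have "norm (w (Suc n) a) + norm (w n a) * p > 0" using p r by (simp add: add_pos_pos)
    ultimately have "cos (y a) = 0" by simp
    with s0 show False using sin_cos_squared_add[of "y a"] by simp
  qed
  have cg: "continuous_on {\<alpha>..\<beta>} g" unfolding g_def by (intro continuous_intros z th y)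
  have "g \<beta> - g \<alpha> < 2 * pi"
  proof (rule ccontr)
    assume big: "\<not> ?thesis"
    define m where "m = \<lceil>(g \<alpha> / pi - 1) / 2\<rceil>"
    have "(g \<alpha> / pi - 1) / 2 \<le> of_int m" "of_int m < (g \<alpha> / pi - 1) / 2 + 1"
      unfolding m_def by linarith+
    hence "g \<alpha> \<le> of_int (2 * m + 1) * pi" "of_int (2 * m + 1) * pi \<le> g \<alpha> + 2 * pi"
      using pi_gt_zero by (simp_all add: field_simps)
    hence "\<exists>x\<ge>\<alpha>. x \<le> \<beta> \<and> g x = of_int (2 * m + 1) * pi"
      using big ab cg by (intro IVT') auto
    thus False using odd by auto
  qed
  hence "z \<beta> - z \<alpha> \<le> real (Suc n) * (\<Theta> + 2 * pi)"
    using y(3) th(2) unfolding g_def by (simp add: algebra_simps)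
  thus ?case using z by blast
qed

text \<open>A cell in which the direction of \<open>w n\<close> moves by an angle of sine larger than \<open>\<eta>\<close> uses up more
  than \<open>\<eta>\<close> of the total rotation.\<close>

lemma rotation_count:
  assumes b: "\<And>i. i \<le> N \<Longrightarrow> b i \<in> {\<alpha>..\<beta>}" "\<And>i. i < N \<Longrightarrow> b i \<le> b (Suc i)" and \<eta>: "\<eta> > 0"
  shows "real (card {i. i < N \<and> (\<exists>a\<in>{b i..b (Suc i)}. \<bar>cr (w n (b i)) (w n a)\<bar> > \<eta> * norm (w n (b i)) * norm (w n a))})
     \<le> real n * (\<Theta> + 2 * pi) / \<eta>"
proof -
  obtain y where y: "continuous_on {\<alpha>..\<beta>} y" "\<And>a. a \<in> {\<alpha>..\<beta>} \<Longrightarrow> w n a = norm (w n a) *\<^sub>R dir (y a)"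
    "y \<beta> - y \<alpha> \<le> real n * (\<Theta> + 2 * pi)" using lift_total[of n] by blast
  have m: "mono_on {\<alpha>..\<beta>} y" using y by (intro lift_mono)
  let ?X = "{i. i < N \<and> (\<exists>a\<in>{b i..b (Suc i)}. \<bar>cr (w n (b i)) (w n a)\<bar> > \<eta> * norm (w n (b i)) * norm (w n a))}"
  have big: "\<eta> \<le> y (b (Suc i)) - y (b i)" if "i \<in> ?X" for i
  proof -
    from that obtain a where a: "i < N" "a \<in> {b i..b (Suc i)}"
      "\<bar>cr (w n (b i)) (w n a)\<bar> > \<eta> * norm (w n (b i)) * norm (w n a)" by blast
    have i: "b i \<in> {\<alpha>..\<beta>}" "b (Suc i) \<in> {\<alpha>..\<beta>}" using a(1) b(1)[of i] b(1)[of "Suc i"] by auto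
    hence ax: "a \<in> {\<alpha>..\<beta>}" using a(2) by auto
    have "\<bar>cr (w n (b i)) (w n a)\<bar> = \<bar>norm (w n (b i)) * (norm (w n a) * sin (y a - y (b i)))\<bar>"
      using y(2)[OF i(1)] y(2)[OF ax] by (metis cr_dir cr_scale)
    hence "\<eta> * (norm (w n (b i)) * norm (w n a)) < \<bar>sin (y a - y (b i))\<bar> * (norm (w n (b i)) * norm (w n a))"
      using a(3) by (simp add: abs_mult algebra_simps)
    hence "\<eta> < \<bar>sin (y a - y (b i))\<bar>"
      by (rule mult_right_less_imp_less) simp
    also have "\<dots> \<le> \<bar>y a - y (b i)\<bar>" by (rule abs_sin_x_le_abs_x)
    also have "\<dots> \<le> y (b (Suc i)) - y (b i)"
      using mono_onD[OF m i(1) ax] mono_onD[OF m ax i(2)] a(2) by auto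
    finally show ?thesis by simp
  qed
  have "\<eta> * real (card ?X) = (\<Sum>i\<in>?X. \<eta>)" by simp
  also have "\<dots> \<le> (\<Sum>i\<in>?X. y (b (Suc i)) - y (b i))" by (rule sum_mono) (use big in blast)
  also have "\<dots> \<le> (\<Sum>i<N. y (b (Suc i)) - y (b i))"
  proof (rule sum_mono2)
    fix i assume "i \<in> {..<N} - ?X"
    hence "i < N" by simp
    thus "0 \<le> y (b (Suc i)) - y (b i)"
      using mono_onD[OF m, of "b i" "b (Suc i)"] b(1)[of i] b(1)[of "Suc i"] b(2)[of i] by simp
  qed auto
  also have "\<dots> = y (b N) - y (b 0)" by (rule sum_lessThan_telescope)
  also have "\<dots> \<le> y \<beta> - y \<alpha>"
    using mono_onD[OF m, of "b N" \<beta>] mono_onD[OF m, of \<alpha> "b 0"] b(1)[of N] b(1)[of 0] ab by auto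
  finally show ?thesis using y(3) \<eta> by (simp add: field_simps)
qed

end

section \<open>Growth of a fixed vector under a random product\<close>

lemma continuous_on_mm [continuous_intros]:
  assumes "continuous_on X f" "continuous_on X g"
  shows "continuous_on X (\<lambda>t. (f t :: real^2^2) ** (g t :: real^2^2))"
proof -
  have "((\<lambda>t. f t ** g t) \<longlongrightarrow> f x ** g x) (at x within X)" if "x \<in> X" for x
  proof (intro vec_tendstoI)
    fix i j
    have "((\<lambda>t. f t) \<longlongrightarrow> f x) (at x within X)" "((\<lambda>t. g t) \<longlongrightarrow> g x) (at x within X)"
      using assms that by (auto simp: continuous_on_def)
    thus "((\<lambda>t. (f t ** g t) $ i $ j) \<longlongrightarrow> (f x ** g x) $ i $ j) (at x within X)"
      unfolding matrix_matrix_mult_def by (auto simp: sum_2 intro!: tendsto_intros)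
  qed
  thus ?thesis by (auto simp: continuous_on_def)
qed

lemma borel_measurable_mm [measurable]:
  assumes [measurable]: "f \<in> borel_measurable N" "g \<in> borel_measurable N"
  shows "(\<lambda>x. (f x :: real^2^2) ** (g x :: real^2^2)) \<in> borel_measurable N"
  by (rule borel_measurable_continuous_Pair[of f N g "(**)"]) (auto intro!: continuous_intros)

lemma borel_measurable_mv [measurable]:
  assumes [measurable]: "f \<in> borel_measurable N" "g \<in> borel_measurable N"
  shows "(\<lambda>x. (f x :: real^2^2) *v (g x :: real^2)) \<in> borel_measurable N"
  by (rule borel_measurable_continuous_Pair[of f N g "(*v)"]) (auto intro!: continuous_intros)

lemma borel_measurable_cr [measurable]:
  assumes [measurable]: "f \<in> borel_measurable N" "g \<in> borel_measurable N"
  shows "(\<lambda>x. cr (f x) (g x)) \<in> borel_measurable N"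
  by (rule borel_measurable_continuous_Pair[of f N g "cr"])
     (auto simp: cr_def intro!: continuous_intros)

lemma cr_zero_imp_scale:
  assumes "cr x y = 0" "x \<noteq> 0" shows "\<exists>c. y = c *\<^sub>R x"
proof -
  have "(norm x)\<^sup>2 *\<^sub>R y = (x \<bullet> y) *\<^sub>R x" using assms by (simp add: orthogonal_decomposition)
  hence "y = ((x \<bullet> y) / (norm x)\<^sup>2) *\<^sub>R x"
    using assms by (metis (no_types) divide_inverse mult.commute norm_eq_zero power_not_zero
      real_vector_eq_affinity scaleR_scaleR vector_fraction_eq_iff)
  thus ?thesis ..
qed

lemma span_singleton_eq_iff:
  fixes x y :: "real^2" assumes "x \<noteq> 0" "y \<noteq> 0"
  shows "span {x} = span {y} \<longleftrightarrow> (\<exists>c. c \<noteq> 0 \<and> y = c *\<^sub>R x)"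
proof
  assume "span {x} = span {y}"
  hence "y \<in> span {x}" by (simp add: span_base)
  then obtain c where "y = c *\<^sub>R x" by (auto simp: span_singleton)
  thus "\<exists>c. c \<noteq> 0 \<and> y = c *\<^sub>R x" using assms by auto
next
  assume "\<exists>c. c \<noteq> 0 \<and> y = c *\<^sub>R x"
  then obtain c where c: "c \<noteq> 0" "y = c *\<^sub>R x" by blast
  show "span {x} = span {y}"
  proof (rule antisym)
    have "x = (1 / c) *\<^sub>R y" using c by simp
    hence "x \<in> span {y}" by (metis insertI1 span_base span_scale)
    thus "span {x} \<subseteq> span {y}" by (intro span_minimal subspace_span) auto
    have "y \<in> span {x}" using c(2) by (metis insertI1 span_base span_scale)
    thus "span {y} \<subseteq> span {x}" by (intro span_minimal subspace_span) auto
  qed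
qed

text \<open>For positive \<open>f\<close> this says \<open>liminf (ln (f n) / n) < l\<close>. The quantifiers are countable, so that the
  sequences along which a vector is slow form a measurable set.\<close>

definition slow :: "real \<Rightarrow> (nat \<Rightarrow> real) \<Rightarrow> bool" where
  "slow l f \<longleftrightarrow> (\<exists>k::nat. \<forall>m. \<exists>n\<ge>m. f n < exp ((l - 1 / (real k + 1)) * real n))"

text \<open>Half of the gap between the rate of \<open>f\<close> and \<open>l\<close> absorbs the constant and the shift of the index.\<close>

lemma slow_transfer:
  assumes f: "slow l f" and c: "c > 0" and g: "\<And>n. g (n + i) \<le> c * f (n + j)"
  shows "slow l g"
proof -
  obtain k where k: "\<And>m. \<exists>n\<ge>m. f n < exp ((l - 1 / (real k + 1)) * real n)"
    using f by (auto simp: slow_def)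
  define d where "d = 1 / (real k + 1)"
  define k' where "k' = 2 * k + 1"
  have d': "1 / (real k' + 1) = d / 2" unfolding k'_def d_def by (simp add: field_simps)
  have dp: "d > 0" by (simp add: d_def)
  show ?thesis unfolding slow_def
  proof (rule exI[of _ k'], rule allI)
    fix m
    define K where "K = ln c + (l - d) * (real j - real i) + d * real i"
    obtain N :: nat where N: "real N > 2 * \<bar>K\<bar> / d" using reals_Archimedean2 by blast
    obtain n' where n': "n' \<ge> m + N + j" "f n' < exp ((l - d) * real n')"
      using k[of "m + N + j"] unfolding d_def by blast
    define n where "n = n' - j"
    have n: "n' = n + j" "n \<ge> m" "n \<ge> N" using n' by (auto simp: n_def)
    have "\<bar>K\<bar> < d / 2 * real N" using N dp by (simp add: field_simps)
    also have "\<dots> \<le> d / 2 * real n" using n dp by simp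
    finally have Kn: "K < d / 2 * real n" by simp
    have "g (n + i) \<le> c * f (n + j)" by (rule g)
    also have "\<dots> < c * exp ((l - d) * real (n + j))" using n' n c by simp
    also have "\<dots> = exp (ln c + (l - d) * real (n + j))" using c by (simp add: exp_add)
    also have "\<dots> \<le> exp ((l - d / 2) * real (n + i))"
    proof -
      have "ln c + (l - d) * real (n + j) = K + (l - d) * real (n + i) - d * real i"
        by (simp add: K_def algebra_simps)
      also have "\<dots> \<le> d / 2 * real n + (l - d) * real (n + i)"
        using Kn mult_nonneg_nonneg[of d "real i"] dp by linarith
      also have "\<dots> \<le> (l - d / 2) * real (n + i)" using dp by (simp add: algebra_simps)
      finally show ?thesis by simp
    qed
    finally have "g (n + i) < exp ((l - 1 / (real k' + 1)) * real (n + i))" unfolding d' .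
    thus "\<exists>n\<ge>m. g n < exp ((l - 1 / (real k' + 1)) * real n)" using n by (intro exI[of _ "n + i"]) auto
  qed
qed

text \<open>The contracted directions \<open>s n\<close> of the partial products form a Cauchy sequence of lines, since
  both \<open>s n\<close> and \<open>s (Suc n)\<close> are contracted by the \<open>n\<close>-th product. A slow vector is close to \<open>s n\<close>
  for arbitrarily large \<open>n\<close>, so it spans the limit line.\<close>

lemma slow_vectors_parallel:
  fixes A :: "nat \<Rightarrow> real^2^2"
  assumes det: "\<And>i. det (A i) = 1" and C: "\<And>i. op_norm (A i) \<le> C"
    and lim: "(\<lambda>n. ln (op_norm (mprod A n)) / real n) \<longlonglongrightarrow> l" and l: "l > 0"
    and s1: "slow l (\<lambda>n. norm (mprod A n *v v1))" and s2: "slow l (\<lambda>n. norm (mprod A n *v v2))"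
  shows "cr v1 v2 = 0"
proof -
  let ?P = "mprod A"
  have dP: "det (?P n) = 1" for n by (rule det_mprod[OF det])
  have P1: "op_norm (?P n) \<ge> 1" for n by (rule op_norm_ge_1[OF dP])
  have C1: "C \<ge> 1" using op_norm_ge_1[OF det] C order_trans by blast
  obtain k1 k2 where k1: "\<And>m. \<exists>n\<ge>m. norm (?P n *v v1) < exp ((l - 1 / (real k1 + 1)) * real n)"
    and k2: "\<And>m. \<exists>n\<ge>m. norm (?P n *v v2) < exp ((l - 1 / (real k2 + 1)) * real n)"
    using s1 s2 by (auto simp: slow_def)
  define d where "d = min (1 / (real k1 + 1)) (1 / (real k2 + 1))"
  define \<kappa> where "\<kappa> = min (d / 2) (l / 2)"
  have dp: "d > 0" by (simp add: d_def)
  hence kp: "\<kappa> > 0" "\<kappa> \<le> d / 2" "\<kappa> \<le> l / 2" using l by (auto simp: \<kappa>_def)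
  have "eventually (\<lambda>n. ln (op_norm (?P n)) / real n > l - \<kappa>) sequentially"
    using kp by (intro order_tendstoD[OF lim]) simp
  moreover have "eventually (\<lambda>n. n > (0::nat)) sequentially" by (rule eventually_gt_at_top)
  ultimately have "eventually (\<lambda>n. op_norm (?P n) \<ge> exp ((l - \<kappa>) * real n)) sequentially"
  proof eventually_elim
    case (elim n)
    hence "(l - \<kappa>) * real n \<le> ln (op_norm (?P n))" by (simp add: field_simps)
    thus ?case using P1[of n] by (simp add: ln_ge_iff)
  qed
  then obtain n0 where n0: "\<And>n. n \<ge> n0 \<Longrightarrow> op_norm (?P n) \<ge> exp ((l - \<kappa>) * real n)"
    by (auto simp: eventually_sequentially)
  define s where "s n = (SOME s. norm s = 1 \<and> norm (?P n *v s) * op_norm (?P n) \<le> 2)" for n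
  have s: "norm (s n) = 1" "norm (?P n *v s n) * op_norm (?P n) \<le> 2" for n
    using someI_ex[of "\<lambda>s. norm s = 1 \<and> norm (?P n *v s) * op_norm (?P n) \<le> 2"]
      contracted_direction[OF dP[of n]] unfolding s_def by blast+
  have sc: "norm (?P n *v s n) \<le> 2 * exp (- (l - \<kappa>) * real n)" if "n \<ge> n0" for n
  proof -
    have "norm (?P n *v s n) * exp ((l - \<kappa>) * real n) \<le> norm (?P n *v s n) * op_norm (?P n)"
      using n0[OF that] by (intro mult_left_mono) auto
    also have "\<dots> \<le> 2" by (rule s)
    finally have "norm (?P n *v s n) \<le> 2 / exp ((l - \<kappa>) * real n)" by (simp add: pos_le_divide_eq)
    moreover have "exp (- (l - \<kappa>) * real n) = 1 / exp ((l - \<kappa>) * real n)"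
      by (metis exp_minus inverse_eq_divide mult_minus_left)
    ultimately show ?thesis by simp
  qed
  have crP: "cr x y = cr (?P n *v x) (?P n *v y)" for n x y using dP by (simp add: cr_matrix)
  define \<rho> where "\<rho> = exp (- l)"
  have rho: "0 < \<rho>" "\<rho> < 1" using l by (auto simp: \<rho>_def)
  have step: "\<bar>cr (s (Suc n)) (s n)\<bar> \<le> 4 * C * \<rho> ^ n" if "n \<ge> n0" for n
  proof -
    have "norm (?P n *v s (Suc n)) \<le> op_norm (A n) * norm (?P (Suc n) *v s (Suc n))"
      unfolding mprod_Suc_mv by (rule norm_le_op_norm_mv[OF det])
    also have "\<dots> \<le> C * (2 * exp (- (l - \<kappa>) * real (Suc n)))"
      using C1 sc[of "Suc n"] that by (intro mult_mono C) auto
    also have "\<dots> \<le> C * (2 * exp (- (l - \<kappa>) * real n))" using C1 kp l by simp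
    finally have 1: "norm (?P n *v s (Suc n)) \<le> C * (2 * exp (- (l - \<kappa>) * real n))" .
    have "\<bar>cr (s (Suc n)) (s n)\<bar> \<le> norm (?P n *v s (Suc n)) * norm (?P n *v s n)"
      using crP abs_cr_le by metis
    also have "\<dots> \<le> (C * (2 * exp (- (l - \<kappa>) * real n))) * (2 * exp (- (l - \<kappa>) * real n))"
      using C1 by (intro mult_mono 1 sc that) auto
    also have "\<dots> = 4 * C * exp (- (l - \<kappa>) * real n + - (l - \<kappa>) * real n)" by (simp only: exp_add)
    also have "\<dots> \<le> 4 * C * exp (real n * (- l))"
    proof -
      have "- (l - \<kappa>) * real n + - (l - \<kappa>) * real n = real n * (- 2 * (l - \<kappa>))" by (simp add: algebra_simps)
      also have "\<dots> \<le> real n * (- l)" using kp by (intro mult_left_mono) auto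
      finally show ?thesis using C1 by simp
    qed
    finally show ?thesis unfolding \<rho>_def exp_of_nat_mult .
  qed
  have far: "\<bar>cr (s (n + m)) (s n)\<bar> \<le> 4 * C * \<rho> ^ n / (1 - \<rho>)" if "n \<ge> n0" for n m
  proof -
    have "\<bar>cr (s (n + m)) (s n)\<bar> \<le> (\<Sum>i<m. 4 * C * \<rho> ^ (n + i))"
    proof (induction m)
      case (Suc m)
      have "\<bar>cr (s (n + Suc m)) (s n)\<bar> \<le> \<bar>cr (s (Suc (n + m))) (s (n + m))\<bar> + \<bar>cr (s (n + m)) (s n)\<bar>"
        using cr_triangle[of "s (Suc (n + m))" "s n" "s (n + m)"] by (simp add: s(1))
      also have "\<dots> \<le> 4 * C * \<rho> ^ (n + m) + (\<Sum>i<m. 4 * C * \<rho> ^ (n + i))"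
        using that by (intro add_mono Suc step) auto
      finally show ?case by simp
    qed simp
    also have "\<dots> = 4 * C * \<rho> ^ n * (\<Sum>i<m. \<rho> ^ i)" by (simp add: power_add sum_distrib_left algebra_simps)
    also have "\<dots> \<le> 4 * C * \<rho> ^ n * (1 / (1 - \<rho>))"
    proof (intro mult_left_mono)
      have "(\<Sum>i<m. \<rho> ^ i) = (1 - \<rho> ^ m) / (1 - \<rho>)" using rho by (simp add: sum_gp_strict)
      also have "\<dots> \<le> 1 / (1 - \<rho>)" using rho by (intro divide_right_mono) auto
      finally show "(\<Sum>i<m. \<rho> ^ i) \<le> 1 / (1 - \<rho>)" .
    qed (use C1 rho in auto)
    finally show ?thesis by simp
  qed
  have near: "\<bar>cr v (s n)\<bar> \<le> 2 * exp (- \<kappa> * real n)"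
    if "n \<ge> n0" "norm (?P n *v v) < exp ((l - d) * real n)" for n v
  proof -
    have "\<bar>cr v (s n)\<bar> \<le> norm (?P n *v v) * norm (?P n *v s n)" using crP abs_cr_le by metis
    also have "\<dots> \<le> exp ((l - d) * real n) * (2 * exp (- (l - \<kappa>) * real n))"
      using that by (intro mult_mono sc) auto
    also have "\<dots> = 2 * exp ((l - d) * real n + - (l - \<kappa>) * real n)" by (simp only: exp_add)
    also have "\<dots> \<le> 2 * exp (- \<kappa> * real n)"
    proof -
      have "(l - d) * real n + - (l - \<kappa>) * real n = (\<kappa> - d) * real n" by (simp add: algebra_simps)
      also have "\<dots> \<le> - \<kappa> * real n" using kp by (intro mult_right_mono) auto
      finally show ?thesis by simp
    qed
    finally show ?thesis .
  qed
  have "\<bar>cr v1 v2\<bar> \<le> \<tau>'" if t': "\<tau>' > 0" for \<tau>'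
  proof -
    define \<tau> where "\<tau> = \<tau>' / (norm v2 + norm v1 * norm v2 + norm v1 + 1)"
    have den: "norm v2 + norm v1 * norm v2 + norm v1 + 1 > 0"
      by (intro add_nonneg_pos add_nonneg_nonneg mult_nonneg_nonneg) auto
    have t: "\<tau> > 0" using t' den by (simp add: \<tau>_def)
    have "(\<lambda>n. 4 * C * \<rho> ^ n / (1 - \<rho>)) \<longlonglongrightarrow> 4 * C * 0 / (1 - \<rho>)"
      using rho by (intro tendsto_intros LIMSEQ_power_zero) auto
    hence "eventually (\<lambda>n. 4 * C * \<rho> ^ n / (1 - \<rho>) < \<tau>) sequentially"
      using t by (intro order_tendstoD(2)[where a = \<tau>]) auto
    moreover have "(\<lambda>n. 2 * exp (- \<kappa>) ^ n) \<longlonglongrightarrow> 2 * 0"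
      using kp by (intro tendsto_intros LIMSEQ_power_zero) auto
    hence "eventually (\<lambda>n. 2 * exp (- \<kappa>) ^ n < \<tau>) sequentially"
      using t by (intro order_tendstoD(2)[where a = \<tau>]) auto
    ultimately have "eventually (\<lambda>n. 4 * C * \<rho> ^ n / (1 - \<rho>) < \<tau> \<and> 2 * exp (- \<kappa>) ^ n < \<tau>) sequentially"
      by eventually_elim auto
    then obtain N where N: "\<And>n. n \<ge> N \<Longrightarrow> 4 * C * \<rho> ^ n / (1 - \<rho>) < \<tau> \<and> 2 * exp (- \<kappa>) ^ n < \<tau>"
      by (auto simp: eventually_sequentially)
    have ex: "2 * exp (- \<kappa> * real n) < \<tau>" if "n \<ge> N" for n
      using N[OF that] by (metis exp_of_nat_mult mult.commute)
    have dd: "exp ((l - 1 / (real k1 + 1)) * real n) \<le> exp ((l - d) * real n)"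
      "exp ((l - 1 / (real k2 + 1)) * real n) \<le> exp ((l - d) * real n)" for n
      by (simp_all add: d_def mult_right_mono)
    obtain n where n: "n \<ge> max N n0" "norm (?P n *v v1) < exp ((l - d) * real n)"
      using k1[of "max N n0"] dd(1) by (meson less_le_trans)
    obtain m where m: "m \<ge> n" "norm (?P m *v v2) < exp ((l - d) * real m)"
      using k2[of n] dd(2) by (meson less_le_trans)
    have a: "\<bar>cr v1 (s n)\<bar> \<le> \<tau>" using near[of n v1] n ex[of n] by simp
    have b: "\<bar>cr v2 (s m)\<bar> \<le> \<tau>" using near[of m v2] m n ex[of m] by simp
    have c: "\<bar>cr (s m) (s n)\<bar> \<le> \<tau>" using far[of n "m - n"] N[of n] m n by simp
    have "\<bar>cr v2 (s n)\<bar> \<le> \<bar>cr v2 (s m)\<bar> + \<bar>cr (s m) (s n)\<bar> * norm v2"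
      using cr_triangle[of v2 "s n" "s m"] by (simp add: s(1))
    also have "\<dots> \<le> \<tau> + \<tau> * norm v2" using b c by (intro add_mono mult_right_mono) auto
    finally have e: "\<bar>cr (s n) v2\<bar> \<le> \<tau> + \<tau> * norm v2" by (subst cr_commute) simp
    have "\<bar>cr v1 v2\<bar> \<le> \<bar>cr v1 (s n)\<bar> * norm v2 + \<bar>cr (s n) v2\<bar> * norm v1"
      using cr_triangle[of v1 v2 "s n"] by (simp add: s(1))
    also have "\<dots> \<le> \<tau> * norm v2 + (\<tau> + \<tau> * norm v2) * norm v1"
      using a e by (intro add_mono mult_right_mono) auto
    also have "\<dots> = \<tau> * (norm v2 + norm v1 * norm v2 + norm v1)" by (simp add: algebra_simps)
    also have "\<dots> \<le> \<tau> * (norm v2 + norm v1 * norm v2 + norm v1 + 1)" using t by simp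
    also have "\<dots> = \<tau>'" using den by (simp add: \<tau>_def)
    finally show ?thesis .
  qed
  thus ?thesis by (metis abs_le_zero_iff dense_ge less_le)
qed

lemma sequence_space_if_prob_space: "prob_space M \<Longrightarrow> sequence_space M"
  by (simp add: sequence_space_def product_prob_space_def product_prob_space_axioms_def
    product_sigma_finite_def prob_space_imp_sigma_finite)

locale sl2_walk = sequence_space M for M :: "'w measure" +
  fixes G :: "'w \<Rightarrow> real^2^2" and C :: real and W :: "nat \<Rightarrow> (nat \<Rightarrow> 'w) \<Rightarrow> real^2^2"
  assumes G_meas [measurable]: "G \<in> borel_measurable M"
    and G_det: "\<And>x. x \<in> space M \<Longrightarrow> det (G x) = 1"
    and G_bd: "\<And>x. x \<in> space M \<Longrightarrow> op_norm (G x) \<le> C"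
    and C1: "1 \<le> C"
  defines "W \<equiv> \<lambda>n \<omega>. mprod (\<lambda>i. G (\<omega> i)) n"
begin

lemma W_0 [simp]: "W 0 \<omega> = mat 1" by (simp add: W_def)

lemma W_Suc: "W (Suc n) \<omega> = G (\<omega> n) ** W n \<omega>" by (simp add: W_def)

lemma W_meas [measurable]: "W n \<in> borel_measurable S"
  by (induction n) (simp_all add: W_Suc fun_eq_iff[of "W _", abs_def] del: fun_eq_iff)

lemma in_space: "\<omega> \<in> space S \<Longrightarrow> \<omega> i \<in> space M"
  by (auto simp: space_PiM)

lemma W_det: "\<omega> \<in> space S \<Longrightarrow> det (W n \<omega>) = 1"
  unfolding W_def by (intro det_mprod G_det in_space)

lemma W_op: "\<omega> \<in> space S \<Longrightarrow> op_norm (W n \<omega>) \<le> C ^ n"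
  unfolding W_def by (intro op_norm_mprod G_bd in_space)

lemma W_upper: "\<omega> \<in> space S \<Longrightarrow> norm (W n \<omega> *v v) \<le> C ^ n * norm v"
  using norm_mv_le[of "W n \<omega>" v] W_op[of \<omega> n] by (meson mult_right_mono norm_ge_zero order_trans)

lemma W_lower: "\<omega> \<in> space S \<Longrightarrow> norm v \<le> C ^ n * norm (W n \<omega> *v v)"
  using norm_le_op_norm_mv[OF W_det, of \<omega> v n] W_op[of \<omega> n] by (meson mult_right_mono norm_ge_zero order_trans)

lemma W_nz: "\<omega> \<in> space S \<Longrightarrow> v \<noteq> 0 \<Longrightarrow> W n \<omega> *v v \<noteq> 0"
  by (intro mv_nonzero W_det)

lemma abs_ln_W: assumes "\<omega> \<in> space S" "norm v = 1" shows "\<bar>ln (norm (W n \<omega> *v v))\<bar> \<le> real n * ln C"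
proof -
  have v: "v \<noteq> 0" using assms by auto
  have p: "norm (W n \<omega> *v v) > 0" using W_nz[OF assms(1) v] by simp
  have "ln (norm (W n \<omega> *v v)) \<le> ln (C ^ n)"
    using W_upper[OF assms(1), of n v] assms(2) p C1 by (intro ln_mono) auto
  moreover have "ln 1 \<le> ln (C ^ n * norm (W n \<omega> *v v))"
    using W_lower[OF assms(1), of v n] assms(2) p C1 by (intro ln_mono) auto
  hence "0 \<le> ln (C ^ n) + ln (norm (W n \<omega> *v v))" using p C1 by (simp add: ln_mult)
  ultimately show ?thesis using C1 by (simp add: ln_realpow)
qed

lemma abs_ln_op: assumes "\<omega> \<in> space S" shows "\<bar>ln (op_norm (W n \<omega>))\<bar> \<le> real n * ln C"
proof -
  have 1: "op_norm (W n \<omega>) \<ge> 1" by (intro op_norm_ge_1 W_det assms)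
  hence "ln (op_norm (W n \<omega>)) \<le> ln (C ^ n)" using W_op[OF assms, of n] by (intro ln_mono) auto
  thus ?thesis using 1 C1 by (simp add: ln_realpow)
qed

lemma W_comb [simp]: "W m (comb_seq m \<omega> \<omega>') = W m \<omega>"
  unfolding W_def by (intro mprod_cong) (simp add: comb_seq_less)

lemma W_add_comb: "W (m + n) (comb_seq m \<omega> \<omega>') = W n \<omega>' ** W m \<omega>"
proof -
  have "W (m + n) (comb_seq m \<omega> \<omega>')
     = mprod (\<lambda>i. G (comb_seq m \<omega> \<omega>' (m + i))) n ** W m (comb_seq m \<omega> \<omega>')"
    unfolding W_def by (rule mprod_add)
  moreover have "(\<lambda>i. G (comb_seq m \<omega> \<omega>' (m + i))) = (\<lambda>i. G (\<omega>' i))"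
    by (simp add: comb_seq_def)
  ultimately show ?thesis by (simp only: W_comb) (simp only: W_def)
qed

lemma W_case_nat: "W (Suc n) (case_nat x \<omega>) = W n \<omega> ** G x"
  using mprod_add[of "\<lambda>i. G (case_nat x \<omega> i)" 1 n] by (simp add: W_def)

text \<open>The Markov property in integrated form: \<open>comb_seq m\<close> replaces everything after the first \<open>m\<close> entries
  by an independent copy.\<close>

lemma nn_integral_comb_seq:
  assumes [measurable]: "f \<in> borel_measurable S"
  shows "(\<integral>\<^sup>+\<omega>. f \<omega> \<partial>S) = (\<integral>\<^sup>+\<omega>. \<integral>\<^sup>+\<omega>'. f (comb_seq m \<omega> \<omega>') \<partial>S \<partial>S)"
proof -
  have "(\<integral>\<^sup>+\<omega>. f \<omega> \<partial>S) = (\<integral>\<^sup>+\<omega>. f \<omega> \<partial>distr (S \<Otimes>\<^sub>M S) S (\<lambda>(\<omega>, \<omega>'). comb_seq m \<omega> \<omega>'))"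
    by (simp only: PiM_comb_seq)
  also have "\<dots> = (\<integral>\<^sup>+z. f (case z of (\<omega>, \<omega>') \<Rightarrow> comb_seq m \<omega> \<omega>') \<partial>(S \<Otimes>\<^sub>M S))"
    by (rule nn_integral_distr) (auto simp: split_beta' intro!: measurable_comb_seq)
  also have "\<dots> = (\<integral>\<^sup>+\<omega>. \<integral>\<^sup>+\<omega>'. f (comb_seq m \<omega> \<omega>') \<partial>S \<partial>S)"
    by (subst P.nn_integral_fst[symmetric])
       (auto simp: split_beta' intro!: measurable_compose[OF measurable_comb_seq[unfolded split_beta'] assms])
  finally show ?thesis .
qed

definition prob_slow :: "real \<Rightarrow> real^2 \<Rightarrow> real" where
  "prob_slow l v = P.prob {\<omega> \<in> space S. slow l (\<lambda>n. norm (W n \<omega> *v v))}"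

lemma sets_slow [measurable]: "{\<omega> \<in> space S. slow l (\<lambda>n. norm (W n \<omega> *v v))} \<in> sets S"
  unfolding slow_def by measurable

lemma prob_slow_scale:
  assumes "c \<noteq> 0" shows "prob_slow l (c *\<^sub>R v) = prob_slow l v"
proof -
  have 1: "slow l (\<lambda>n. norm (W n \<omega> *v (d *\<^sub>R u)))" if "slow l (\<lambda>n. norm (W n \<omega> *v u))" "d \<noteq> 0" for d u \<omega>
    by (rule slow_transfer[OF that(1), where c = "\<bar>d\<bar>" and i = 0 and j = 0])
       (use that in \<open>auto simp: matrix_vector_mult_scaleR\<close>)
  have "slow l (\<lambda>n. norm (W n \<omega> *v (c *\<^sub>R v))) \<longleftrightarrow> slow l (\<lambda>n. norm (W n \<omega> *v v))" for \<omega>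
    using 1[of \<omega> v c] 1[of \<omega> "c *\<^sub>R v" "1 / c"] assms by auto
  thus ?thesis unfolding prob_slow_def by simp
qed

lemma prob_slow_span: "u \<noteq> 0 \<Longrightarrow> v \<noteq> 0 \<Longrightarrow> span {u} = span {v} \<Longrightarrow> prob_slow l u = prob_slow l v"
  using span_singleton_eq_iff[of u v] prob_slow_scale by auto

text \<open>The function \<open>prob_slow l\<close> is harmonic: condition on the first factor. The function \<open>q\<close> is the
  integrand, obtained as a section of a measurable set so that its measurability comes for free.\<close>

lemma prob_slow_step:
  obtains q where "q \<in> borel_measurable M" "\<And>x. x \<in> space M \<Longrightarrow> q x = ennreal (prob_slow l (G x *v v))"
    "ennreal (prob_slow l v) = (\<integral>\<^sup>+x. q x \<partial>M)"
proof -
  let ?A = "{\<omega> \<in> space S. slow l (\<lambda>n. norm (W n \<omega> *v v))}"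
  let ?f = "\<lambda>(x, \<omega>). case_nat x \<omega> :: nat \<Rightarrow> 'w"
  let ?B = "?f -` ?A \<inter> space (M \<Otimes>\<^sub>M S)"
  have f: "?f \<in> M \<Otimes>\<^sub>M S \<rightarrow>\<^sub>M S" by (simp add: split_beta')
  have B: "?B \<in> sets (M \<Otimes>\<^sub>M S)" by (rule measurable_sets[OF f sets_slow])
  have "ennreal (prob_slow l v) = emeasure S ?A"
    unfolding prob_slow_def by (rule P.emeasure_eq_measure[symmetric])
  also have "\<dots> = emeasure (distr (M \<Otimes>\<^sub>M S) S ?f) ?A" by (simp only: PiM_iter)
  also have "\<dots> = emeasure (M \<Otimes>\<^sub>M S) ?B" by (rule emeasure_distr[OF f sets_slow])
  also have "\<dots> = (\<integral>\<^sup>+x. emeasure S (Pair x -` ?B) \<partial>M)" by (rule P.emeasure_pair_measure_alt[OF B])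
  finally have 3: "ennreal (prob_slow l v) = (\<integral>\<^sup>+x. emeasure S (Pair x -` ?B) \<partial>M)" .
  have eq: "slow l (\<lambda>n. norm (W n (case_nat x \<omega>) *v v)) \<longleftrightarrow> slow l (\<lambda>n. norm (W n \<omega> *v (G x *v v)))" for x \<omega>
  proof
    assume "slow l (\<lambda>n. norm (W n (case_nat x \<omega>) *v v))"
    thus "slow l (\<lambda>n. norm (W n \<omega> *v (G x *v v)))"
      by (rule slow_transfer[where c = 1 and i = 0 and j = 1])
         (simp_all add: W_case_nat matrix_vector_mul_assoc)
  next
    assume "slow l (\<lambda>n. norm (W n \<omega> *v (G x *v v)))"
    thus "slow l (\<lambda>n. norm (W n (case_nat x \<omega>) *v v))"
      by (rule slow_transfer[where c = 1 and i = 1 and j = 0])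
         (simp_all add: W_case_nat matrix_vector_mul_assoc)
  qed
  have "Pair x -` ?B = {\<omega> \<in> space S. slow l (\<lambda>n. norm (W n \<omega> *v (G x *v v)))}" if x: "x \<in> space M" for x
  proof -
    have "case_nat x \<omega> \<in> space S" if "\<omega> \<in> space S" for \<omega>
      using measurable_space[OF f, of "(x, \<omega>)"] x that by (simp add: space_pair_measure)
    thus ?thesis using x by (auto simp: eq space_pair_measure)
  qed
  hence 2: "emeasure S (Pair x -` ?B) = ennreal (prob_slow l (G x *v v))" if "x \<in> space M" for x
    unfolding prob_slow_def using that by (simp add: P.emeasure_eq_measure)
  have 1: "(\<lambda>x. emeasure S (Pair x -` ?B)) \<in> borel_measurable M"
    by (rule P.measurable_emeasure_Pair[OF B])
  show ?thesis using 1 2 3 by (rule that)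
qed

text \<open>The form of the Furstenberg condition that integration can contradict: it speaks of almost every
  matrix instead of the support of the distribution.\<close>

definition line_irreducible :: bool where
  "line_irreducible \<longleftrightarrow> (\<forall>V. finite V \<and> V \<noteq> {} \<and> (\<forall>L\<in>V. \<exists>v. v \<noteq> 0 \<and> L = span {v}) \<longrightarrow>
     \<not> (AE x in M. \<forall>v. v \<noteq> 0 \<longrightarrow> span {v} \<in> V \<longrightarrow> span {G x *v v} \<in> V))"

text \<open>Slow vectors of different lines occur for disjoint sets of sequences, so only finitely many lines
  are slow with at least a given probability.\<close>

lemma finite_slow_lines:
  assumes lim: "AE \<omega> in S. (\<lambda>n. ln (op_norm (W n \<omega>)) / real n) \<longlonglongrightarrow> l" and l: "l > 0" and c: "c > 0"
  shows "finite {span {v} |v. v \<noteq> 0 \<and> prob_slow l v \<ge> c}" (is "finite ?X")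
proof -
  let ?good = "{\<omega> \<in> space S. (\<lambda>n. ln (op_norm (W n \<omega>)) / real n) \<longlonglongrightarrow> l}"
  have "card Y \<le> nat \<lfloor>1 / c\<rfloor>" if Y: "Y \<subseteq> ?X" "finite Y" for Y
  proof -
    have "\<forall>L\<in>Y. \<exists>v. L = span {v} \<and> v \<noteq> 0 \<and> prob_slow l v \<ge> c" using Y by blast
    then obtain r where r: "\<And>L. L \<in> Y \<Longrightarrow> L = span {r L} \<and> r L \<noteq> 0 \<and> prob_slow l (r L) \<ge> c" by metis
    define E where "E L = {\<omega> \<in> space S. slow l (\<lambda>n. norm (W n \<omega> *v r L))} \<inter> ?good" for L
    have [measurable]: "?good \<in> sets S" by measurable
    have Em: "E L \<in> sets S" for L unfolding E_def by (intro sets.Int sets_slow) simp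
    have pE: "P.prob (E L) = prob_slow l (r L)" for L
      unfolding prob_slow_def
    proof (rule P.finite_measure_eq_AE)
      show "AE \<omega> in S. \<omega> \<in> E L \<longleftrightarrow> \<omega> \<in> {\<omega> \<in> space S. slow l (\<lambda>n. norm (W n \<omega> *v r L))}"
        using lim by eventually_elim (auto simp: E_def)
    qed (use Em in auto)
    have disj: "disjoint_family_on E Y"
      unfolding disjoint_family_on_def
    proof (intro ballI impI)
      fix K L assume KL: "K \<in> Y" "L \<in> Y" "K \<noteq> L"
      show "E K \<inter> E L = {}"
      proof (rule ccontr)
        assume "E K \<inter> E L \<noteq> {}"
        then obtain \<omega> where w: "\<omega> \<in> space S" "slow l (\<lambda>n. norm (W n \<omega> *v r K))"
          "slow l (\<lambda>n. norm (W n \<omega> *v r L))" "(\<lambda>n. ln (op_norm (W n \<omega>)) / real n) \<longlonglongrightarrow> l"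
          by (auto simp: E_def)
        have "cr (r K) (r L) = 0"
          by (rule slow_vectors_parallel[where A = "\<lambda>i. G (\<omega> i)" and C = C and l = l])
             (use w l G_det G_bd in_space in \<open>auto simp: W_def\<close>)
        then obtain d where "r L = d *\<^sub>R r K" using cr_zero_imp_scale r KL by blast
        moreover have "d \<noteq> 0" using calculation r[OF KL(2)] by auto
        ultimately have "span {r K} = span {r L}"
          using span_singleton_eq_iff[of "r K" "r L"] r[OF KL(1)] r[OF KL(2)] by blast
        thus False using r KL by metis
      qed
    qed
    have "real (card Y) * c = (\<Sum>L\<in>Y. c)" by simp
    also have "\<dots> \<le> (\<Sum>L\<in>Y. P.prob (E L))" by (rule sum_mono) (use r pE in auto)
    also have "\<dots> = P.prob (\<Union>L\<in>Y. E L)"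
      using Em disj Y by (intro P.finite_measure_finite_Union[symmetric]) auto
    also have "\<dots> \<le> 1" by (rule P.prob_le_1)
    finally have "real (card Y) \<le> 1 / c" using c by (simp add: field_simps)
    thus ?thesis by linarith
  qed
  thus ?thesis using finite_if_finite_subsets_card_bdd by blast
qed

text \<open>If some line were slow with positive probability, the maximum of this probability would be attained
  on a nonempty finite family of lines. By harmonicity, almost every matrix maps this family into itself.\<close>

lemma prob_slow_eq_0:
  assumes irr: line_irreducible
    and lim: "AE \<omega> in S. (\<lambda>n. ln (op_norm (W n \<omega>)) / real n) \<longlonglongrightarrow> l" and l: "l > 0" and v: "v \<noteq> 0"
  shows "prob_slow l v = 0"
proof (rule ccontr)
  assume "prob_slow l v \<noteq> 0"
  hence c: "prob_slow l v > 0" by (simp add: prob_slow_def zero_less_measure_iff)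
  let ?X = "{span {u} |u. u \<noteq> 0 \<and> prob_slow l u \<ge> prob_slow l v}"
  have fX: "finite ?X" by (rule finite_slow_lines[OF lim l c])
  define pr where "pr L = prob_slow l (SOME u. u \<noteq> 0 \<and> L = span {u})" for L
  have pr: "pr (span {u}) = prob_slow l u" if "u \<noteq> 0" for u
  proof -
    have "\<exists>w. w \<noteq> 0 \<and> span {u} = span {w}" using that by blast
    note s = someI_ex[OF this]
    show ?thesis unfolding pr_def using prob_slow_span[OF that conjunct1[OF s] conjunct2[OF s]] by simp
  qed
  have ne: "?X \<noteq> {}" using v by blast
  define pm where "pm = Max (pr ` ?X)"
  have "pm \<in> pr ` ?X" unfolding pm_def using fX ne by (intro Max_in) auto
  then obtain u0 where u0: "u0 \<noteq> 0" "prob_slow l u0 \<ge> prob_slow l v" "pm = prob_slow l u0"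
    using pr by auto
  have max: "prob_slow l u \<le> pm" if "u \<noteq> 0" for u
  proof (cases "prob_slow l u \<ge> prob_slow l v")
    case True
    hence "span {u} \<in> ?X" using that by blast
    hence "pr (span {u}) \<in> pr ` ?X" by (rule imageI)
    thus ?thesis unfolding pm_def using fX pr[OF that] Max_ge[of "pr ` ?X" "pr (span {u})"] by simp
  qed (use u0 in auto)
  let ?V = "{span {u} |u. u \<noteq> 0 \<and> prob_slow l u = pm}"
  have "?V \<subseteq> ?X" using u0 by auto
  hence fV: "finite ?V" using fX finite_subset by blast
  have step: "AE x in M. prob_slow l (G x *v u) = pm" if u: "u \<noteq> 0" "prob_slow l u = pm" for u
  proof -
    obtain q where [measurable]: "q \<in> borel_measurable M"
      and q: "\<And>x. x \<in> space M \<Longrightarrow> q x = ennreal (prob_slow l (G x *v u))"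
        "ennreal (prob_slow l u) = (\<integral>\<^sup>+x. q x \<partial>M)"
      using prob_slow_step[of l u] by blast
    have le: "q x \<le> ennreal pm" if "x \<in> space M" for x
      using q(1)[OF that] max[OF mv_nonzero[OF G_det[OF that] u(1)]] by (simp add: ennreal_leI)
    have "(\<integral>\<^sup>+x. ennreal pm - q x \<partial>M) = (\<integral>\<^sup>+x. ennreal pm \<partial>M) - (\<integral>\<^sup>+x. q x \<partial>M)"
      using le q(2) by (intro nn_integral_diff) (auto simp: less_top[symmetric] simp flip: q(2))
    also have "\<dots> = ennreal pm - ennreal pm" unfolding q(2)[symmetric] using u by (simp add: M.emeasure_space_1)
    also have "\<dots> = 0" by (rule diff_eq_0_ennreal) auto
    finally have "AE x in M. ennreal pm - q x = 0"
      by (subst (asm) nn_integral_0_iff_AE) auto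
    moreover have "AE x in M. x \<in> space M" by (rule AE_space)
    ultimately show ?thesis
    proof eventually_elim
      case (elim x)
      hence "ennreal pm \<le> q x" by (simp add: diff_eq_0_iff_ennreal)
      hence "pm \<le> prob_slow l (G x *v u)" using q(1) elim by (simp add: prob_slow_def)
      thus ?case using max[OF mv_nonzero[OF G_det u(1)]] elim by force
    qed
  qed
  define r where "r L = (SOME u. u \<noteq> 0 \<and> prob_slow l u = pm \<and> L = span {u})" for L
  have r: "r L \<noteq> 0 \<and> prob_slow l (r L) = pm \<and> L = span {r L}" if "L \<in> ?V" for L
    unfolding r_def by (rule someI_ex) (use that in blast)
  have "AE x in M. \<forall>L\<in>?V. prob_slow l (G x *v r L) = pm"
    using fV step r by (intro AE_finite_allI) auto
  moreover have "AE x in M. x \<in> space M" by (rule AE_space)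
  ultimately have "AE x in M. \<forall>u. u \<noteq> 0 \<longrightarrow> span {u} \<in> ?V \<longrightarrow> span {G x *v u} \<in> ?V"
  proof eventually_elim
    case (elim x)
    show ?case
    proof (intro allI impI)
      fix u :: "real^2" assume u: "u \<noteq> 0" "span {u} \<in> ?V"
      let ?w = "r (span {u})"
      have w: "?w \<noteq> 0" "prob_slow l (G x *v ?w) = pm" "span {u} = span {?w}" using r[OF u(2)] elim u by auto
      then obtain c where c: "c \<noteq> 0" "?w = c *\<^sub>R u" using span_singleton_eq_iff[OF u(1) w(1)] by auto
      have "prob_slow l (G x *v u) = pm"
        using w(2) c prob_slow_scale[of c l "G x *v u"] by (simp add: matrix_vector_mult_scaleR)
      moreover have "G x *v u \<noteq> 0" using mv_nonzero[OF G_det u(1)] elim by blast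
      ultimately show "span {G x *v u} \<in> ?V" by blast
    qed
  qed
  moreover have "?V \<noteq> {}" "\<forall>L\<in>?V. \<exists>v. v \<noteq> 0 \<and> L = span {v}" using u0 by blast+
  ultimately show False using irr fV unfolding line_irreducible_def by blast
qed

lemma expected_op_norm_growth:
  assumes lim: "AE \<omega> in S. (\<lambda>n. ln (op_norm (W n \<omega>)) / real n) \<longlonglongrightarrow> l"
  shows "(\<lambda>n. (\<integral>\<omega>. ln (op_norm (W n \<omega>)) \<partial>S) / real n) \<longlonglongrightarrow> l"
proof -
  have b: "\<bar>ln (op_norm (W n \<omega>)) / real n\<bar> \<le> ln C" if "\<omega> \<in> space S" for n \<omega>
    using abs_ln_op[OF that, of n] C1 by (cases "n = 0") (simp_all add: field_simps)
  have "(\<lambda>n. \<integral>\<omega>. ln (op_norm (W n \<omega>)) / real n \<partial>S) \<longlonglongrightarrow> (\<integral>\<omega>. l \<partial>S)"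
    by (rule integral_dominated_convergence[where w = "\<lambda>_. ln C"]) (use lim b in auto)
  thus ?thesis by (simp add: P.prob_space)
qed

text \<open>Almost surely the vector is not slow, so it grows at the rate of the norm. The normalised logarithms
  are bounded by \<open>ln C\<close>, so the expectations converge too.\<close>

lemma expected_growth:
  assumes irr: line_irreducible
    and lim: "AE \<omega> in S. (\<lambda>n. ln (op_norm (W n \<omega>)) / real n) \<longlonglongrightarrow> l" and l: "l > 0" and v: "norm v = 1"
  shows "(\<lambda>n. (\<integral>\<omega>. ln (norm (W n \<omega> *v v)) \<partial>S) / real n) \<longlonglongrightarrow> l"
proof -
  have v0: "v \<noteq> 0" using v by auto
  have "AE \<omega> in S. \<omega> \<notin> {\<omega> \<in> space S. slow l (\<lambda>n. norm (W n \<omega> *v v))}"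
    using prob_slow_eq_0[OF irr lim l v0] unfolding prob_slow_def
    by (intro AE_not_in) (simp add: null_sets_def P.emeasure_eq_measure)
  moreover have "AE \<omega> in S. \<omega> \<in> space S" by (rule AE_space)
  ultimately have AE: "AE \<omega> in S. (\<lambda>n. ln (norm (W n \<omega> *v v)) / real n) \<longlonglongrightarrow> l" using lim
  proof eventually_elim
    case (elim \<omega>)
    have pos: "norm (W n \<omega> *v v) > 0" for n using W_nz[OF _ v0, of \<omega> n] elim by simp
    have "\<not> slow l (\<lambda>n. norm (W n \<omega> *v v))" using elim by auto
    hence ns: "\<exists>m. \<forall>n\<ge>m. norm (W n \<omega> *v v) \<ge> exp ((l - 1 / (real k + 1)) * real n)" for k
      unfolding slow_def by (meson not_less)
    show ?case
    proof (rule order_tendstoI)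
      fix a assume "a < l"
      then obtain k where k: "1 / (real k + 1) < l - a"
        using reals_Archimedean[of "l - a"] by (auto simp: inverse_eq_divide add.commute)
      from ns[of k] obtain m where m: "\<And>n. n \<ge> m \<Longrightarrow> norm (W n \<omega> *v v) \<ge> exp ((l - 1 / (real k + 1)) * real n)" by blast
      show "eventually (\<lambda>n. a < ln (norm (W n \<omega> *v v)) / real n) sequentially"
        using eventually_ge_at_top[of m] eventually_gt_at_top[of 0]
      proof eventually_elim
        case (elim n)
        have "(l - 1 / (real k + 1)) * real n \<le> ln (norm (W n \<omega> *v v))"
          using m[OF elim(1)] pos[of n] by (simp add: ln_ge_iff)
        hence "l - 1 / (real k + 1) \<le> ln (norm (W n \<omega> *v v)) / real n" using elim by (simp add: field_simps)
        thus ?case using k by linarith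
      qed
    next
      fix a assume "l < a"
      hence "eventually (\<lambda>n. ln (op_norm (W n \<omega>)) / real n < a) sequentially"
        using elim by (intro order_tendstoD(2)) auto
      thus "eventually (\<lambda>n. ln (norm (W n \<omega> *v v)) / real n < a) sequentially"
      proof eventually_elim
        case (elim n)
        have "norm (W n \<omega> *v v) \<le> op_norm (W n \<omega>)" using norm_mv_le[of "W n \<omega>" v] v by simp
        hence "ln (norm (W n \<omega> *v v)) \<le> ln (op_norm (W n \<omega>))"
          using pos[of n] by (intro ln_mono) auto
        hence "ln (norm (W n \<omega> *v v)) / real n \<le> ln (op_norm (W n \<omega>)) / real n"
          by (rule divide_right_mono) simp
        thus ?case using elim by linarith
      qed
    qed
  qed
  have b: "\<bar>ln (norm (W n \<omega> *v v)) / real n\<bar> \<le> ln C" if "\<omega> \<in> space S" for n \<omega>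
    using abs_ln_W[OF that v, of n] C1 by (cases "n = 0") (simp_all add: field_simps)
  have "(\<lambda>n. \<integral>\<omega>. ln (norm (W n \<omega> *v v)) / real n \<partial>S) \<longlonglongrightarrow> (\<integral>\<omega>. l \<partial>S)"
    by (rule integral_dominated_convergence[where w = "\<lambda>_. ln C"]) (use AE b in auto)
  thus ?thesis by (simp add: P.prob_space)
qed

end

section \<open>Large deviations\<close>

lemma exp_le_quadratic:
  fixes x :: real assumes "\<bar>x\<bar> \<le> 1" shows "exp x \<le> 1 + x + x\<^sup>2"
proof (cases "x \<ge> 0")
  case True thus ?thesis using exp_bound[of x] assms by simp
next
  case False
  define y where "y = - x"
  have y: "y > 0" using False by (simp add: y_def)
  have "1 \<le> (1 + y) * (1 - y + y\<^sup>2)"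
  proof -
    have "(1 + y) * (1 - y + y\<^sup>2) = 1 + y ^ 3" by (simp add: algebra_simps power2_eq_square power3_eq_cube)
    thus ?thesis using y by simp
  qed
  moreover have "0 \<le> 1 - y + y\<^sup>2" using zero_le_power2[of "y - 1/2"] by (simp add: power2_eq_square algebra_simps)
  ultimately have "1 \<le> exp y * (1 - y + y\<^sup>2)"
    using exp_ge_add_one_self[of y] by (meson mult_right_mono order_trans)
  hence "exp (- y) \<le> 1 - y + y\<^sup>2" by (simp add: exp_minus field_simps)
  thus ?thesis by (simp add: y_def)
qed

text \<open>For small \<open>t\<close> the exponential moment differs from that of a constant only by the second order term
  \<open>t\<^sup>2 * B\<^sup>2\<close>, which \<open>t * d\<close> dominates.\<close>

lemma (in prob_space) exp_moment_le:
  fixes X :: "'a \<Rightarrow> real"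
  assumes [measurable]: "X \<in> borel_measurable M" and B: "\<And>\<omega>. \<omega> \<in> space M \<Longrightarrow> \<bar>X \<omega>\<bar> \<le> B"
    and E: "expectation X \<le> m" and t: "0 < t" "t * B \<le> 1" "t * B\<^sup>2 \<le> d"
  shows "(\<integral>\<^sup>+\<omega>. ennreal (exp (t * X \<omega>)) \<partial>M) \<le> ennreal (exp (t * (m + d)))"
proof -
  have iX: "integrable M X" by (rule integrable_const_bound[where B = B]) (use B in auto)
  have pt: "exp (t * X \<omega>) \<le> 1 + t * X \<omega> + t * d" if w: "\<omega> \<in> space M" for \<omega>
  proof -
    have 1: "\<bar>t * X \<omega>\<bar> \<le> t * B" using B[OF w] t by (simp add: abs_mult)
    have "(t * X \<omega>)\<^sup>2 \<le> (t * B)\<^sup>2" using 1 by (metis abs_ge_zero power2_abs power_mono)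
    also have "\<dots> = t * (t * B\<^sup>2)" by (simp add: power2_eq_square)
    also have "\<dots> \<le> t * d" using t by (intro mult_left_mono) auto
    finally show ?thesis using exp_le_quadratic[of "t * X \<omega>"] 1 t by linarith
  qed
  have "(\<integral>\<^sup>+\<omega>. ennreal (exp (t * X \<omega>)) \<partial>M) \<le> (\<integral>\<^sup>+\<omega>. ennreal (1 + t * X \<omega> + t * d) \<partial>M)"
    using pt by (intro nn_integral_mono) (simp add: ennreal_leI)
  also have "\<dots> = ennreal (\<integral>\<omega>. 1 + t * X \<omega> + t * d \<partial>M)"
  proof (rule nn_integral_eq_integral)
    show "integrable M (\<lambda>\<omega>. 1 + t * X \<omega> + t * d)" using iX by simp
    show "AE \<omega> in M. 0 \<le> 1 + t * X \<omega> + t * d"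
      using pt by (intro AE_I2) (meson exp_ge_zero order_trans)
  qed
  also have "(\<integral>\<omega>. 1 + t * X \<omega> + t * d \<partial>M) = 1 + t * expectation X + t * d"
    using iX by (simp add: prob_space)
  also have "ennreal \<dots> \<le> ennreal (exp (t * (m + d)))"
  proof (rule ennreal_leI)
    have "1 + t * expectation X + t * d \<le> 1 + t * (m + d)" using E t by (simp add: distrib_left)
    also have "\<dots> \<le> exp (t * (m + d))" by (rule exp_ge_add_one_self)
    finally show "1 + t * expectation X + t * d \<le> exp (t * (m + d))" .
  qed
  finally show ?thesis .
qed

context sl2_walk
begin

lemma W_add_mv: "W (m + n) (comb_seq m \<omega> \<omega>') *v v = W n \<omega>' *v (W m \<omega> *v v)"
  by (simp add: W_add_comb matrix_vector_mul_assoc)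

text \<open>A bound on the negative moment that is available, for every vector, at some time of a bounded
  range propagates to all times: restart the walk at that time, with the vector reached there.\<close>

lemma negative_moment_induct:
  assumes s: "s > 0" and nm: "\<And>w. norm w = 1 \<Longrightarrow> \<exists>n. 1 \<le> n \<and> n \<le> nm \<and>
      (\<integral>\<^sup>+\<omega>. ennreal (norm (W n \<omega> *v w) powr - s) \<partial>S) \<le> ennreal (exp (- s * g * real n))"
    and w: "norm w = 1"
  shows "(\<integral>\<^sup>+\<omega>. ennreal (norm (W n \<omega> *v w) powr - s) \<partial>S)
    \<le> ennreal (exp (s * real nm * (ln C + \<bar>g\<bar>)) * exp (- s * g * real n))"
  using w
proof (induction n arbitrary: w rule: less_induct)
  case (less n)
  let ?K = "exp (s * real nm * (ln C + \<bar>g\<bar>))"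
  obtain k where k: "1 \<le> k" "k \<le> nm"
    "(\<integral>\<^sup>+\<omega>. ennreal (norm (W k \<omega> *v w) powr - s) \<partial>S) \<le> ennreal (exp (- s * g * real k))"
    using nm[OF less.prems] by blast
  show ?case
  proof (cases "n < k")
    case True
    have pt: "norm (W n \<omega> *v w) powr - s \<le> ?K * exp (- s * g * real n)" if \<omega>: "\<omega> \<in> space S" for \<omega>
    proof -
      have "w \<noteq> 0" using less.prems by auto
      hence p: "norm (W n \<omega> *v w) > 0" using W_nz[OF \<omega>] by simp
      have "- ln (norm (W n \<omega> *v w)) \<le> real n * ln C" using abs_ln_W[OF \<omega> less.prems, of n] by simp
      hence "s * - ln (norm (W n \<omega> *v w)) \<le> s * (real n * ln C)" using s by (intro mult_left_mono) auto
      moreover have "s * (real n * ln C) + s * (real n * g) \<le> s * (real nm * (ln C + \<bar>g\<bar>))"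
      proof -
        have "real n * (ln C + g) \<le> real n * (ln C + \<bar>g\<bar>)" by (intro mult_left_mono) auto
        also have "\<dots> \<le> real nm * (ln C + \<bar>g\<bar>)" using C1 True k by (intro mult_right_mono) auto
        finally have "s * (real n * (ln C + g)) \<le> s * (real nm * (ln C + \<bar>g\<bar>))"
          using s by (intro mult_left_mono) auto
        thus ?thesis by (simp add: algebra_simps)
      qed
      ultimately have "- s * ln (norm (W n \<omega> *v w)) \<le> s * real nm * (ln C + \<bar>g\<bar>) + - s * g * real n"
        by (simp add: algebra_simps)
      thus ?thesis using p by (simp add: powr_def exp_add[symmetric])
    qed
    have "(\<integral>\<^sup>+\<omega>. ennreal (norm (W n \<omega> *v w) powr - s) \<partial>S) \<le> (\<integral>\<^sup>+\<omega>. ennreal (?K * exp (- s * g * real n)) \<partial>S)"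
      using pt by (intro nn_integral_mono ennreal_leI) auto
    thus ?thesis by (simp add: P.emeasure_space_1)
  next
    case False
    define m where "m = n - k"
    have n: "n = k + m" "m < n" using False k by (auto simp: m_def)
    have "(\<integral>\<^sup>+\<omega>. ennreal (norm (W n \<omega> *v w) powr - s) \<partial>S)
       = (\<integral>\<^sup>+\<omega>. \<integral>\<^sup>+\<omega>'. ennreal (norm (W m \<omega>' *v (W k \<omega> *v w)) powr - s) \<partial>S \<partial>S)"
      unfolding n by (subst nn_integral_comb_seq[where m = k]) (simp_all add: W_add_mv)
    also have "\<dots> \<le> (\<integral>\<^sup>+\<omega>. ennreal (norm (W k \<omega> *v w) powr - s) * ennreal (?K * exp (- s * g * real m)) \<partial>S)"
    proof (rule nn_integral_mono)
      fix \<omega> assume \<omega>: "\<omega> \<in> space S"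
      define N where "N = norm (W k \<omega> *v w)"
      have "w \<noteq> 0" using less.prems by auto
      hence N: "N > 0" using W_nz[OF \<omega>] by (simp add: N_def)
      define u where "u = (1 / N) *\<^sub>R (W k \<omega> *v w)"
      have u: "norm u = 1" "W k \<omega> *v w = N *\<^sub>R u" using N by (simp_all add: u_def N_def)
      have "(\<integral>\<^sup>+\<omega>'. ennreal (norm (W m \<omega>' *v (W k \<omega> *v w)) powr - s) \<partial>S)
         = (\<integral>\<^sup>+\<omega>'. ennreal (N powr - s) * ennreal (norm (W m \<omega>' *v u) powr - s) \<partial>S)"
        unfolding u(2) using N by (simp add: matrix_vector_mult_scaleR powr_mult ennreal_mult)
      also have "\<dots> = ennreal (N powr - s) * (\<integral>\<^sup>+\<omega>'. ennreal (norm (W m \<omega>' *v u) powr - s) \<partial>S)"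
        by (rule nn_integral_cmult) simp
      also have "\<dots> \<le> ennreal (N powr - s) * ennreal (?K * exp (- s * g * real m))"
        by (intro mult_left_mono less.IH n u) auto
      finally show "(\<integral>\<^sup>+\<omega>'. ennreal (norm (W m \<omega>' *v (W k \<omega> *v w)) powr - s) \<partial>S)
         \<le> ennreal (norm (W k \<omega> *v w) powr - s) * ennreal (?K * exp (- s * g * real m))" unfolding N_def .
    qed
    also have "\<dots> = (\<integral>\<^sup>+\<omega>. ennreal (norm (W k \<omega> *v w) powr - s) \<partial>S) * ennreal (?K * exp (- s * g * real m))"
      by (rule nn_integral_multc) simp
    also have "\<dots> \<le> ennreal (exp (- s * g * real k)) * ennreal (?K * exp (- s * g * real m))"
      by (intro mult_right_mono k) auto
    also have "\<dots> = ennreal (?K * exp (- s * g * real n))"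
      unfolding n by (simp add: ennreal_mult[symmetric] exp_add[symmetric] algebra_simps)
    finally show ?thesis .
  qed
qed

text \<open>At the times where the expected logarithm is at least \<open>g * n\<close>, the exponential moment of \<open>- ln\<close> is
  computed to second order; the error costs only \<open>d\<close> in the rate, because \<open>s\<close> is small.\<close>

lemma negative_moment_bound:
  assumes s: "s > 0" "s * (real nm * ln C) \<le> 1" "s * (real nm * ln C)\<^sup>2 \<le> d"
    and nm: "\<And>w. norm w = 1 \<Longrightarrow> \<exists>n. 1 \<le> n \<and> n \<le> nm \<and> (\<integral>\<omega>. ln (norm (W n \<omega> *v w)) \<partial>S) \<ge> g * real n"
    and w: "norm w = 1"
  shows "(\<integral>\<^sup>+\<omega>. ennreal (norm (W n \<omega> *v w) powr - s) \<partial>S)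
    \<le> ennreal (exp (s * real nm * (ln C + \<bar>g - d\<bar>)) * exp (- s * (g - d) * real n))"
proof (rule negative_moment_induct[OF s(1) _ w])
  fix u :: "real^2" assume u: "norm u = 1"
  obtain k where k: "1 \<le> k" "k \<le> nm" "(\<integral>\<omega>. ln (norm (W k \<omega> *v u)) \<partial>S) \<ge> g * real k"
    using nm[OF u] by blast
  have d: "0 \<le> d" using s by (meson less_imp_le mult_nonneg_nonneg order_trans zero_le_power2)
  have "(\<integral>\<^sup>+\<omega>. ennreal (exp (s * (- ln (norm (W k \<omega> *v u))))) \<partial>S) \<le> ennreal (exp (s * (- (g * real k) + d)))"
  proof (rule P.exp_moment_le[where B = "real nm * ln C"])
    show "\<bar>- ln (norm (W k \<omega> *v u))\<bar> \<le> real nm * ln C" if "\<omega> \<in> space S" for \<omega>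
    proof -
      have "\<bar>- ln (norm (W k \<omega> *v u))\<bar> \<le> real k * ln C" using abs_ln_W[OF that u, of k] by simp
      also have "\<dots> \<le> real nm * ln C" using k C1 by (intro mult_right_mono) auto
      finally show ?thesis .
    qed
  qed (use s k in auto)
  also have "\<dots> \<le> ennreal (exp (- s * (g - d) * real k))"
  proof (intro ennreal_leI iffD2[OF exp_le_cancel_iff])
    have "d * 1 \<le> d * real k" using k d by (intro mult_left_mono) auto
    hence "s * (- (g * real k) + d) \<le> s * (- (g * real k) + d * real k)" using s by (intro mult_left_mono) auto
    thus "s * (- (g * real k) + d) \<le> - s * (g - d) * real k" by (simp add: algebra_simps)
  qed
  also have "(\<integral>\<^sup>+\<omega>. ennreal (exp (s * (- ln (norm (W k \<omega> *v u))))) \<partial>S) = (\<integral>\<^sup>+\<omega>. ennreal (norm (W k \<omega> *v u) powr - s) \<partial>S)"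
  proof (rule nn_integral_cong)
    fix \<omega> assume "\<omega> \<in> space S"
    moreover have "u \<noteq> 0" using u by auto
    ultimately have "norm (W k \<omega> *v u) \<noteq> 0" using W_nz by simp
    thus "ennreal (exp (s * (- ln (norm (W k \<omega> *v u))))) = ennreal (norm (W k \<omega> *v u) powr - s)"
      by (simp add: powr_def)
  qed
  finally show "\<exists>n. 1 \<le> n \<and> n \<le> nm \<and>
      (\<integral>\<^sup>+\<omega>. ennreal (norm (W n \<omega> *v u) powr - s) \<partial>S) \<le> ennreal (exp (- s * (g - d) * real n))"
    using k by blast
qed

text \<open>Markov's inequality, for the walk restarted at time \<open>k\<close>.\<close>

lemma prob_small_growth:
  assumes s: "s > 0" and K: "K \<ge> 0"
    and mom: "\<And>w. norm w = 1 \<Longrightarrow> (\<integral>\<^sup>+\<omega>. ennreal (norm (W n \<omega> *v w) powr - s) \<partial>S) \<le> ennreal K"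
    and t: "t > 0" and v: "v \<noteq> 0"
  shows "P.prob {\<omega> \<in> space S. norm (W (k + n) \<omega> *v v) < t * norm (W k \<omega> *v v)} \<le> t powr s * K"
proof -
  let ?A = "{\<omega> \<in> space S. norm (W (k + n) \<omega> *v v) < t * norm (W k \<omega> *v v)}"
  have [measurable]: "?A \<in> sets S" by measurable
  have "emeasure S ?A = (\<integral>\<^sup>+\<omega>. indicator ?A \<omega> \<partial>S)" by simp
  also have "\<dots> \<le> (\<integral>\<^sup>+\<omega>. ennreal (t powr s * (norm (W k \<omega> *v v) powr s * norm (W (k + n) \<omega> *v v) powr - s)) \<partial>S)"
  proof (rule nn_integral_mono)
    fix \<omega> assume \<omega>: "\<omega> \<in> space S"
    have p: "norm (W k \<omega> *v v) > 0" "norm (W (k + n) \<omega> *v v) > 0" using W_nz[OF \<omega> v] by simp_all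
    have "1 \<le> t powr s * (norm (W k \<omega> *v v) powr s * norm (W (k + n) \<omega> *v v) powr - s)"
      if "norm (W (k + n) \<omega> *v v) < t * norm (W k \<omega> *v v)"
    proof -
      have "norm (W (k + n) \<omega> *v v) powr s \<le> (t * norm (W k \<omega> *v v)) powr s"
        using that p s by (intro powr_mono2) auto
      hence "norm (W (k + n) \<omega> *v v) powr s \<le> t powr s * norm (W k \<omega> *v v) powr s"
        using p t by (simp add: powr_mult)
      thus ?thesis using p by (simp add: powr_minus field_simps)
    qed
    thus "indicator ?A \<omega> \<le> ennreal (t powr s * (norm (W k \<omega> *v v) powr s * norm (W (k + n) \<omega> *v v) powr - s))"
      by (auto simp: indicator_def ennreal_le_iff2 simp flip: ennreal_1)
  qed
  also have "\<dots> = (\<integral>\<^sup>+\<omega>. \<integral>\<^sup>+\<omega>'. ennreal (t powr s * (norm (W k \<omega> *v v) powr s *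
      norm (W n \<omega>' *v (W k \<omega> *v v)) powr - s)) \<partial>S \<partial>S)"
    by (subst nn_integral_comb_seq[where m = k]) (simp_all add: W_add_mv)
  also have "\<dots> \<le> (\<integral>\<^sup>+\<omega>. ennreal (t powr s * K) \<partial>S)"
  proof (rule nn_integral_mono)
    fix \<omega> assume \<omega>: "\<omega> \<in> space S"
    define N where "N = norm (W k \<omega> *v v)"
    have N: "N > 0" using W_nz[OF \<omega> v] by (simp add: N_def)
    define u where "u = (1 / N) *\<^sub>R (W k \<omega> *v v)"
    have u: "norm u = 1" "W k \<omega> *v v = N *\<^sub>R u" using N by (simp_all add: u_def N_def)
    have "N powr s * norm (W n \<omega>' *v (N *\<^sub>R u)) powr - s = norm (W n \<omega>' *v u) powr - s" for \<omega>'
      using N by (simp add: matrix_vector_mult_scaleR powr_mult powr_minus field_simps)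
    hence "(\<integral>\<^sup>+\<omega>'. ennreal (t powr s * (N powr s * norm (W n \<omega>' *v (W k \<omega> *v v)) powr - s)) \<partial>S)
        = (\<integral>\<^sup>+\<omega>'. ennreal (t powr s) * ennreal (norm (W n \<omega>' *v u) powr - s) \<partial>S)"
      unfolding u(2) by (simp add: ennreal_mult)
    also have "\<dots> = ennreal (t powr s) * (\<integral>\<^sup>+\<omega>'. ennreal (norm (W n \<omega>' *v u) powr - s) \<partial>S)"
      by (rule nn_integral_cmult) simp
    also have "\<dots> \<le> ennreal (t powr s) * ennreal K" by (intro mult_left_mono mom u) auto
    also have "\<dots> = ennreal (t powr s * K)" using K by (simp add: ennreal_mult)
    finally show "(\<integral>\<^sup>+\<omega>'. ennreal (t powr s * (norm (W k \<omega> *v v) powr s *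
      norm (W n \<omega>' *v (W k \<omega> *v v)) powr - s)) \<partial>S) \<le> ennreal (t powr s * K)" unfolding N_def .
  qed
  also have "\<dots> = ennreal (t powr s * K)" by (simp add: P.emeasure_space_1)
  finally show ?thesis using K t by (simp add: P.emeasure_eq_measure ennreal_le_iff)
qed

end

locale matrix_family = sequence_space M for M :: "'w measure" +
  fixes F :: "'w \<Rightarrow> real \<Rightarrow> real^2^2" and J :: "real set" and C :: real
    and W :: "nat \<Rightarrow> real \<Rightarrow> (nat \<Rightarrow> 'w) \<Rightarrow> real^2^2"
  assumes F_meas: "\<And>a. a \<in> J \<Longrightarrow> (\<lambda>x. F x a) \<in> borel_measurable M"
    and F_det: "\<And>x a. x \<in> space M \<Longrightarrow> a \<in> J \<Longrightarrow> det (F x a) = 1"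
    and F_bd: "\<And>x a. x \<in> space M \<Longrightarrow> a \<in> J \<Longrightarrow> op_norm (F x a) \<le> C"
    and F_lip: "\<And>x a b. x \<in> space M \<Longrightarrow> a \<in> J \<Longrightarrow> b \<in> J \<Longrightarrow> op_norm (F x a - F x b) \<le> C * \<bar>a - b\<bar>"
    and C1: "1 \<le> C"
  defines "W \<equiv> \<lambda>n a \<omega>. mprod (\<lambda>i. F (\<omega> i) a) n"
begin

lemma walk: "a \<in> J \<Longrightarrow> sl2_walk M (\<lambda>x. F x a) C"
  by (intro sl2_walk.intro sequence_space_axioms sl2_walk_axioms.intro F_meas F_det F_bd C1)

lemma W_eq: "mprod (\<lambda>i. F (\<omega> i) a) n = W n a \<omega>" by (simp add: W_def)

lemmas W_simps = sl2_walk.W_Suc[OF walk, unfolded W_eq]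
lemmas W_meas = sl2_walk.W_meas[OF walk, unfolded W_eq]
lemmas W_det = sl2_walk.W_det[OF walk, unfolded W_eq]
lemmas W_op = sl2_walk.W_op[OF walk, unfolded W_eq]
lemmas W_nz = sl2_walk.W_nz[OF walk, unfolded W_eq]
lemmas abs_ln_W = sl2_walk.abs_ln_W[OF walk, unfolded W_eq]
lemmas abs_ln_op = sl2_walk.abs_ln_op[OF walk, unfolded W_eq]
lemmas negative_moment_bound = sl2_walk.negative_moment_bound[OF walk, unfolded W_eq]
lemmas prob_small_growth = sl2_walk.prob_small_growth[OF walk, unfolded W_eq]
lemmas expected_growth = sl2_walk.expected_growth[OF walk, unfolded W_eq]
lemmas expected_op_norm_growth = sl2_walk.expected_op_norm_growth[OF walk, unfolded W_eq]
lemmas nn_integral_comb_seq = sl2_walk.nn_integral_comb_seq[OF walk]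

lemma W_0 [simp]: "W 0 a \<omega> = mat 1" by (simp add: W_def)

lemma in_space: "\<omega> \<in> space S \<Longrightarrow> \<omega> i \<in> space M"
  by (auto simp: space_PiM)

lemma W_lipschitz:
  assumes "\<omega> \<in> space S" "a \<in> J" "b \<in> J"
  shows "op_norm (W n a \<omega> - W n b \<omega>) \<le> real n * C ^ n * \<bar>a - b\<bar>"
proof (induction n)
  case 0 show ?case using op_norm_le[of 0 0] by simp
next
  case (Suc n)
  let ?f = "F (\<omega> n)"
  have "W (Suc n) a \<omega> - W (Suc n) b \<omega> = ?f a ** (W n a \<omega> - W n b \<omega>) + (?f a - ?f b) ** W n b \<omega>"
    using assms by (simp add: W_simps matrix_matrix_mult_def vec_eq_iff sum_2 algebra_simps)
  also have "op_norm \<dots> \<le> op_norm (?f a ** (W n a \<omega> - W n b \<omega>)) + op_norm ((?f a - ?f b) ** W n b \<omega>)"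
    by (rule op_norm_triangle)
  also have "\<dots> \<le> op_norm (?f a) * op_norm (W n a \<omega> - W n b \<omega>) + op_norm (?f a - ?f b) * op_norm (W n b \<omega>)"
    by (intro add_mono op_norm_mult)
  also have "\<dots> \<le> C * (real n * C ^ n * \<bar>a - b\<bar>) + (C * \<bar>a - b\<bar>) * C ^ n"
    using C1 by (intro add_mono mult_mono F_bd F_lip W_op Suc in_space assms) auto
  also have "\<dots> = real (Suc n) * C ^ Suc n * \<bar>a - b\<bar>" by (simp add: algebra_simps)
  finally show ?case .
qed

lemma tendsto_expected_ln_W:
  assumes a: "\<And>m. A m \<in> J" "A \<longlonglongrightarrow> a" "a \<in> J" and v: "\<And>m. norm (v m) = 1" "v \<longlonglongrightarrow> w"
  shows "(\<lambda>m. \<integral>\<omega>. ln (norm (W n (A m) \<omega> *v v m)) \<partial>S) \<longlonglongrightarrow> (\<integral>\<omega>. ln (norm (W n a \<omega> *v w)) \<partial>S)"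
proof (rule integral_dominated_convergence[where w = "\<lambda>_. real n * ln C"])
  have w: "norm w = 1" using tendsto_norm[OF v(2)] v(1) by (simp add: LIMSEQ_const_iff)
  note [measurable] = W_meas[OF a(3)] W_meas[OF a(1)]
  show "(\<lambda>\<omega>. ln (norm (W n a \<omega> *v w))) \<in> borel_measurable S" by measurable
  show "(\<lambda>\<omega>. ln (norm (W n (A m) \<omega> *v v m))) \<in> borel_measurable S" for m by measurable
  show "AE \<omega> in S. norm (ln (norm (W n (A m) \<omega> *v v m))) \<le> real n * ln C" for m
    using abs_ln_W[OF a(1) _ v(1)] by (intro AE_I2) simp
  show "AE \<omega> in S. (\<lambda>m. ln (norm (W n (A m) \<omega> *v v m))) \<longlonglongrightarrow> ln (norm (W n a \<omega> *v w))"
  proof (rule AE_I2)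
    fix \<omega> assume \<omega>: "\<omega> \<in> space S"
    have "(\<lambda>m. W n (A m) \<omega> *v v m - W n a \<omega> *v v m) \<longlonglongrightarrow> 0"
    proof (rule Lim_null_comparison)
      show "eventually (\<lambda>m. norm (W n (A m) \<omega> *v v m - W n a \<omega> *v v m) \<le> real n * C ^ n * \<bar>A m - a\<bar>) sequentially"
      proof (rule always_eventually, rule allI)
        fix m
        have "norm (W n (A m) \<omega> *v v m - W n a \<omega> *v v m) = norm ((W n (A m) \<omega> - W n a \<omega>) *v v m)"
          by (simp add: matrix_vector_mult_diff_rdistrib)
        also have "\<dots> \<le> op_norm (W n (A m) \<omega> - W n a \<omega>) * norm (v m)" by (rule norm_mv_le)
        also have "\<dots> \<le> real n * C ^ n * \<bar>A m - a\<bar>" using W_lipschitz[OF \<omega> a(1) a(3)] v(1) by simp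
        finally show "norm (W n (A m) \<omega> *v v m - W n a \<omega> *v v m) \<le> real n * C ^ n * \<bar>A m - a\<bar>" .
      qed
      have "(\<lambda>m. real n * C ^ n * \<bar>A m - a\<bar>) \<longlonglongrightarrow> real n * C ^ n * \<bar>a - a\<bar>"
        by (intro tendsto_intros a)
      thus "(\<lambda>m. real n * C ^ n * \<bar>A m - a\<bar>) \<longlonglongrightarrow> 0" by simp
    qed
    moreover have "(\<lambda>m. W n a \<omega> *v v m) \<longlonglongrightarrow> W n a \<omega> *v w" by (intro tendsto_intros v)
    ultimately have "(\<lambda>m. (W n (A m) \<omega> *v v m - W n a \<omega> *v v m) + W n a \<omega> *v v m) \<longlonglongrightarrow> 0 + W n a \<omega> *v w"
      by (rule tendsto_add)
    hence "(\<lambda>m. W n (A m) \<omega> *v v m) \<longlonglongrightarrow> W n a \<omega> *v w" by simp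
    moreover have "w \<noteq> 0" using w by auto
    hence "norm (W n a \<omega> *v w) \<noteq> 0" using W_nz[OF a(3) \<omega>, of w] by simp
    ultimately show "(\<lambda>m. ln (norm (W n (A m) \<omega> *v v m))) \<longlonglongrightarrow> ln (norm (W n a \<omega> *v w))"
      by (intro tendsto_ln tendsto_norm)
  qed
qed simp

text \<open>The unit vectors form a compact set, and the expected growth at a fixed time is continuous in the
  vector and the parameter. So the time at which it is close to its limit can be bounded
  uniformly near a given parameter.\<close>

lemma uniform_expected_growth:
  assumes a0: "a0 \<in> J" and lim: "\<And>v. norm v = 1 \<Longrightarrow> (\<lambda>n. (\<integral>\<omega>. ln (norm (W n a0 \<omega> *v v)) \<partial>S) / real n) \<longlonglongrightarrow> l"
    and g: "g < l"
  shows "\<exists>r>0. \<exists>nm\<ge>1. \<forall>a\<in>J. \<bar>a - a0\<bar> < r \<longrightarrow> (\<forall>w. norm w = 1 \<longrightarrow>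
    (\<exists>n. 1 \<le> n \<and> n \<le> nm \<and> (\<integral>\<omega>. ln (norm (W n a \<omega> *v w)) \<partial>S) \<ge> g * real n))"
proof (rule ccontr)
  assume neg: "\<not> ?thesis"
  have "\<exists>a w. a \<in> J \<and> \<bar>a - a0\<bar> < 1 / real (Suc m) \<and> norm w = 1 \<and>
    (\<forall>n. 1 \<le> n \<longrightarrow> n \<le> Suc m \<longrightarrow> (\<integral>\<omega>. ln (norm (W n a \<omega> *v w)) \<partial>S) < g * real n)" for m
  proof (rule ccontr)
    assume n2: "\<not> ?thesis"
    have "?thesis \<or> (\<exists>r>0. \<exists>nm\<ge>1. \<forall>a\<in>J. \<bar>a - a0\<bar> < r \<longrightarrow> (\<forall>w. norm w = 1 \<longrightarrow>
      (\<exists>n. 1 \<le> n \<and> n \<le> nm \<and> (\<integral>\<omega>. ln (norm (W n a \<omega> *v w)) \<partial>S) \<ge> g * real n)))"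
      apply (rule disjI2)
      apply (rule exI[of _ "1 / real (Suc m)"], rule conjI, simp)
      apply (rule exI[of _ "Suc m"], rule conjI, simp)
      using n2 by (meson not_le)
    thus False using neg n2 by blast
  qed
  then obtain A v where A: "\<And>m. A m \<in> J" "\<And>m. \<bar>A m - a0\<bar> < 1 / real (Suc m)" and v: "\<And>m. norm (v m) = 1"
    and small: "\<And>m n. 1 \<le> n \<Longrightarrow> n \<le> Suc m \<Longrightarrow> (\<integral>\<omega>. ln (norm (W n (A m) \<omega> *v v m)) \<partial>S) < g * real n"
    by metis
  have Alim: "A \<longlonglongrightarrow> a0"
  proof (rule LIM_zero_cancel, rule Lim_null_comparison)
    show "eventually (\<lambda>m. norm (A m - a0) \<le> 1 / real (Suc m)) sequentially"
      using A(2) by (intro always_eventually) (auto intro: less_imp_le)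
    show "(\<lambda>m. 1 / real (Suc m)) \<longlonglongrightarrow> 0" by (rule LIMSEQ_Suc[OF lim_1_over_n])
  qed
  have "compact (sphere (0::real^2) 1)" by simp
  then obtain w \<rho> where w: "w \<in> sphere 0 1" "strict_mono \<rho>" "(v \<circ> \<rho>) \<longlonglongrightarrow> w"
    using v unfolding compact_def by (metis mem_sphere_0)
  hence w1: "norm w = 1" by simp
  have "eventually (\<lambda>n. (\<integral>\<omega>. ln (norm (W n a0 \<omega> *v w)) \<partial>S) / real n > g) sequentially"
    using lim[OF w1] g by (intro order_tendstoD(1)) auto
  moreover have "eventually (\<lambda>n. n \<ge> (1::nat)) sequentially" by (rule eventually_ge_at_top)
  ultimately have "eventually (\<lambda>n. (\<integral>\<omega>. ln (norm (W n a0 \<omega> *v w)) \<partial>S) / real n > g \<and> n \<ge> 1) sequentially"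
    by (rule eventually_conj)
  then obtain n where n: "n \<ge> 1" "(\<integral>\<omega>. ln (norm (W n a0 \<omega> *v w)) \<partial>S) / real n > g"
    by (auto simp: eventually_sequentially)
  have "(\<lambda>m. \<integral>\<omega>. ln (norm (W n ((A \<circ> \<rho>) m) \<omega> *v (v \<circ> \<rho>) m)) \<partial>S) \<longlonglongrightarrow> (\<integral>\<omega>. ln (norm (W n a0 \<omega> *v w)) \<partial>S)"
    using A v w LIMSEQ_subseq_LIMSEQ[OF Alim w(2)] by (intro tendsto_expected_ln_W a0) (auto simp: o_def)
  moreover have "eventually (\<lambda>m. (\<integral>\<omega>. ln (norm (W n ((A \<circ> \<rho>) m) \<omega> *v (v \<circ> \<rho>) m)) \<partial>S) \<le> g * real n) sequentially"
    using eventually_ge_at_top[of n]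
  proof eventually_elim
    case (elim m)
    have "n \<le> Suc (\<rho> m)" using elim seq_suble[OF w(2), of m] by simp
    thus ?case using small[OF n(1), of "\<rho> m"] by simp
  qed
  ultimately have "(\<integral>\<omega>. ln (norm (W n a0 \<omega> *v w)) \<partial>S) \<le> g * real n"
    by (rule tendsto_upperbound) simp
  thus False using n by (simp add: field_simps)
qed

lemma uniform_negative_moment:
  assumes a0: "a0 \<in> J" and lim: "\<And>v. norm v = 1 \<Longrightarrow> (\<lambda>n. (\<integral>\<omega>. ln (norm (W n a0 \<omega> *v v)) \<partial>S) / real n) \<longlonglongrightarrow> l"
    and \<epsilon>: "\<epsilon> > 0"
  shows "\<exists>r>0. \<exists>s>0. \<exists>K>0. s \<le> 1 \<and> (\<forall>a\<in>J. \<bar>a - a0\<bar> < r \<longrightarrow> (\<forall>w n. norm w = 1 \<longrightarrow>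
    (\<integral>\<^sup>+\<omega>. ennreal (norm (W n a \<omega> *v w) powr - s) \<partial>S) \<le> ennreal (K * exp (- s * (l - \<epsilon>) * real n))))"
proof -
  obtain r nm where r: "r > 0" "nm \<ge> 1" and growth: "\<And>a w. a \<in> J \<Longrightarrow> \<bar>a - a0\<bar> < r \<Longrightarrow> norm w = 1 \<Longrightarrow>
    \<exists>n. 1 \<le> n \<and> n \<le> nm \<and> (\<integral>\<omega>. ln (norm (W n a \<omega> *v w)) \<partial>S) \<ge> (l - \<epsilon> / 2) * real n"
    using uniform_expected_growth[OF a0 lim, of "l - \<epsilon> / 2"] \<epsilon> by auto
  define B where "B = real nm * ln C"
  have B: "B \<ge> 0" using C1 by (simp add: B_def)
  \<comment> \<open>so small that the second order error stays below half of \<open>\<epsilon>\<close>\<close>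
  define s where "s = min (1 / (B + 1)) (\<epsilon> / 2 / (B\<^sup>2 + 1))"
  have s: "s > 0" "s * B \<le> 1" "s * B\<^sup>2 \<le> \<epsilon> / 2" "s \<le> 1"
  proof -
    have B2: "0 < B\<^sup>2 + 1" by (simp add: add_nonneg_pos)
    show "s > 0" using B B2 \<epsilon> by (simp add: s_def)
    have "s * B \<le> 1 / (B + 1) * B" using B by (intro mult_right_mono) (auto simp: s_def)
    also have "\<dots> \<le> 1" using B by (simp add: field_simps)
    finally show "s * B \<le> 1" .
    have "s * B\<^sup>2 \<le> \<epsilon> / 2 / (B\<^sup>2 + 1) * B\<^sup>2" by (intro mult_right_mono) (auto simp: s_def)
    also have "\<dots> = \<epsilon> / 2 * (B\<^sup>2 / (B\<^sup>2 + 1))" by simp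
    also have "\<dots> \<le> \<epsilon> / 2 * 1" using \<epsilon> B2 by (intro mult_left_mono) (auto simp: field_simps)
    finally show "s * B\<^sup>2 \<le> \<epsilon> / 2" by simp
    have "s \<le> 1 / (B + 1)" by (simp add: s_def)
    also have "\<dots> \<le> 1" using B by (simp add: field_simps)
    finally show "s \<le> 1" .
  qed
  define K where "K = exp (s * real nm * (ln C + \<bar>l - \<epsilon>\<bar>))"
  have "(\<integral>\<^sup>+\<omega>. ennreal (norm (W n a \<omega> *v w) powr - s) \<partial>S) \<le> ennreal (K * exp (- s * (l - \<epsilon>) * real n))"
    if "a \<in> J" "\<bar>a - a0\<bar> < r" "norm w = 1" for a w n
    using negative_moment_bound[OF that(1) s(1) s(2,3)[unfolded B_def], of "l - \<epsilon> / 2" w n] growth[OF that(1,2)] that(3)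
    unfolding K_def by simp
  moreover have "K > 0" by (simp add: K_def)
  ultimately show ?thesis using r(1) s(1,4) by blast
qed

text \<open>Uniform upper bounds are easier: the norm of a product of fixed length \<open>m\<close> is Lipschitz in the
  parameter, so it suffices to control products of independent norms at the single parameter \<open>a0\<close>.\<close>

lemma uniform_upper_bound:
  assumes a0: "a0 \<in> J" and lim: "(\<lambda>n. (\<integral>\<omega>. ln (op_norm (W n a0 \<omega>)) \<partial>S) / real n) \<longlonglongrightarrow> l"
    and l: "l \<ge> 0" and \<epsilon>: "\<epsilon> > 0"
  shows "\<exists>r>0. \<exists>c>0. \<exists>K>0. \<forall>p. \<exists>E\<in>sets S. P.prob E \<le> K * exp (- c * real p) \<and>
    (\<forall>\<omega>\<in>space S - E. \<forall>a\<in>J. \<bar>a - a0\<bar> < r \<longrightarrow> op_norm (W p a \<omega>) \<le> exp ((l + \<epsilon>) * real p))"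
proof -
  define d where "d = \<epsilon> / 5"
  have d: "d > 0" using \<epsilon> by (simp add: d_def)
  note [measurable] = W_meas[OF a0]
  have "eventually (\<lambda>n. (\<integral>\<omega>. ln (op_norm (W n a0 \<omega>)) \<partial>S) / real n < l + d \<and> n \<ge> 1) sequentially"
    using lim d by (intro eventually_conj order_tendstoD(2) eventually_ge_at_top) auto
  then obtain m where m: "m \<ge> 1" "(\<integral>\<omega>. ln (op_norm (W m a0 \<omega>)) \<partial>S) / real m < l + d"
    by (auto simp: eventually_sequentially)
  define X where "X = (\<lambda>\<omega>. ln (op_norm (W m a0 \<omega>)))"
  have [measurable]: "X \<in> borel_measurable S" unfolding X_def by measurable
  have W1: "1 \<le> op_norm (W n a \<omega>)" if "\<omega> \<in> space S" "a \<in> J" for n a \<omega>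
    using that by (intro op_norm_ge_1 W_det)
  define B where "B = real m * ln C"
  have B: "B \<ge> 0" using C1 by (simp add: B_def)
  have XB: "\<bar>X \<omega>\<bar> \<le> B" if "\<omega> \<in> space S" for \<omega> using abs_ln_op[OF a0 that] by (simp add: X_def B_def)
  have EX: "P.expectation X \<le> (l + d) * real m" using m unfolding X_def by (simp add: field_simps)
  define t where "t = min (1 / (B + 1)) (d / (B\<^sup>2 + 1))"
  have t: "t > 0" "t * B \<le> 1" "t * B\<^sup>2 \<le> d"
  proof -
    have B2: "0 < B\<^sup>2 + 1" by (simp add: add_nonneg_pos)
    show "t > 0" using B B2 d by (simp add: t_def)
    have "t * B \<le> 1 / (B + 1) * B" using B by (intro mult_right_mono) (auto simp: t_def)
    also have "\<dots> \<le> 1" using B by (simp add: field_simps)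
    finally show "t * B \<le> 1" .
    have "t * B\<^sup>2 \<le> d / (B\<^sup>2 + 1) * B\<^sup>2" by (intro mult_right_mono) (auto simp: t_def)
    also have "\<dots> = d * (B\<^sup>2 / (B\<^sup>2 + 1))" by simp
    also have "\<dots> \<le> d * 1" using d B2 by (intro mult_left_mono) (auto simp: field_simps)
    finally show "t * B\<^sup>2 \<le> d" by simp
  qed
  have mom: "(\<integral>\<^sup>+\<omega>. ennreal (exp (t * X \<omega>)) \<partial>S) \<le> ennreal (exp (t * ((l + 2 * d) * real m)))"
  proof -
    have "(\<integral>\<^sup>+\<omega>. ennreal (exp (t * X \<omega>)) \<partial>S) \<le> ennreal (exp (t * ((l + d) * real m + d)))"
      by (rule P.exp_moment_le[OF _ XB EX t]) auto
    also have "\<dots> \<le> ennreal (exp (t * ((l + 2 * d) * real m)))"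
    proof (intro ennreal_leI iffD2[OF exp_le_cancel_iff] mult_left_mono)
      have "d * 1 \<le> d * real m" using m d by (intro mult_left_mono) auto
      thus "(l + d) * real m + d \<le> (l + 2 * d) * real m" by (simp add: algebra_simps)
    qed (use t in auto)
    finally show ?thesis .
  qed
  \<comment> \<open>sum of the independent logarithms of the norms of \<open>k\<close> consecutive products of length \<open>m\<close>\<close>
  define Q where "Q = rec_nat (\<lambda>\<omega>. 0) (\<lambda>_ q \<omega>. X \<omega> + q (\<lambda>i. \<omega> (m + i)))"
  have Q0: "Q 0 = (\<lambda>\<omega>. 0)" and QS: "Q (Suc k) = (\<lambda>\<omega>. X \<omega> + Q k (\<lambda>i. \<omega> (m + i)))" for k
    by (simp_all add: Q_def)
  have shift [measurable]: "(\<lambda>\<omega> i. \<omega> (m + i)) \<in> S \<rightarrow>\<^sub>M S"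
    by (rule measurable_PiM_single') (auto simp: space_PiM)
  have Qm [measurable]: "Q k \<in> borel_measurable S" for k
    by (induction k) (auto simp: Q0 QS intro!: borel_measurable_add measurable_compose[OF shift])
  have Qmom: "(\<integral>\<^sup>+\<omega>. ennreal (exp (t * Q k \<omega>)) \<partial>S) \<le> ennreal (exp (t * ((l + 2 * d) * real (k * m))))" for k
  proof (induction k)
    case 0 show ?case by (simp add: Q0 P.emeasure_space_1)
  next
    case (Suc k)
    have Xc: "X (comb_seq m \<omega> \<omega>') = X \<omega>" for \<omega> \<omega>'
      using sl2_walk.W_comb[OF walk[OF a0], of m \<omega> \<omega>', unfolded W_eq] by (simp add: X_def)
    have Qc: "Q (Suc k) (comb_seq m \<omega> \<omega>') = X \<omega> + Q k \<omega>'" for \<omega> \<omega>'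
      by (simp add: QS Xc, simp add: comb_seq_def)
    have "(\<integral>\<^sup>+\<omega>. ennreal (exp (t * Q (Suc k) \<omega>)) \<partial>S)
       = (\<integral>\<^sup>+\<omega>. \<integral>\<^sup>+\<omega>'. ennreal (exp (t * X \<omega>)) * ennreal (exp (t * Q k \<omega>')) \<partial>S \<partial>S)"
      by (subst nn_integral_comb_seq[OF a0, where m = m])
         (simp_all add: Qc distrib_left exp_add ennreal_mult)
    also have "\<dots> = (\<integral>\<^sup>+\<omega>. ennreal (exp (t * X \<omega>)) * (\<integral>\<^sup>+\<omega>'. ennreal (exp (t * Q k \<omega>')) \<partial>S) \<partial>S)"
      by (simp add: nn_integral_cmult)
    also have "\<dots> = (\<integral>\<^sup>+\<omega>. ennreal (exp (t * X \<omega>)) \<partial>S) * (\<integral>\<^sup>+\<omega>'. ennreal (exp (t * Q k \<omega>')) \<partial>S)"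
      by (simp add: nn_integral_multc)
    also have "\<dots> \<le> ennreal (exp (t * ((l + 2 * d) * real m))) * ennreal (exp (t * ((l + 2 * d) * real (k * m))))"
      by (intro mult_mono mom Suc) auto
    also have "\<dots> = ennreal (exp (t * ((l + 2 * d) * real (Suc k * m))))"
      by (simp add: ennreal_mult[symmetric] exp_add[symmetric] algebra_simps)
    finally show ?case .
  qed
  define L where "L = real m * C ^ m"
  define r where "r = d / (L + 1)"
  have L: "L \<ge> 0" using C1 by (simp add: L_def)
  have r: "r > 0" "L * r \<le> d" using L d by (auto simp: r_def field_simps)
  have near: "ln (op_norm (W m a \<omega>)) \<le> X \<omega> + d * real m" if "\<omega> \<in> space S" "a \<in> J" "\<bar>a - a0\<bar> < r" for a \<omega>
  proof -
    have "op_norm (W m a \<omega>) \<le> op_norm (W m a \<omega> - W m a0 \<omega>) + op_norm (W m a0 \<omega>)"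
      using op_norm_triangle[of "W m a \<omega> - W m a0 \<omega>" "W m a0 \<omega>"] by simp
    also have "\<dots> \<le> L * \<bar>a - a0\<bar> + op_norm (W m a0 \<omega>)"
      using W_lipschitz[OF that(1,2) a0] by (simp add: L_def)
    also have "\<dots> \<le> d + op_norm (W m a0 \<omega>)"
      using mult_left_mono[OF less_imp_le[OF that(3)] L] r by simp
    also have "\<dots> \<le> (1 + d) * op_norm (W m a0 \<omega>)"
      using W1[OF that(1) a0, of m] d by (simp add: distrib_right)
    finally have "ln (op_norm (W m a \<omega>)) \<le> ln ((1 + d) * op_norm (W m a0 \<omega>))"
      using W1[OF that(1,2), of m] by (intro ln_mono) auto
    also have "\<dots> = ln (1 + d) + X \<omega>" using W1[OF that(1) a0, of m] d by (simp add: ln_mult X_def)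
    also have "ln (1 + d) \<le> d * 1" using d ln_add_one_self_le_self[of d] by simp
    also have "d * 1 \<le> d * real m" using m d by (intro mult_left_mono) auto
    finally show ?thesis by simp
  qed
  have blocks: "ln (op_norm (W (k * m + j) a \<omega>)) \<le> Q k \<omega> + d * real (k * m) + real j * ln C"
    if "\<omega> \<in> space S" "a \<in> J" "\<bar>a - a0\<bar> < r" for k j a \<omega>
    using that
  proof (induction k arbitrary: \<omega>)
    case 0 thus ?case using abs_ln_op[of a \<omega> j] by (simp add: Q0)
  next
    case (Suc k)
    define \<omega>' where "\<omega>' = (\<lambda>i. \<omega> (m + i))"
    have \<omega>': "\<omega>' \<in> space S" using Suc.prems(1) by (auto simp: \<omega>'_def space_PiM)
    have "W (Suc k * m + j) a \<omega> = W (k * m + j) a \<omega>' ** W m a \<omega>"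
      using mprod_add[of "\<lambda>i. F (\<omega> i) a" m "k * m + j"] by (simp add: W_def \<omega>'_def algebra_simps)
    hence "ln (op_norm (W (Suc k * m + j) a \<omega>)) \<le> ln (op_norm (W (k * m + j) a \<omega>') * op_norm (W m a \<omega>))"
      using W1[OF Suc.prems(1,2), of "Suc k * m + j"] op_norm_mult[of "W (k * m + j) a \<omega>'" "W m a \<omega>"]
      by (intro ln_mono) auto
    also have "\<dots> = ln (op_norm (W (k * m + j) a \<omega>')) + ln (op_norm (W m a \<omega>))"
      using W1[OF \<omega>' Suc.prems(2), of "k * m + j"] W1[OF Suc.prems(1,2), of m] by (simp add: ln_mult)
    also have "\<dots> \<le> (Q k \<omega>' + d * real (k * m) + real j * ln C) + (X \<omega> + d * real m)"
      by (intro add_mono Suc.IH near \<omega>' Suc.prems)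
    also have "\<dots> = Q (Suc k) \<omega> + d * real (Suc k * m) + real j * ln C"
      by (simp add: QS \<omega>'_def algebra_simps)
    finally show ?case .
  qed
  define K where "K = exp (t * (real m * ln C))"
  define c where "c = t * (2 * d)"
  have "\<exists>E\<in>sets S. P.prob E \<le> K * exp (- c * real p) \<and>
    (\<forall>\<omega>\<in>space S - E. \<forall>a\<in>J. \<bar>a - a0\<bar> < r \<longrightarrow> op_norm (W p a \<omega>) \<le> exp ((l + \<epsilon>) * real p))" for p
  proof -
    define k where "k = p div m"
    define j where "j = p mod m"
    have p: "p = k * m + j" "j \<le> m" using m by (auto simp: k_def j_def less_imp_le)
    have kp: "real (k * m) \<le> real p" using p(1) by linarith
    \<comment> \<open>the last product is shorter than \<open>m\<close> and costs at most \<open>real m * ln C\<close>\<close>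
    define z where "z = (l + 4 * d) * real p - real m * ln C"
    define E where "E = {\<omega> \<in> space S. Q k \<omega> > z}"
    have [measurable]: "E \<in> sets S" unfolding E_def by measurable
    have "emeasure S E = (\<integral>\<^sup>+\<omega>. indicator E \<omega> \<partial>S)" by simp
    also have "\<dots> \<le> (\<integral>\<^sup>+\<omega>. ennreal (exp (- t * z)) * ennreal (exp (t * Q k \<omega>)) \<partial>S)"
    proof (rule nn_integral_mono)
      fix \<omega>
      have "1 \<le> exp (- t * z) * exp (t * Q k \<omega>)" if "z < Q k \<omega>"
      proof -
        have "t * z \<le> t * Q k \<omega>" using that t by (intro mult_left_mono) auto
        thus ?thesis by (simp add: exp_add[symmetric])
      qed
      thus "indicator E \<omega> \<le> ennreal (exp (- t * z)) * ennreal (exp (t * Q k \<omega>))"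
        by (auto simp: indicator_def E_def ennreal_mult[symmetric] simp flip: ennreal_1)
    qed
    also have "\<dots> = ennreal (exp (- t * z)) * (\<integral>\<^sup>+\<omega>. ennreal (exp (t * Q k \<omega>)) \<partial>S)"
      by (rule nn_integral_cmult) measurable
    also have "\<dots> \<le> ennreal (exp (- t * z)) * ennreal (exp (t * ((l + 2 * d) * real (k * m))))"
      by (intro mult_left_mono Qmom) auto
    also have "\<dots> = ennreal (exp (- t * z + t * ((l + 2 * d) * real (k * m))))"
      by (simp only: ennreal_mult[symmetric] exp_ge_zero exp_add)
    also have "\<dots> \<le> ennreal (K * exp (- c * real p))"
    proof (rule ennreal_leI)
      have "(l + 2 * d) * real (k * m) \<le> (l + 2 * d) * real p" using kp l d by (intro mult_left_mono) auto
      hence "t * ((l + 2 * d) * real (k * m) - z) \<le> t * ((l + 2 * d) * real p - z)"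
        using t by (intro mult_left_mono) auto
      also have "\<dots> = t * (real m * ln C) + - c * real p" by (simp add: z_def c_def algebra_simps)
      finally have "- t * z + t * ((l + 2 * d) * real (k * m)) \<le> t * (real m * ln C) + - c * real p"
        by (simp add: algebra_simps)
      thus "exp (- t * z + t * ((l + 2 * d) * real (k * m))) \<le> K * exp (- c * real p)"
        unfolding K_def exp_add[symmetric] by simp
    qed
    finally have 1: "P.prob E \<le> K * exp (- c * real p)"
      by (simp add: P.emeasure_eq_measure K_def ennreal_le_iff)
    have 2: "op_norm (W p a \<omega>) \<le> exp ((l + \<epsilon>) * real p)"
      if \<omega>: "\<omega> \<in> space S" "\<omega> \<notin> E" and a: "a \<in> J" "\<bar>a - a0\<bar> < r" for a \<omega>
    proof -
      have "ln (op_norm (W p a \<omega>)) \<le> Q k \<omega> + d * real (k * m) + real j * ln C"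
        unfolding p(1) by (rule blocks[OF \<omega>(1) a])
      also have "\<dots> \<le> z + d * real p + real m * ln C"
        using \<omega> kp d p C1 by (intro add_mono mult_left_mono mult_right_mono) (auto simp: E_def not_less)
      also have "\<dots> = (l + \<epsilon>) * real p" by (simp add: z_def d_def algebra_simps)
      finally have "exp (ln (op_norm (W p a \<omega>))) \<le> exp ((l + \<epsilon>) * real p)" by simp
      thus ?thesis using W1[OF \<omega>(1) a(1), of p] by simp
    qed
    show ?thesis using 1 2 by (intro bexI[of _ E]) auto
  qed
  moreover have "c > 0" "K > 0" using t d by (simp_all add: c_def K_def)
  ultimately show ?thesis using r(1) by blast
qed

end

section \<open>Exceptional parameters at a given scale\<close>

text \<open>The vectors are almost parallel and the matrices almost equal, so \<open>A\<close> stretches \<open>x\<close> hardly more than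
  \<open>B\<close> stretches \<open>y\<close>.\<close>

lemma growth_ratio_step:
  assumes A: "det A = 1" "op_norm A \<le> C" and AB: "op_norm (A - B) \<le> C * h" and h: "0 \<le> h"
    and B: "det B = 1" "op_norm B \<le> C" and xy: "\<bar>cr x y\<bar> \<le> \<eta> * norm x * norm y"
  shows "norm (A *v x) * norm y \<le> (1 + C\<^sup>2 * (h + \<eta>)) * (norm (B *v y) * norm x)"
proof -
  have C: "C \<ge> 1" using op_norm_ge_1[OF A(1)] A(2) by simp
  have y: "norm y \<le> C * norm (B *v y)"
    using norm_le_op_norm_mv[OF B(1), of y] B(2) by (meson mult_right_mono norm_ge_zero order_trans)
  have "A *v x = B *v x + (A - B) *v x" by (simp add: matrix_vector_mult_diff_rdistrib)
  hence "norm (A *v x) \<le> norm (B *v x) + norm ((A - B) *v x)" by (metis norm_triangle_ineq)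
  also have "norm ((A - B) *v x) \<le> C * h * norm x"
    using norm_mv_le[of "A - B" x] AB by (meson mult_right_mono norm_ge_zero order_trans)
  finally have "norm (A *v x) * norm y \<le> (norm (B *v x) + C * h * norm x) * norm y"
    by (intro mult_right_mono) auto
  also have "\<dots> = norm (B *v x) * norm y + C * h * norm x * norm y" by (simp add: algebra_simps)
  also have "norm (B *v x) * norm y \<le> norm x * norm (B *v y) + \<bar>cr y x\<bar> * op_norm B"
    by (rule norm_mv_parallel)
  also have "\<bar>cr y x\<bar> * op_norm B \<le> (\<eta> * norm x * norm y) * C"
    using xy B(2) C by (intro mult_mono) (auto simp: cr_commute[of y x])
  finally have "norm (A *v x) * norm y \<le> norm x * norm (B *v y) + (C * (h + \<eta>) * norm x) * norm y"
    by (simp add: algebra_simps)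
  also have "(C * (h + \<eta>) * norm x) * norm y \<le> (C * (h + \<eta>) * norm x) * (C * norm (B *v y))"
  proof (cases "x = 0 \<or> y = 0")
    case False
    have "0 \<le> \<eta> * (norm x * norm y)" using xy by (metis abs_ge_zero mult.assoc order_trans)
    moreover have "norm x * norm y > 0" using False by simp
    ultimately have "0 \<le> \<eta>" by (metis mult_less_0_iff not_le not_less_iff_gr_or_eq order.asym)
    thus ?thesis using C h y by (intro mult_left_mono) auto
  qed auto
  finally show ?thesis by (simp add: power2_eq_square algebra_simps)
qed

text \<open>Two products with nearby factors: as long as the images of \<open>e\<close> stay almost parallel, they grow at
  almost the same rate, and the area they span is controlled by the accumulated differences of the
  factors. If \<open>u\<close> grows enough between any two times, the area stays small compared with
  the product of the lengths.\<close>

locale nearby_products =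
  fixes A B :: "nat \<Rightarrow> real^2^2" and C h \<eta> \<kappa> :: real and e :: "real^2" and u w
  assumes A: "\<And>i. det (A i) = 1" "\<And>i. op_norm (A i) \<le> C"
    and B: "\<And>i. det (B i) = 1" "\<And>i. op_norm (B i) \<le> C"
    and AB: "\<And>i. op_norm (A i - B i) \<le> C * h" and h: "0 < h" and \<eta>: "0 < \<eta>"
    and \<kappa>: "C\<^sup>2 * (h + \<eta>) \<le> \<kappa>" and e: "e \<noteq> 0"
  defines "u \<equiv> \<lambda>n. mprod A n *v e" and "w \<equiv> \<lambda>n. mprod B n *v e"
begin

lemma Suc_eqs: "u (Suc n) = A n *v u n" "w (Suc n) = B n *v w n" "u 0 = e" "w 0 = e"
  by (simp_all add: u_def w_def mprod_Suc_mv del: mprod.simps(2))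

lemma nz: "u n \<noteq> 0" "w n \<noteq> 0"
  by (induction n) (simp_all add: Suc_eqs e mv_nonzero A B)

lemma C_ge_1: "C \<ge> 1" using op_norm_ge_1[OF A(1)] A(2) order_trans by blast

lemma ratio:
  assumes "\<And>i. i < n \<Longrightarrow> \<bar>cr (u i) (w i)\<bar> \<le> \<eta> * norm (u i) * norm (w i)" and "k \<le> n"
  shows "norm (u n) * norm (w k) \<le> exp (\<kappa> * real (n - k)) * (norm (w n) * norm (u k))"
  using assms(2)
proof (induction k rule: inc_induct)
  case base show ?case by (simp add: mult.commute)
next
  case (step k)
  have "norm (u (Suc k)) * norm (w k) \<le> (1 + C\<^sup>2 * (h + \<eta>)) * (norm (w (Suc k)) * norm (u k))"
    unfolding Suc_eqs using assms(1)[OF step.hyps(2)] h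
    by (intro growth_ratio_step A B AB) auto
  also have "\<dots> \<le> exp \<kappa> * (norm (w (Suc k)) * norm (u k))"
  proof (rule mult_right_mono)
    show "1 + C\<^sup>2 * (h + \<eta>) \<le> exp \<kappa>" using \<kappa> exp_ge_add_one_self[of \<kappa>] by linarith
  qed simp
  finally have 1: "norm (u (Suc k)) * norm (w k) \<le> exp \<kappa> * (norm (w (Suc k)) * norm (u k))" .
  have "(norm (u n) * norm (w k)) * (norm (w (Suc k)) * norm (u (Suc k)))
      = (norm (u n) * norm (w (Suc k))) * (norm (u (Suc k)) * norm (w k))" by (simp add: algebra_simps)
  also have "\<dots> \<le> (exp (\<kappa> * real (n - Suc k)) * (norm (w n) * norm (u (Suc k)))) * (exp \<kappa> * (norm (w (Suc k)) * norm (u k)))"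
    by (intro mult_mono step.IH 1) auto
  also have "\<dots> = (exp (\<kappa> * real (n - Suc k)) * exp \<kappa>) * (norm (w n) * norm (u k)) * (norm (w (Suc k)) * norm (u (Suc k)))"
    by (simp add: algebra_simps)
  also have "exp (\<kappa> * real (n - Suc k)) * exp \<kappa> = exp (\<kappa> * real (n - k))"
  proof -
    have "n - k = Suc (n - Suc k)" using step.hyps by simp
    thus ?thesis by (simp add: exp_add[symmetric] algebra_simps)
  qed
  finally have "(norm (u n) * norm (w k)) * (norm (w (Suc k)) * norm (u (Suc k)))
      \<le> (exp (\<kappa> * real (n - k)) * (norm (w n) * norm (u k))) * (norm (w (Suc k)) * norm (u (Suc k)))" .
  thus ?case by (rule mult_right_le_imp_le) (use nz in simp)
qed

lemma cross_le: "\<bar>cr (u n) (w n)\<bar> \<le> (\<Sum>k<n. C\<^sup>2 * h * (norm (u k) * norm (w k)))"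
proof (induction n)
  case 0 show ?case by (simp add: Suc_eqs)
next
  case (Suc n)
  have "cr (u (Suc n)) (w (Suc n)) = cr (u n) (w n) - cr (A n *v u n) ((A n - B n) *v w n)"
  proof -
    have "B n *v w n = A n *v w n - (A n - B n) *v w n" by (simp add: matrix_vector_mult_diff_rdistrib)
    thus ?thesis unfolding Suc_eqs by (simp add: cr_diff cr_matrix A)
  qed
  hence "\<bar>cr (u (Suc n)) (w (Suc n))\<bar> \<le> \<bar>cr (u n) (w n)\<bar> + \<bar>cr (A n *v u n) ((A n - B n) *v w n)\<bar>" by simp
  also have "\<bar>cr (A n *v u n) ((A n - B n) *v w n)\<bar> \<le> norm (A n *v u n) * norm ((A n - B n) *v w n)"
    by (rule abs_cr_le)
  also have "\<dots> \<le> (C * norm (u n)) * ((C * h) * norm (w n))"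
  proof (rule mult_mono)
    show "norm (A n *v u n) \<le> C * norm (u n)"
      using norm_mv_le[of "A n" "u n"] A(2)[of n] by (meson mult_right_mono norm_ge_zero order_trans)
    show "norm ((A n - B n) *v w n) \<le> (C * h) * norm (w n)"
      using norm_mv_le[of "A n - B n" "w n"] AB[of n] by (meson mult_right_mono norm_ge_zero order_trans)
  qed (use C_ge_1 in auto)
  also have "\<dots> = C\<^sup>2 * h * (norm (u n) * norm (w n))" by (simp add: power2_eq_square)
  finally show ?case using Suc by simp
qed

text \<open>Induction on the time: up to time \<open>n\<close> the two products grow alike, so the growth of \<open>u\<close> from \<open>k\<close> to \<open>n\<close>
  bounds the \<open>k\<close>-th contribution to the area by \<open>\<eta> / L\<close> of its allowed value. The smaller \<open>h\<close>, the
  less \<open>u\<close> has to grow.\<close>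

lemma stay_parallel:
  assumes t: "\<And>m. t m \<ge> 0" "\<And>m. (t m)\<^sup>2 \<ge> real L * C\<^sup>2 * h / \<eta> * exp (\<kappa> * real m)"
    and big: "\<And>k n. k < n \<Longrightarrow> n \<le> L \<Longrightarrow> norm (u n) \<ge> t (n - k) * norm (u k)" and n: "n \<le> L"
  shows "\<bar>cr (u n) (w n)\<bar> \<le> \<eta> * norm (u n) * norm (w n)"
  using n
proof (induction n rule: less_induct)
  case (less n)
  show ?case
  proof (cases "n = 0")
    case True thus ?thesis using \<eta> by (simp add: Suc_eqs)
  next
    case False
    hence L: "real L > 0" using less.prems by simp
    have term_le: "C\<^sup>2 * h * (norm (u k) * norm (w k)) \<le> \<eta> / real L * (norm (u n) * norm (w n))" if k: "k < n" for k
    proof -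
      have r: "norm (u n) * norm (w k) \<le> exp (\<kappa> * real (n - k)) * (norm (w n) * norm (u k))"
        using less k by (intro ratio) auto
      have "real L * C\<^sup>2 * h / \<eta> * exp (\<kappa> * real (n - k)) * (norm (u k))\<^sup>2 \<le> (t (n - k))\<^sup>2 * (norm (u k))\<^sup>2"
        by (intro mult_right_mono t) auto
      also have "\<dots> = (t (n - k) * norm (u k))\<^sup>2" by (simp add: power_mult_distrib)
      also have "\<dots> \<le> (norm (u n))\<^sup>2" using big[OF k less.prems] t by (intro power_mono) auto
      finally have "real L * C\<^sup>2 * h / \<eta> * exp (\<kappa> * real (n - k)) * (norm (u k))\<^sup>2 \<le> (norm (u n))\<^sup>2" .
      hence 2: "C\<^sup>2 * h * exp (\<kappa> * real (n - k)) * (norm (u k))\<^sup>2 \<le> \<eta> / real L * (norm (u n))\<^sup>2"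
        using L \<eta> by (simp add: field_simps)
      have "(C\<^sup>2 * h * (norm (u k) * norm (w k))) * norm (u n) = C\<^sup>2 * h * norm (u k) * (norm (u n) * norm (w k))"
        by (simp add: algebra_simps)
      also have "\<dots> \<le> C\<^sup>2 * h * norm (u k) * (exp (\<kappa> * real (n - k)) * (norm (w n) * norm (u k)))"
        using h by (intro mult_left_mono r) auto
      also have "\<dots> = (C\<^sup>2 * h * exp (\<kappa> * real (n - k)) * (norm (u k))\<^sup>2) * norm (w n)"
        by (simp add: power2_eq_square algebra_simps)
      also have "\<dots> \<le> (\<eta> / real L * (norm (u n))\<^sup>2) * norm (w n)"
        by (intro mult_right_mono 2) auto
      also have "\<dots> = (\<eta> / real L * (norm (u n) * norm (w n))) * norm (u n)"
        by (simp add: power2_eq_square algebra_simps)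
      finally have "(C\<^sup>2 * h * (norm (u k) * norm (w k))) * norm (u n)
        \<le> (\<eta> / real L * (norm (u n) * norm (w n))) * norm (u n)" .
      thus ?thesis by (rule mult_right_le_imp_le) (use nz in simp)
    qed
    have "\<bar>cr (u n) (w n)\<bar> \<le> (\<Sum>k<n. C\<^sup>2 * h * (norm (u k) * norm (w k)))" by (rule cross_le)
    also have "\<dots> \<le> (\<Sum>k<n. \<eta> / real L * (norm (u n) * norm (w n)))" by (intro sum_mono term_le) auto
    also have "\<dots> = real n / real L * (\<eta> * norm (u n) * norm (w n))" by simp
    also have "\<dots> \<le> 1 * (\<eta> * norm (u n) * norm (w n))"
      using less.prems L \<eta> by (intro mult_right_mono) auto
    finally show ?thesis by simp
  qed
qed

end

lemma ge_on_interval_if_ge_on_rats: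
  fixes f :: "real \<Rightarrow> real"
  assumes f: "continuous_on {b..b'} f" and b: "b < b'" and ge: "\<And>x. x \<in> {b..b'} \<inter> \<rat> \<Longrightarrow> c \<le> f x"
    and a: "a \<in> {b..b'}"
  shows "c \<le> f a"
proof (rule ccontr)
  assume n: "\<not> c \<le> f a"
  hence "c - f a > 0" by simp
  then obtain d where d: "d > 0" "\<And>x. x \<in> {b..b'} \<Longrightarrow> \<bar>x - a\<bar> < d \<Longrightarrow> \<bar>f x - f a\<bar> < c - f a"
    using f[unfolded continuous_on_iff, rule_format, OF a] unfolding dist_real_def by blast
  have "max b (a - d) < min b' (a + d)" using a b d by auto
  then obtain q where q: "q \<in> \<rat>" "max b (a - d) < q" "q < min b' (a + d)" using Rats_dense_in_real by blast
  hence "\<bar>f q - f a\<bar> < c - f a" by (intro d) auto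
  moreover have "c \<le> f q" using q by (intro ge) auto
  ultimately show False by linarith
qed

locale rotating_family = matrix_family M F "{\<alpha>..\<beta>}" C for M :: "'w measure" and F \<alpha> \<beta> C +
  fixes D :: "'w \<Rightarrow> real \<Rightarrow> real^2^2" and \<Theta> :: real
  assumes ab: "\<alpha> < \<beta>"
    and deriv: "\<And>x a. x \<in> space M \<Longrightarrow> a \<in> {\<alpha>..\<beta>} \<Longrightarrow> (F x has_vector_derivative D x a) (at a within {\<alpha>..\<beta>})"
    and pos: "\<And>x a v. x \<in> space M \<Longrightarrow> a \<in> {\<alpha>..\<beta>} \<Longrightarrow> v \<noteq> 0 \<Longrightarrow> cr (F x a *v v) (D x a *v v) > 0"
    and total: "\<And>x. x \<in> space M \<Longrightarrow> \<exists>\<theta>. continuous_on {\<alpha>..\<beta>} \<theta> \<and>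
        (\<forall>a\<in>{\<alpha>..\<beta>}. F x a *v dir 0 = norm (F x a *v dir 0) *\<^sub>R dir (\<theta> a)) \<and> \<theta> \<beta> - \<theta> \<alpha> \<le> \<Theta>"
    and \<Theta>: "0 \<le> \<Theta>"
begin

abbreviation e :: "real^2" where "e \<equiv> dir 0"

lemma e_nz: "e \<noteq> 0" using norm_dir[of 0] by (auto simp del: norm_dir)

lemma rotating: "\<omega> \<in> space S \<Longrightarrow> rotating_product \<alpha> \<beta> \<Theta> (\<lambda>i. F (\<omega> i)) (\<lambda>i. D (\<omega> i))"
  by (intro rotating_product.intro ab F_det deriv pos total in_space)

lemmas rotation_count = rotating_product.rotation_count[OF rotating, unfolded W_eq]
lemmas W_cont = rotating_product.cont_w[OF rotating, unfolded W_eq]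

definition cell :: "nat \<Rightarrow> nat \<Rightarrow> real" where
  "cell N i = \<alpha> + real i * ((\<beta> - \<alpha>) / real N)"

lemma cell_Suc: "cell N (Suc i) = cell N i + (\<beta> - \<alpha>) / real N"
  by (simp add: cell_def distrib_right add_divide_distrib)

lemma cell_mono: "cell N i \<le> cell N (Suc i)"
  using ab by (simp add: cell_Suc)

lemma cell_in: assumes "i \<le> N" "N > 0" shows "cell N i \<in> {\<alpha>..\<beta>}"
proof -
  have "real i * ((\<beta> - \<alpha>) / real N) \<le> real N * ((\<beta> - \<alpha>) / real N)"
    using assms ab by (intro mult_right_mono) auto
  thus ?thesis using assms ab by (simp add: cell_def)
qed

lemma cells_cover: assumes "N > 0" "a \<in> {\<alpha>..\<beta>}" shows "\<exists>i<N. a \<in> {cell N i..cell N (Suc i)}"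
proof (cases "a = \<beta>")
  case True
  have "cell N (Suc (N - 1)) = \<beta>" using assms by (simp add: cell_def)
  thus ?thesis using assms True cell_mono[of N "N - 1"] by (intro exI[of _ "N - 1"]) auto
next
  case False
  define h where "h = (\<beta> - \<alpha>) / real N"
  have h: "h > 0" using ab assms by (simp add: h_def)
  define i where "i = nat \<lfloor>(a - \<alpha>) / h\<rfloor>"
  have "0 \<le> (a - \<alpha>) / h" using assms h by simp
  hence i: "real i \<le> (a - \<alpha>) / h" "(a - \<alpha>) / h < real i + 1" unfolding i_def by linarith+
  have "(a - \<alpha>) / h < real N" using False assms ab by (simp add: h_def field_simps)
  hence "i < N" using i(1) by linarith
  moreover have "a \<in> {cell N i..cell N (Suc i)}"
    using i h by (simp add: cell_def h_def[symmetric] field_simps)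
  ultimately show ?thesis by blast
qed

text \<open>Only rational parameters are tested, which makes this a countable union of measurable sets; continuity
  takes care of the other parameters of the cell.\<close>

definition turned :: "real \<Rightarrow> nat \<Rightarrow> nat \<Rightarrow> nat \<Rightarrow> (nat \<Rightarrow> 'w) set" where
  "turned \<eta> N i n = {\<omega> \<in> space S. \<exists>a\<in>{cell N i..cell N (Suc i)} \<inter> \<rat>.
     \<bar>cr (W n (cell N i) \<omega> *v e) (W n a \<omega> *v e)\<bar> > \<eta> * norm (W n (cell N i) \<omega> *v e) * norm (W n a \<omega> *v e)}"

text \<open>Outside of this event, the growth at the left end point of the cell carries over to the whole cell.\<close>

definition exceptional :: "real \<Rightarrow> nat \<Rightarrow> nat \<Rightarrow> real \<Rightarrow> nat \<Rightarrow> (nat \<Rightarrow> 'w) set" where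
  "exceptional \<eta> N L \<tau> i = (\<Union>n\<le>L. turned \<eta> N i n) \<union> {\<omega> \<in> space S. norm (W L (cell N i) \<omega> *v e) < \<tau>}"

lemma sets_turned [measurable]: assumes i: "i < N" shows "turned \<eta> N i n \<in> sets S"
proof -
  let ?I = "{cell N i..cell N (Suc i)} \<inter> \<rat>"
  let ?A = "\<lambda>a. {\<omega> \<in> space S. \<bar>cr (W n (cell N i) \<omega> *v e) (W n a \<omega> *v e)\<bar>
      > \<eta> * norm (W n (cell N i) \<omega> *v e) * norm (W n a \<omega> *v e)}"
  have "?A a \<in> sets S" if "a \<in> ?I" for a
  proof -
    have "a \<in> {\<alpha>..\<beta>}" using that cell_in[of i N] cell_in[of "Suc i" N] i by auto
    moreover have "cell N i \<in> {\<alpha>..\<beta>}" using cell_in[of i N] i by simp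
    ultimately have [measurable]: "W n a \<in> borel_measurable S" "W n (cell N i) \<in> borel_measurable S"
      using W_meas by blast+
    show ?thesis by measurable
  qed
  hence "(\<Union>a\<in>?I. ?A a) \<in> sets S"
    by (intro sets.countable_UN'' countable_Int2 countable_rat)
  moreover have "turned \<eta> N i n = (\<Union>a\<in>?I. ?A a)" by (auto simp: turned_def)
  ultimately show ?thesis by simp
qed

lemma sets_short [measurable]: assumes "i < N" shows "{\<omega> \<in> space S. norm (W L (cell N i) \<omega> *v e) < \<tau>} \<in> sets S"
proof -
  have [measurable]: "W L (cell N i) \<in> borel_measurable S" using W_meas cell_in[of i N] assms by simp
  show ?thesis by measurable
qed

lemma sets_exceptional: "i < N \<Longrightarrow> exceptional \<eta> N L \<tau> i \<in> sets S"
  unfolding exceptional_def by (intro sets.Un sets.finite_UN sets_turned sets_short) auto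

lemma nearby:
  assumes \<omega>: "\<omega> \<in> space S" and i: "i < N" and a: "a \<in> {cell N i..cell N (Suc i)}"
    and \<eta>: "\<eta> > 0" and \<kappa>: "C\<^sup>2 * ((\<beta> - \<alpha>) / real N + \<eta>) \<le> \<kappa>"
  shows "nearby_products (\<lambda>j. F (\<omega> j) (cell N i)) (\<lambda>j. F (\<omega> j) a) C ((\<beta> - \<alpha>) / real N) \<eta> \<kappa> e"
proof -
  have b: "cell N i \<in> {\<alpha>..\<beta>}" "a \<in> {\<alpha>..\<beta>}" using a cell_in[of i N] cell_in[of "Suc i" N] i by auto
  have "op_norm (F (\<omega> j) (cell N i) - F (\<omega> j) a) \<le> C * ((\<beta> - \<alpha>) / real N)" for j
  proof -
    have "op_norm (F (\<omega> j) (cell N i) - F (\<omega> j) a) \<le> C * \<bar>cell N i - a\<bar>"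
      by (intro F_lip in_space \<omega> b)
    also have "\<dots> \<le> C * ((\<beta> - \<alpha>) / real N)"
      using a C1 cell_Suc[of N i] by (intro mult_left_mono) auto
    finally show ?thesis .
  qed
  thus ?thesis using ab i \<eta> \<kappa> e_nz
    by (intro nearby_products.intro F_det F_bd in_space \<omega> b) auto
qed

lemma growth_if_not_exceptional:
  assumes \<omega>: "\<omega> \<in> space S" "\<omega> \<notin> exceptional \<eta> N L \<tau> i" and i: "i < N" and a: "a \<in> {cell N i..cell N (Suc i)}"
    and \<eta>: "\<eta> > 0" and \<kappa>: "C\<^sup>2 * ((\<beta> - \<alpha>) / real N + \<eta>) \<le> \<kappa>"
  shows "exp (- \<kappa> * real L) * \<tau> \<le> norm (W L a \<omega> *v e)"
proof (rule ge_on_interval_if_ge_on_rats[where f = "\<lambda>a. norm (W L a \<omega> *v e)", OF _ _ _ a])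
  have "{cell N i..cell N (Suc i)} \<subseteq> {\<alpha>..\<beta>}" using cell_in[of i N] cell_in[of "Suc i" N] i by auto
  thus "continuous_on {cell N i..cell N (Suc i)} (\<lambda>a. norm (W L a \<omega> *v e))"
    by (intro continuous_on_norm continuous_on_subset[OF W_cont[OF \<omega>(1)]])
  show "cell N i < cell N (Suc i)" using ab i by (simp add: cell_Suc)
  fix x assume x: "x \<in> {cell N i..cell N (Suc i)} \<inter> \<rat>"
  interpret nearby_products "\<lambda>j. F (\<omega> j) (cell N i)" "\<lambda>j. F (\<omega> j) x" C "(\<beta> - \<alpha>) / real N" \<eta> \<kappa> e
    "\<lambda>n. W n (cell N i) \<omega> *v e" "\<lambda>n. W n x \<omega> *v e"
    using nearby[OF \<omega>(1) i _ \<eta> \<kappa>] x by (auto simp: W_eq)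
  have "norm (W L (cell N i) \<omega> *v e) * norm (W 0 x \<omega> *v e)
      \<le> exp (\<kappa> * real (L - 0)) * (norm (W L x \<omega> *v e) * norm (W 0 (cell N i) \<omega> *v e))"
    using \<omega> x by (intro ratio) (auto simp: exceptional_def turned_def not_less)
  hence "norm (W L (cell N i) \<omega> *v e) \<le> exp (\<kappa> * real L) * norm (W L x \<omega> *v e)" by simp
  moreover have "\<tau> \<le> norm (W L (cell N i) \<omega> *v e)" using \<omega> by (auto simp: exceptional_def)
  ultimately have "\<tau> \<le> exp (\<kappa> * real L) * norm (W L x \<omega> *v e)" by simp
  thus "exp (- \<kappa> * real L) * \<tau> \<le> norm (W L x \<omega> *v e)"
    by (simp add: exp_minus field_simps)
qed

text \<open>The sum is the expected number of turned cells, which the total rotation bounds for every sequence.\<close>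

lemma sum_prob_turned:
  assumes "\<eta> > 0" "N > 0"
  shows "(\<Sum>i<N. P.prob (turned \<eta> N i n)) \<le> real n * (\<Theta> + 2 * pi) / \<eta>"
proof -
  have "(\<Sum>i<N. P.prob (turned \<eta> N i n)) = (\<Sum>i<N. P.expectation (indicator (turned \<eta> N i n)))"
    by (intro sum.cong) (auto intro!: sets.sets_into_space sets_turned simp: Int_absorb1 Int_absorb2)
  also have "\<dots> = P.expectation (\<lambda>\<omega>. \<Sum>i<N. indicator (turned \<eta> N i n) \<omega>)"
    by (intro Bochner_Integration.integral_sum[symmetric])
       (auto intro!: integrable_real_indicator sets_turned simp: less_top[symmetric])
  also have "\<dots> \<le> real n * (\<Theta> + 2 * pi) / \<eta>"
  proof (rule P.integral_le_const)
    show "integrable S (\<lambda>\<omega>. \<Sum>i<N. indicator (turned \<eta> N i n) \<omega> :: real)"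
      by (auto intro!: integrable_real_indicator sets_turned Bochner_Integration.integrable_sum simp: less_top[symmetric])
    show "AE \<omega> in S. (\<Sum>i<N. indicator (turned \<eta> N i n) \<omega>) \<le> real n * (\<Theta> + 2 * pi) / \<eta>"
    proof (rule AE_I2)
      fix \<omega> assume \<omega>: "\<omega> \<in> space S"
      let ?X = "{i. i < N \<and> (\<exists>a\<in>{cell N i..cell N (Suc i)}. \<bar>cr (W n (cell N i) \<omega> *v e) (W n a \<omega> *v e)\<bar>
          > \<eta> * norm (W n (cell N i) \<omega> *v e) * norm (W n a \<omega> *v e))}"
      have "(\<Sum>i<N. indicator (turned \<eta> N i n) \<omega> :: real) = real (card {i. i < N \<and> \<omega> \<in> turned \<eta> N i n})"
        by (simp add: indicator_def sum.If_cases Int_def)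
      also have "\<dots> \<le> real (card ?X)"
        by (intro of_nat_mono card_mono) (auto simp: turned_def)
      also have "\<dots> \<le> real n * (\<Theta> + 2 * pi) / \<eta>"
        using assms by (intro rotation_count[OF \<omega>] cell_in cell_mono) auto
      finally show "(\<Sum>i<N. indicator (turned \<eta> N i n) \<omega>) \<le> real n * (\<Theta> + 2 * pi) / \<eta>" .
    qed
  qed
  finally show ?thesis .
qed

text \<open>The direction turns within the cell only if, from some time \<open>k\<close> to some later time \<open>k + m\<close>, the
  orbit at the left end point grows by a factor less than \<open>t m\<close>; there are at most \<open>(L + 1)\<^sup>2\<close> pairs of times.\<close>

lemma prob_turned_le:
  assumes \<eta>: "\<eta> > 0" and \<kappa>: "C\<^sup>2 * ((\<beta> - \<alpha>) / real N + \<eta>) \<le> \<kappa>" and i: "i < N"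
    and t: "\<And>m. t m \<ge> 0" "\<And>m. (t m)\<^sup>2 \<ge> real L * C\<^sup>2 * ((\<beta> - \<alpha>) / real N) / \<eta> * exp (\<kappa> * real m)"
    and q: "\<And>k m. m > 0 \<Longrightarrow> k + m \<le> L \<Longrightarrow>
      P.prob {\<omega> \<in> space S. norm (W (k + m) (cell N i) \<omega> *v e) < t m * norm (W k (cell N i) \<omega> *v e)} \<le> q"
    and q0: "q \<ge> 0"
  shows "P.prob (\<Union>n\<le>L. turned \<eta> N i n) \<le> real ((L + 1) ^ 2) * q"
proof -
  have [measurable]: "W n (cell N i) \<in> borel_measurable S" for n using W_meas cell_in[of i N] i by simp
  let ?B = "\<lambda>(k, m). {\<omega> \<in> space S. norm (W (k + m) (cell N i) \<omega> *v e) < t m * norm (W k (cell N i) \<omega> *v e)}"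
  let ?I = "{(k, m). m > 0 \<and> k + m \<le> L}"
  have I: "?I \<subseteq> {..L} \<times> {..L}" by auto
  hence fI: "finite ?I" by (rule finite_subset) auto
  have Bm: "?B z \<in> sets S" for z unfolding split_beta by measurable
  have "(\<Union>n\<le>L. turned \<eta> N i n) \<subseteq> (\<Union>z\<in>?I. ?B z)"
  proof (rule subsetI, rule ccontr)
    fix \<omega> assume "\<omega> \<in> (\<Union>n\<le>L. turned \<eta> N i n)" and no: "\<omega> \<notin> (\<Union>z\<in>?I. ?B z)"
    then obtain n x where n: "n \<le> L" and \<omega>: "\<omega> \<in> space S" and x: "x \<in> {cell N i..cell N (Suc i)}"
      and cr: "\<bar>cr (W n (cell N i) \<omega> *v e) (W n x \<omega> *v e)\<bar> > \<eta> * norm (W n (cell N i) \<omega> *v e) * norm (W n x \<omega> *v e)"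
      by (auto simp: turned_def)
    interpret nearby_products "\<lambda>j. F (\<omega> j) (cell N i)" "\<lambda>j. F (\<omega> j) x" C "(\<beta> - \<alpha>) / real N" \<eta> \<kappa> e
      "\<lambda>n. W n (cell N i) \<omega> *v e" "\<lambda>n. W n x \<omega> *v e"
      using nearby[OF \<omega> i x \<eta> \<kappa>] by (auto simp: W_eq)
    have "t (n' - k) * norm (W k (cell N i) \<omega> *v e) \<le> norm (W n' (cell N i) \<omega> *v e)" if "k < n'" "n' \<le> L" for k n'
    proof -
      have "(k, n' - k) \<in> ?I" using that by simp
      hence "\<omega> \<notin> ?B (k, n' - k)" using no by blast
      thus ?thesis using that \<omega> by (simp add: not_less)
    qed
    hence "\<bar>cr (W n (cell N i) \<omega> *v e) (W n x \<omega> *v e)\<bar> \<le> \<eta> * norm (W n (cell N i) \<omega> *v e) * norm (W n x \<omega> *v e)"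
      by (intro stay_parallel[OF t _ n])
    thus False using cr by simp
  qed
  hence "P.prob (\<Union>n\<le>L. turned \<eta> N i n) \<le> P.prob (\<Union>z\<in>?I. ?B z)"
    using Bm fI by (intro P.finite_measure_mono sets.finite_UN) auto
  also have "\<dots> \<le> (\<Sum>z\<in>?I. P.prob (?B z))"
    using Bm fI by (intro P.finite_measure_subadditive_finite) auto
  also have "\<dots> \<le> (\<Sum>z\<in>?I. q)" using q by (intro sum_mono) auto
  also have "\<dots> = real (card ?I) * q" by simp
  also have "\<dots> \<le> real ((L + 1) ^ 2) * q"
  proof -
    have "card ?I \<le> card ({..L} \<times> {..L})" by (rule card_mono) (use I in auto)
    also have "\<dots> = (L + 1) ^ 2" by (simp add: card_cartesian_product power2_eq_square)
    finally show ?thesis using q0 by (intro mult_right_mono of_nat_mono) auto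
  qed
  finally show ?thesis .
qed

text \<open>The exceptional cells at two separated times are independent. There are few exceptional cells, and
  each given cell is exceptional with small probability, so a common exceptional cell is unlikely.\<close>

lemma prob_common_exceptional:
  assumes d: "L \<le> d" and N: "N > 0" and q: "\<And>i. i < N \<Longrightarrow> P.prob (exceptional \<eta> N L \<tau> i) \<le> q"
  defines "E \<equiv> \<Union>i<N. {\<omega> \<in> space S. \<omega> \<in> exceptional \<eta> N L \<tau> i \<and> (\<lambda>n. \<omega> (d + n)) \<in> exceptional \<eta> N L \<tau> i}"
  shows "E \<in> sets S" "P.prob E \<le> q * (\<Sum>i<N. P.prob (exceptional \<eta> N L \<tau> i))"
proof -
  let ?X = "exceptional \<eta> N L \<tau>"
  let ?E = "\<lambda>i. {\<omega> \<in> space S. \<omega> \<in> ?X i \<and> (\<lambda>n. \<omega> (d + n)) \<in> ?X i}"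
  have shift [measurable]: "(\<lambda>\<omega> n. \<omega> (d + n)) \<in> S \<rightarrow>\<^sub>M S"
    by (rule measurable_PiM_single') (auto simp: space_PiM)
  have Em: "?E i \<in> sets S" if "i < N" for i
  proof -
    note [measurable] = sets_exceptional[OF that, of \<eta> L \<tau>]
    show ?thesis by measurable
  qed
  thus "E \<in> sets S" unfolding E_def by (intro sets.finite_UN) auto
  have ind: "P.prob (?E i) = P.prob (?X i) * P.prob (?X i)" if i: "i < N" for i
  proof -
    have Xm [measurable]: "?X i \<in> sets S" by (rule sets_exceptional[OF i])
    have Wc: "W n a (comb_seq d \<omega> \<omega>') = W n a \<omega>" if "n \<le> L" for n a \<omega> \<omega>'
      unfolding W_def using that d by (intro mprod_cong) (simp add: comb_seq_less)
    have a: "comb_seq d \<omega> \<omega>' \<in> ?X i \<longleftrightarrow> \<omega> \<in> ?X i" if "\<omega> \<in> space S" "\<omega>' \<in> space S" for \<omega> \<omega>'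
    proof -
      have "comb_seq d \<omega> \<omega>' \<in> space S"
        using that by (auto simp: space_PiM comb_seq_def PiE_iff)
      thus ?thesis using that Wc unfolding exceptional_def turned_def by auto
    qed
    have "emeasure S (?E i) = (\<integral>\<^sup>+\<omega>. indicator (?E i) \<omega> \<partial>S)" using Em[OF i] by simp
    also have "\<dots> = (\<integral>\<^sup>+\<omega>. \<integral>\<^sup>+\<omega>'. indicator (?E i) (comb_seq d \<omega> \<omega>') \<partial>S \<partial>S)"
      using ab Em[OF i] by (intro nn_integral_comb_seq[of \<alpha>]) auto
    also have "\<dots> = (\<integral>\<^sup>+\<omega>. \<integral>\<^sup>+\<omega>'. indicator (?X i) \<omega> * indicator (?X i) \<omega>' \<partial>S \<partial>S)"
    proof (intro nn_integral_cong)
      fix \<omega> \<omega>' assume w: "\<omega> \<in> space S" "\<omega>' \<in> space S"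
      have "comb_seq d \<omega> \<omega>' \<in> space S" using w by (auto simp: space_PiM comb_seq_def PiE_iff)
      moreover have "(\<lambda>n. comb_seq d \<omega> \<omega>' (d + n)) = \<omega>'" by (simp add: comb_seq_def)
      ultimately show "(indicator (?E i) (comb_seq d \<omega> \<omega>') :: ennreal) = indicator (?X i) \<omega> * indicator (?X i) \<omega>'"
        using a[OF w] by (auto simp: indicator_def)
    qed
    also have "\<dots> = emeasure S (?X i) * emeasure S (?X i)"
      by (simp add: nn_integral_cmult nn_integral_multc)
    finally show ?thesis by (simp add: P.emeasure_eq_measure ennreal_mult[symmetric])
  qed
  have "P.prob E \<le> (\<Sum>i<N. P.prob (?E i))"
    unfolding E_def using Em by (intro P.finite_measure_subadditive_finite) auto
  also have "\<dots> = (\<Sum>i<N. P.prob (?X i) * P.prob (?X i))" using ind by simp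
  also have "\<dots> \<le> (\<Sum>i<N. q * P.prob (?X i))" by (intro sum_mono mult_right_mono q) auto
  also have "\<dots> = q * (\<Sum>i<N. P.prob (?X i))" by (simp add: sum_distrib_left)
  finally show "P.prob E \<le> q * (\<Sum>i<N. P.prob (?X i))" .
qed

text \<open>The cells have width of order \<open>exp (- s * \<delta> * p)\<close>. On the one hand, an orbit is too short at a given
  parameter with probability of order \<open>exp (- 2 * s * \<delta> * p)\<close>, so few of the exponentially many left end
  points are affected. On the other hand, turning within such a cell requires the orbit to fall
  far behind its typical growth and is exponentially unlikely.\<close>

lemma common_slow_parameter:
  assumes s: "0 < s" "s \<le> 1" and K: "1 \<le> K" and \<delta>: "0 < \<delta>" "\<delta> \<le> g"
    and mom: "\<And>a w n. a \<in> {\<alpha>..\<beta>} \<Longrightarrow> norm w = 1 \<Longrightarrow>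
      (\<integral>\<^sup>+\<omega>. ennreal (norm (W n a \<omega> *v w) powr - s) \<partial>S) \<le> ennreal (K * exp (- s * g * real n))"
  shows "\<exists>c>0. \<exists>D>0. \<forall>p d. 1 \<le> p \<longrightarrow> 2 * p \<le> d \<longrightarrow> (\<exists>E\<in>sets S.
    P.prob E \<le> D * real (2 * p + 1) ^ 5 * exp (- c * real p) \<and>
    (\<forall>\<omega>\<in>space S - E. \<forall>a\<in>{\<alpha>..\<beta>}. exp ((g - 2 * \<delta>) * real (2 * p)) \<le> norm (W (2 * p) a \<omega> *v e) \<or>
       exp ((g - 2 * \<delta>) * real (2 * p)) \<le> norm (W (2 * p) a (\<lambda>n. \<omega> (d + n)) *v e)))"
proof -
  \<comment> \<open>so that \<open>C\<^sup>2 * (h + \<eta>) \<le> \<delta>\<close> as soon as \<open>h \<le> \<eta>\<close>: comparing parameters of a cell costs at most \<open>\<delta>\<close> in the rate\<close>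
  define \<eta> where "\<eta> = \<delta> / (2 * C\<^sup>2)"
  have C2: "C\<^sup>2 > 0" using C1 by simp
  have \<eta>: "\<eta> > 0" using \<delta> C2 by (simp add: \<eta>_def)
  \<comment> \<open>makes the width of the cells at most \<open>\<eta> * exp (- s * \<delta> * p)\<close>\<close>
  define N0 where "N0 = 1 + (\<beta> - \<alpha>) / \<eta>"
  have N0: "N0 \<ge> 1" using ab \<eta> by (simp add: N0_def)
  define D1 where "D1 = (\<Theta> + 2 * pi) / \<eta> + (N0 + 1) * K"
  have rot: "0 \<le> (\<Theta> + 2 * pi) / \<eta>" using \<Theta> \<eta> pi_ge_zero by simp
  have D1: "D1 > 0" using rot N0 K by (simp add: D1_def add_nonneg_pos)
  define c where "c = s * s * \<delta> / 2"
  have c: "c > 0" using s \<delta> by (simp add: c_def)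
  define D where "D = 2 * C * K * D1"
  have D: "D > 0" using C1 K D1 by (simp add: D_def)
  have "\<exists>E\<in>sets S. P.prob E \<le> D * real (2 * p + 1) ^ 5 * exp (- c * real p) \<and>
    (\<forall>\<omega>\<in>space S - E. \<forall>a\<in>{\<alpha>..\<beta>}. exp ((g - 2 * \<delta>) * real (2 * p)) \<le> norm (W (2 * p) a \<omega> *v e) \<or>
       exp ((g - 2 * \<delta>) * real (2 * p)) \<le> norm (W (2 * p) a (\<lambda>n. \<omega> (d + n)) *v e))"
    if p: "1 \<le> p" and d: "2 * p \<le> d" for p d
  proof -
    define L where "L = 2 * p"
    define N where "N = nat \<lceil>N0 * exp (s * \<delta> * real p)\<rceil>"
    define h where "h = (\<beta> - \<alpha>) / real N"
    define \<tau> where "\<tau> = exp ((g - \<delta>) * real L)"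
    have L: "L \<ge> 2" using p by (simp add: L_def)
    have e1: "1 \<le> exp (s * \<delta> * real p)" using s \<delta> by simp
    have "N0 * exp (s * \<delta> * real p) > 0" using N0 by simp
    hence N: "real N \<ge> N0 * exp (s * \<delta> * real p)" "real N \<le> N0 * exp (s * \<delta> * real p) + 1"
      unfolding N_def by linarith+
    have Np: "N > 0" using N(1) \<open>N0 * exp (s * \<delta> * real p) > 0\<close> by (cases N) auto
    have hN: "h \<le> \<eta> * exp (- s * \<delta> * real p)"
    proof -
      have "(\<beta> - \<alpha>) / \<eta> * exp (s * \<delta> * real p) \<le> N0 * exp (s * \<delta> * real p)"
        by (intro mult_right_mono) (auto simp: N0_def)
      hence "(\<beta> - \<alpha>) / \<eta> * exp (s * \<delta> * real p) \<le> real N" using N by simp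
      thus ?thesis unfolding h_def using \<eta> Np by (simp add: exp_minus field_simps)
    qed
    have e2: "exp (- s * \<delta> * real p) \<le> 1" using s \<delta> by simp
    have "\<eta> * exp (- s * \<delta> * real p) \<le> \<eta> * 1" using \<eta> by (intro mult_left_mono e2) auto
    hence "h \<le> \<eta>" using hN by linarith
    hence "C\<^sup>2 * (h + \<eta>) \<le> C\<^sup>2 * (2 * \<eta>)" by (intro mult_left_mono) auto
    also have "\<dots> = \<delta>" using C2 by (simp add: \<eta>_def)
    finally have \<kappa>: "C\<^sup>2 * ((\<beta> - \<alpha>) / real N + \<eta>) \<le> \<delta>" unfolding h_def .
    \<comment> \<open>the smallest bound that \<open>stay_parallel\<close> permits for this width\<close>
    define t where "t m = sqrt (real L) * C * exp (- s * \<delta> * real p / 2) * exp (\<delta> * real m / 2)" for m :: nat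
    have t0: "t m > 0" for m using L C1 by (simp add: t_def)
    have ex2: "(exp (x / 2))\<^sup>2 = exp x" for x :: real by (simp add: power2_eq_square exp_add[symmetric])
    have t2: "real L * C\<^sup>2 * ((\<beta> - \<alpha>) / real N) / \<eta> * exp (\<delta> * real m) \<le> (t m)\<^sup>2" for m
    proof -
      have "(t m)\<^sup>2 = real L * C\<^sup>2 * exp (- s * \<delta> * real p) * exp (\<delta> * real m)"
        unfolding t_def power_mult_distrib ex2 by simp
      moreover have "h / \<eta> \<le> exp (- s * \<delta> * real p)" using hN \<eta> by (simp add: field_simps)
      hence "real L * C\<^sup>2 * (h / \<eta>) * exp (\<delta> * real m) \<le> real L * C\<^sup>2 * exp (- s * \<delta> * real p) * exp (\<delta> * real m)"
        by (intro mult_right_mono mult_left_mono) auto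
      ultimately show ?thesis by (simp add: h_def)
    qed
    define q1 where "q1 = real L * C * K * exp (- c * real p)"
    have q1: "q1 \<ge> 0" using C1 K by (simp add: q1_def)
    have tp: "t m powr s * (K * exp (- s * g * real m)) \<le> q1" for m
    proof -
      have x1: "1 \<le> sqrt (real L) * C" using L C1 mult_mono[of 1 "sqrt (real L)" 1 C] by simp
      have "sqrt (real L) \<le> real L"
        by (rule real_le_lsqrt) (use L in \<open>auto simp: power2_eq_square\<close>)
      hence x2: "sqrt (real L) * C \<le> real L * C" using C1 by (intro mult_right_mono) auto
      have "t m powr s = (sqrt (real L) * C) powr s * exp (s * (- s * \<delta> * real p / 2)) * exp (s * (\<delta> * real m / 2))"
        unfolding t_def using x1 by (simp add: powr_mult exp_powr_real mult.commute)
      also have "(sqrt (real L) * C) powr s \<le> (sqrt (real L) * C) powr 1"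
        using s x1 by (intro powr_mono) auto
      also have "(sqrt (real L) * C) powr 1 \<le> real L * C" using x1 x2 by simp
      finally have "t m powr s \<le> real L * C * exp (s * (- s * \<delta> * real p / 2)) * exp (s * (\<delta> * real m / 2))" by simp
      hence "t m powr s * (K * exp (- s * g * real m)) \<le>
          (real L * C * exp (s * (- s * \<delta> * real p / 2)) * exp (s * (\<delta> * real m / 2))) * (K * exp (- s * g * real m))"
        using K by (intro mult_right_mono) auto
      also have "\<dots> = real L * C * K * exp (- c * real p) * exp (s * (\<delta> * real m / 2) + - s * g * real m)"
        unfolding exp_add c_def by simp
      also have "\<dots> \<le> q1 * 1" unfolding q1_def
      proof (rule mult_left_mono)
        have "s * real m * (\<delta> / 2) \<le> s * real m * g" using s \<delta> by (intro mult_left_mono) auto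
        thus "exp (s * (\<delta> * real m / 2) + - s * g * real m) \<le> 1" by (simp add: algebra_simps)
      qed (use C1 K in auto)
      finally show ?thesis by simp
    qed
    have ci: "cell N i \<in> {\<alpha>..\<beta>}" if "i < N" for i using cell_in[of i N] that by simp
    have K0: "0 \<le> K * exp (- s * g * real n)" for n using K by simp
    have turned: "P.prob (\<Union>n\<le>L. turned \<eta> N i n) \<le> real ((L + 1) ^ 2) * q1" if i: "i < N" for i
    proof (rule prob_turned_le[where t = t and \<kappa> = \<delta>, OF \<eta> \<kappa> i less_imp_le[OF t0] t2 _ q1])
      fix k m
      show "P.prob {\<omega> \<in> space S. norm (W (k + m) (cell N i) \<omega> *v e) < t m * norm (W k (cell N i) \<omega> *v e)} \<le> q1"
        by (rule order_trans[OF prob_small_growth[OF ci[OF i] s(1) K0 mom[OF ci[OF i]] t0 e_nz] tp])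
    qed
    have short: "P.prob {\<omega> \<in> space S. norm (W L (cell N i) \<omega> *v e) < \<tau>} \<le> K * exp (- 2 * s * \<delta> * real p)" if i: "i < N" for i
    proof -
      have "P.prob {\<omega> \<in> space S. norm (W (0 + L) (cell N i) \<omega> *v e) < \<tau> * norm (W 0 (cell N i) \<omega> *v e)}
          \<le> \<tau> powr s * (K * exp (- s * g * real L))"
        by (rule prob_small_growth[OF ci[OF i] s(1) K0 mom[OF ci[OF i]] _ e_nz]) (simp_all add: \<tau>_def)
      also have "\<dots> = K * exp (s * ((g - \<delta>) * real L) + - s * g * real L)"
        unfolding exp_add by (simp add: \<tau>_def exp_powr_real mult.commute)
      also have "s * ((g - \<delta>) * real L) + - s * g * real L = - 2 * s * \<delta> * real p" by (simp add: L_def algebra_simps)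
      finally show ?thesis by simp
    qed
    have cs: "c \<le> 2 * s * \<delta>"
    proof -
      have "s * (s * \<delta>) \<le> 1 * (s * \<delta>)" using s \<delta> by (intro mult_right_mono) auto
      moreover have "0 \<le> s * \<delta>" using s \<delta> by simp
      ultimately show ?thesis unfolding c_def by linarith
    qed
    have exc: "P.prob (exceptional \<eta> N L \<tau> i) \<le> P.prob (\<Union>n\<le>L. turned \<eta> N i n) + K * exp (- 2 * s * \<delta> * real p)" if i: "i < N" for i
    proof -
      have "P.prob (exceptional \<eta> N L \<tau> i) \<le> P.prob (\<Union>n\<le>L. turned \<eta> N i n)
          + P.prob {\<omega> \<in> space S. norm (W L (cell N i) \<omega> *v e) < \<tau>}"
        unfolding exceptional_def
        by (intro measure_Un_le sets.finite_UN sets_turned sets_short i) auto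
      thus ?thesis using short[OF i] by simp
    qed
    define q where "q = 2 * real (L + 1) ^ 3 * C * K * exp (- c * real p)"
    have q: "P.prob (exceptional \<eta> N L \<tau> i) \<le> q" if i: "i < N" for i
    proof -
      have "K * exp (- 2 * s * \<delta> * real p) \<le> K * exp (- c * real p)"
        using K cs by (intro mult_left_mono) (auto intro: mult_right_mono)
      also have "\<dots> \<le> (real (L + 1) ^ 3 * C) * (K * exp (- c * real p))"
      proof -
        have "1 * 1 \<le> real (L + 1) ^ 3 * C" using C1 by (intro mult_mono one_le_power) auto
        thus ?thesis using K mult_right_mono[of 1 "real (L + 1) ^ 3 * C" "K * exp (- c * real p)"] by simp
      qed
      finally have 1: "K * exp (- 2 * s * \<delta> * real p) \<le> real (L + 1) ^ 3 * C * K * exp (- c * real p)" by (simp add: mult.assoc)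
      have "real ((L + 1) ^ 2) * q1 = (real (L + 1) ^ 2 * real L) * (C * K * exp (- c * real p))"
        by (simp add: q1_def)
      also have "\<dots> \<le> (real (L + 1) ^ 2 * real (L + 1)) * (C * K * exp (- c * real p))"
        using C1 K by (intro mult_right_mono mult_left_mono) auto
      also have "\<dots> = real (L + 1) ^ 3 * C * K * exp (- c * real p)" by (simp add: power3_eq_cube power2_eq_square)
      finally show ?thesis using exc[OF i] turned[OF i] 1 unfolding q_def by linarith
    qed
    have sum: "(\<Sum>i<N. P.prob (exceptional \<eta> N L \<tau> i)) \<le> real (L + 1) ^ 2 * D1"
    proof -
      have "(\<Sum>i<N. P.prob (exceptional \<eta> N L \<tau> i))
          \<le> (\<Sum>i<N. (\<Sum>n\<le>L. P.prob (turned \<eta> N i n)) + K * exp (- 2 * s * \<delta> * real p))"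
      proof (rule sum_mono)
        fix i assume "i \<in> {..<N}"
        hence i: "i < N" by simp
        have "P.prob (\<Union>n\<le>L. turned \<eta> N i n) \<le> (\<Sum>n\<le>L. P.prob (turned \<eta> N i n))"
          by (intro P.finite_measure_subadditive_finite) (auto intro: sets_turned i)
        thus "P.prob (exceptional \<eta> N L \<tau> i) \<le> (\<Sum>n\<le>L. P.prob (turned \<eta> N i n)) + K * exp (- 2 * s * \<delta> * real p)"
          using exc[OF i] by simp
      qed
      also have "\<dots> = (\<Sum>n\<le>L. \<Sum>i<N. P.prob (turned \<eta> N i n)) + real N * (K * exp (- 2 * s * \<delta> * real p))"
        by (simp add: sum.distrib sum.swap[of _ "{..L}"])
      also have "(\<Sum>n\<le>L. \<Sum>i<N. P.prob (turned \<eta> N i n)) \<le> (\<Sum>n\<le>L. real (L + 1) * ((\<Theta> + 2 * pi) / \<eta>))"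
      proof (rule sum_mono)
        fix n assume "n \<in> {..L}"
        hence "real n * ((\<Theta> + 2 * pi) / \<eta>) \<le> real (L + 1) * ((\<Theta> + 2 * pi) / \<eta>)"
          using rot by (intro mult_right_mono) auto
        thus "(\<Sum>i<N. P.prob (turned \<eta> N i n)) \<le> real (L + 1) * ((\<Theta> + 2 * pi) / \<eta>)"
          using sum_prob_turned[OF \<eta> Np, of n] by simp
      qed
      also have "\<dots> = real (L + 1) ^ 2 * ((\<Theta> + 2 * pi) / \<eta>)" by (simp add: power2_eq_square)
      also have "real N * (K * exp (- 2 * s * \<delta> * real p)) \<le> real (L + 1) ^ 2 * ((N0 + 1) * K)"
      proof -
        have "real N \<le> (N0 + 1) * exp (s * \<delta> * real p)" using N(2) e1 unfolding distrib_right by linarith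
        hence "real N * (K * exp (- 2 * s * \<delta> * real p))
            \<le> ((N0 + 1) * exp (s * \<delta> * real p)) * (K * exp (- 2 * s * \<delta> * real p))"
          using K by (intro mult_right_mono) auto
        also have "\<dots> = (N0 + 1) * K * exp (s * \<delta> * real p + - 2 * s * \<delta> * real p)"
          unfolding exp_add by simp
        also have "s * \<delta> * real p + - 2 * s * \<delta> * real p = - s * \<delta> * real p" by simp
        also have "(N0 + 1) * K * exp (- s * \<delta> * real p) \<le> (N0 + 1) * K * 1"
          using N0 K by (intro mult_left_mono e2) auto
        also have "\<dots> \<le> real (L + 1) ^ 2 * ((N0 + 1) * K)"
        proof -
          have "1 \<le> real (L + 1) ^ 2" by (intro one_le_power) auto
          thus ?thesis using N0 K mult_right_mono[of 1 "real (L + 1) ^ 2" "(N0 + 1) * K"] by simp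
        qed
        finally show ?thesis .
      qed
      finally show ?thesis by (simp add: D1_def distrib_left)
    qed
    define E where "E = (\<Union>i<N. {\<omega> \<in> space S. \<omega> \<in> exceptional \<eta> N L \<tau> i \<and> (\<lambda>n. \<omega> (d + n)) \<in> exceptional \<eta> N L \<tau> i})"
    have Ld: "L \<le> d" using d by (simp add: L_def)
    have Es: "E \<in> sets S" unfolding E_def by (rule prob_common_exceptional(1)[OF Ld Np q])
    have "P.prob E \<le> q * (\<Sum>i<N. P.prob (exceptional \<eta> N L \<tau> i))"
      unfolding E_def by (rule prob_common_exceptional(2)[OF Ld Np q])
    also have "\<dots> \<le> q * (real (L + 1) ^ 2 * D1)"
      using C1 K by (intro mult_left_mono sum) (simp add: q_def)
    also have "\<dots> = D * real (L + 1) ^ 5 * exp (- c * real p)"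
    proof -
      have "real (L + 1) ^ 5 = real (L + 1) ^ 3 * real (L + 1) ^ 2" by (simp add: power_add[symmetric])
      thus ?thesis by (simp add: q_def D_def)
    qed
    finally have PE: "P.prob E \<le> D * real (2 * p + 1) ^ 5 * exp (- c * real p)" unfolding L_def .
    have growth: "exp ((g - 2 * \<delta>) * real (2 * p)) \<le> norm (W (2 * p) a \<omega> *v e)"
      if "\<omega> \<in> space S" "\<omega> \<notin> exceptional \<eta> N L \<tau> i" "i < N" "a \<in> {cell N i..cell N (Suc i)}" for \<omega> i a
    proof -
      have "exp (- \<delta> * real L) * \<tau> \<le> norm (W L a \<omega> *v e)"
        by (rule growth_if_not_exceptional[OF that \<eta> \<kappa>])
      moreover have "exp (- \<delta> * real L) * \<tau> = exp ((g - 2 * \<delta>) * real (2 * p))"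
        unfolding \<tau>_def exp_add[symmetric] L_def by (simp add: algebra_simps)
      ultimately show ?thesis by (simp add: L_def)
    qed
    show ?thesis
    proof (intro bexI[OF _ Es] conjI PE ballI)
      fix \<omega> a assume \<omega>: "\<omega> \<in> space S - E" and a: "a \<in> {\<alpha>..\<beta>}"
      obtain i where i: "i < N" "a \<in> {cell N i..cell N (Suc i)}" using cells_cover[OF Np a] by blast
      have sh: "(\<lambda>n. \<omega> (d + n)) \<in> space S" using \<omega> by (auto simp: space_PiM)
      have "\<omega> \<notin> exceptional \<eta> N L \<tau> i \<or> (\<lambda>n. \<omega> (d + n)) \<notin> exceptional \<eta> N L \<tau> i"
        using \<omega> i by (auto simp: E_def)
      thus "exp ((g - 2 * \<delta>) * real (2 * p)) \<le> norm (W (2 * p) a \<omega> *v e) \<or>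
         exp ((g - 2 * \<delta>) * real (2 * p)) \<le> norm (W (2 * p) a (\<lambda>n. \<omega> (d + n)) *v e)"
        using growth[OF _ _ i] \<omega> sh by blast
    qed
  qed
  thus ?thesis using c D by blast
qed

end

section \<open>Almost sure behaviour of all parameters at once\<close>

lemma summable_poly_exp: "c > 0 \<Longrightarrow> summable (\<lambda>p. D * real (2 * p + 1) ^ 5 * exp (- c * real p))"
proof (rule summable_comparison_test_ev)
  assume c: "c > 0"
  have "(\<lambda>p::nat. D * real (2 * p + 1) ^ 5 * exp (- (c / 2) * real p)) \<longlonglongrightarrow> 0"
    using c by real_asymp
  hence "eventually (\<lambda>p::nat. \<bar>D * real (2 * p + 1) ^ 5 * exp (- (c / 2) * real p)\<bar> < 1) sequentially"
    by (auto dest: tendstoD[where e = 1] simp: dist_real_def)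
  thus "eventually (\<lambda>p. norm (D * real (2 * p + 1) ^ 5 * exp (- c * real p)) \<le> exp (- (c / 2)) ^ p) sequentially"
  proof eventually_elim
    case (elim p)
    have "exp (- c * real p) = exp (- (c / 2) * real p) * exp (- (c / 2) * real p)"
      by (simp add: exp_add[symmetric])
    hence "norm (D * real (2 * p + 1) ^ 5 * exp (- c * real p))
       = \<bar>D * real (2 * p + 1) ^ 5 * exp (- (c / 2) * real p)\<bar> * exp (- (c / 2) * real p)"
      by (simp add: abs_mult)
    also have "\<dots> \<le> 1 * exp (- (c / 2) * real p)" using elim by (intro mult_right_mono) auto
    also have "\<dots> = exp (- (c / 2)) ^ p" by (simp add: exp_of_nat_mult[symmetric] mult.commute)
    finally show ?case .
  qed
  show "summable (\<lambda>p. exp (- (c / 2)) ^ p)" using c by (intro summable_geometric) simp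
qed

text \<open>The Borel--Cantelli lemma for properties \<open>Q p\<close> that are not known to be measurable: statements about all
  parameters at once are uncountable intersections.\<close>

lemma (in prob_space) AE_eventually_if_summable:
  assumes E: "\<And>p. \<exists>E\<in>events. prob E \<le> b p \<and> (\<forall>\<omega>\<in>space M - E. Q p \<omega>)" and b: "summable b"
  shows "AE \<omega> in M. eventually (\<lambda>p. Q p \<omega>) sequentially"
proof -
  from E obtain E where E: "\<And>p. E p \<in> events" "\<And>p. prob (E p) \<le> b p" "\<And>p \<omega>. \<omega> \<in> space M - E p \<Longrightarrow> Q p \<omega>"
    by metis
  have "summable (\<lambda>p. prob (E p))" by (rule summable_comparison_test'[OF b]) (use E in auto)
  hence "AE \<omega> in M. eventually (\<lambda>p. \<omega> \<in> space M - E p) sequentially"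
    by (intro borel_cantelli_AE1 E) (auto simp: emeasure_eq_measure)
  thus ?thesis by eventually_elim (auto elim!: eventually_mono intro: E)
qed

text \<open>Negative moments are controlled uniformly only near a parameter, so the rotation argument is applied on
  small subintervals; this is why \<open>total\<close> speaks of all of them.\<close>

locale furstenberg_family = matrix_family M F "{\<alpha>..\<beta>}" C for M :: "'w measure" and F \<alpha> \<beta> C +
  fixes D :: "'w \<Rightarrow> real \<Rightarrow> real^2^2" and \<Theta> :: real and lam :: "real \<Rightarrow> real"
  assumes ab: "\<alpha> < \<beta>"
    and deriv: "\<And>x a. x \<in> space M \<Longrightarrow> a \<in> {\<alpha>..\<beta>} \<Longrightarrow> (F x has_vector_derivative D x a) (at a within {\<alpha>..\<beta>})"
    and pos: "\<And>x a v. x \<in> space M \<Longrightarrow> a \<in> {\<alpha>..\<beta>} \<Longrightarrow> v \<noteq> 0 \<Longrightarrow> cr (F x a *v v) (D x a *v v) > 0"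
    and total: "\<And>x \<alpha>' \<beta>'. x \<in> space M \<Longrightarrow> \<alpha> \<le> \<alpha>' \<Longrightarrow> \<alpha>' < \<beta>' \<Longrightarrow> \<beta>' \<le> \<beta> \<Longrightarrow>
        \<exists>\<theta>. continuous_on {\<alpha>'..\<beta>'} \<theta> \<and>
          (\<forall>a\<in>{\<alpha>'..\<beta>'}. F x a *v dir 0 = norm (F x a *v dir 0) *\<^sub>R dir (\<theta> a)) \<and> \<theta> \<beta>' - \<theta> \<alpha>' \<le> \<Theta>"
    and \<Theta>: "0 \<le> \<Theta>"
    and irreducible: "\<And>a. a \<in> {\<alpha>..\<beta>} \<Longrightarrow> sl2_walk.line_irreducible M (\<lambda>x. F x a)"
    and exponent: "\<And>a. a \<in> {\<alpha>..\<beta>} \<Longrightarrow> AE \<omega> in S. (\<lambda>n. ln (op_norm (W n a \<omega>)) / real n) \<longlonglongrightarrow> lam a"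
    and lam_pos: "\<And>a. a \<in> {\<alpha>..\<beta>} \<Longrightarrow> lam a > 0"
begin

lemma growth_lim:
  assumes "a \<in> {\<alpha>..\<beta>}" "norm v = 1"
  shows "(\<lambda>n. (\<integral>\<omega>. ln (norm (W n a \<omega> *v v)) \<partial>S) / real n) \<longlonglongrightarrow> lam a"
  using expected_growth[OF assms(1) irreducible[OF assms(1)] exponent[OF assms(1)] lam_pos[OF assms(1)] assms(2)] .

lemma norm_growth_lim:
  assumes "a \<in> {\<alpha>..\<beta>}"
  shows "(\<lambda>n. (\<integral>\<omega>. ln (op_norm (W n a \<omega>)) \<partial>S) / real n) \<longlonglongrightarrow> lam a"
  using expected_op_norm_growth[OF assms exponent[OF assms]] .

lemma lam_ge:
  assumes a: "a \<in> {\<alpha>..\<beta>}" and ev: "AE \<omega> in S. eventually (\<lambda>p. exp (g * real p) \<le> op_norm (W p a \<omega>)) sequentially"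
  shows "g \<le> lam a"
proof -
  have "AE \<omega> in S. g \<le> lam a"
    using ev exponent[OF a]
  proof eventually_elim
    case (elim \<omega>)
    have "eventually (\<lambda>p. g \<le> ln (op_norm (W p a \<omega>)) / real p) sequentially"
      using elim(1) eventually_gt_at_top[of 0]
    proof eventually_elim
      case (elim p)
      have "0 < op_norm (W p a \<omega>)" using elim(1) exp_gt_zero less_le_trans by blast
      hence "g * real p \<le> ln (op_norm (W p a \<omega>))" using elim(1) by (simp add: ln_ge_iff)
      thus ?case using elim(2) by (simp add: field_simps)
    qed
    thus ?case by (intro tendsto_lowerbound[OF elim(2)]) auto
  qed
  thus ?thesis by (simp add: P.AE_const)
qed

lemma lam_le:
  assumes a: "a \<in> {\<alpha>..\<beta>}" and ev: "AE \<omega> in S. eventually (\<lambda>p. op_norm (W p a \<omega>) \<le> exp (g * real p)) sequentially"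
  shows "lam a \<le> g"
proof -
  have "AE \<omega> in S. \<omega> \<in> space S" by (rule AE_space)
  hence "AE \<omega> in S. lam a \<le> g"
    using ev exponent[OF a]
  proof eventually_elim
    case (elim \<omega>)
    have "eventually (\<lambda>p. ln (op_norm (W p a \<omega>)) / real p \<le> g) sequentially"
      using elim(2) eventually_gt_at_top[of 0]
    proof eventually_elim
      case (elim p)
      have "1 \<le> op_norm (W p a \<omega>)" using \<open>\<omega> \<in> space S\<close> a by (intro op_norm_ge_1 W_det)
      hence "ln (op_norm (W p a \<omega>)) \<le> ln (exp (g * real p))" using elim(1) by (intro ln_mono) auto
      thus ?case using elim(2) by (simp add: field_simps)
    qed
    thus ?case by (intro tendsto_upperbound[OF elim(3)]) auto
  qed
  thus ?thesis by (simp add: P.AE_const)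
qed

text \<open>All estimates of the preceding sections near one parameter \<open>a0\<close>, with common constants. Since the growth of
  nearby parameters obeys the bounds for \<open>a0\<close>, their exponents are close to that of \<open>a0\<close>.\<close>

lemma local_estimates:
  assumes a0: "a0 \<in> {\<alpha>..\<beta>}" and \<epsilon>: "0 < \<epsilon>"
  shows "\<exists>r>0. \<exists>c>0. \<exists>K>0.
    (\<forall>a\<in>{\<alpha>..\<beta>}. \<bar>a - a0\<bar> < r \<longrightarrow> \<bar>lam a - lam a0\<bar> \<le> \<epsilon>) \<and>
    (\<forall>p. \<exists>E\<in>sets S. P.prob E \<le> K * real (2 * p + 1) ^ 5 * exp (- c * real p) \<and>
      (\<forall>\<omega>\<in>space S - E. \<forall>a\<in>{\<alpha>..\<beta>}. \<bar>a - a0\<bar> < r \<longrightarrow> op_norm (W p a \<omega>) \<le> exp ((lam a0 + \<epsilon>) * real p))) \<and>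
    (\<forall>p d. 1 \<le> p \<longrightarrow> 2 * p \<le> d \<longrightarrow> (\<exists>E\<in>sets S. P.prob E \<le> K * real (2 * p + 1) ^ 5 * exp (- c * real p) \<and>
      (\<forall>\<omega>\<in>space S - E. \<forall>a\<in>{\<alpha>..\<beta>}. \<bar>a - a0\<bar> < r \<longrightarrow>
         exp ((lam a0 - \<epsilon>) * real (2 * p)) \<le> norm (W (2 * p) a \<omega> *v dir 0) \<or>
         exp ((lam a0 - \<epsilon>) * real (2 * p)) \<le> norm (W (2 * p) a (\<lambda>n. \<omega> (d + n)) *v dir 0))))"
proof -
  let ?l = "lam a0"
  define \<delta> where "\<delta> = min (\<epsilon> / 3) (?l / 2)"
  have \<delta>: "\<delta> > 0" "3 * \<delta> \<le> \<epsilon>" "\<delta> \<le> ?l - \<delta>" using \<epsilon> lam_pos[OF a0] by (auto simp: \<delta>_def)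
  obtain r1 s K1 where r1: "r1 > 0" and s: "s > 0" "s \<le> 1" and K1: "K1 > 0"
    and mom: "\<And>a w n. a \<in> {\<alpha>..\<beta>} \<Longrightarrow> \<bar>a - a0\<bar> < r1 \<Longrightarrow> norm w = 1 \<Longrightarrow>
      (\<integral>\<^sup>+\<omega>. ennreal (norm (W n a \<omega> *v w) powr - s) \<partial>S) \<le> ennreal (K1 * exp (- s * (?l - \<delta>) * real n))"
    using uniform_negative_moment[OF a0 growth_lim[OF a0] \<delta>(1)] by blast
  obtain r2 c2 K2 where r2: "r2 > 0" and c2: "c2 > 0" and K2: "K2 > 0"
    and up: "\<And>p. \<exists>E\<in>sets S. P.prob E \<le> K2 * exp (- c2 * real p) \<and>
      (\<forall>\<omega>\<in>space S - E. \<forall>a\<in>{\<alpha>..\<beta>}. \<bar>a - a0\<bar> < r2 \<longrightarrow> op_norm (W p a \<omega>) \<le> exp ((?l + \<epsilon>) * real p))"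
    using uniform_upper_bound[OF a0 norm_growth_lim[OF a0] less_imp_le[OF lam_pos[OF a0]] \<epsilon>] by blast
  define r where "r = min r1 r2 / 2"
  have r: "r > 0" using r1 r2 by (simp add: r_def)
  define \<alpha>' where "\<alpha>' = max \<alpha> (a0 - r)"
  define \<beta>' where "\<beta>' = min \<beta> (a0 + r)"
  have ab': "\<alpha>' < \<beta>'" "\<alpha> \<le> \<alpha>'" "\<beta>' \<le> \<beta>" using a0 ab r by (auto simp: \<alpha>'_def \<beta>'_def)
  have sub: "{\<alpha>'..\<beta>'} \<subseteq> {\<alpha>..\<beta>}" using ab' by auto
  have close: "\<bar>a - a0\<bar> < r1" if "a \<in> {\<alpha>'..\<beta>'}" for a
    using that r1 r2 by (auto simp: \<alpha>'_def \<beta>'_def r_def)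
  have mem: "a \<in> {\<alpha>'..\<beta>'}" if "a \<in> {\<alpha>..\<beta>}" "\<bar>a - a0\<bar> < r" for a
    using that by (auto simp: \<alpha>'_def \<beta>'_def)
  interpret R: rotating_family W M F \<alpha>' \<beta>' C D \<Theta>
  proof unfold_locales
    show "(F x has_vector_derivative D x a) (at a within {\<alpha>'..\<beta>'})" if "x \<in> space M" "a \<in> {\<alpha>'..\<beta>'}" for x a
      using deriv[OF that(1)] that(2) sub by (blast intro: has_vector_derivative_within_subset)
  qed (use F_meas F_det F_bd F_lip C1 sub ab' pos total \<Theta> in \<open>auto simp: subset_iff\<close>)
  have "\<exists>c>0. \<exists>D>0. \<forall>p d. 1 \<le> p \<longrightarrow> 2 * p \<le> d \<longrightarrow> (\<exists>E\<in>sets S.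
    P.prob E \<le> D * real (2 * p + 1) ^ 5 * exp (- c * real p) \<and>
    (\<forall>\<omega>\<in>space S - E. \<forall>a\<in>{\<alpha>'..\<beta>'}. exp ((?l - \<delta> - 2 * \<delta>) * real (2 * p)) \<le> norm (W (2 * p) a \<omega> *v dir 0) \<or>
       exp ((?l - \<delta> - 2 * \<delta>) * real (2 * p)) \<le> norm (W (2 * p) a (\<lambda>n. \<omega> (d + n)) *v dir 0)))"
  proof (rule R.common_slow_parameter[OF s _ \<delta>(1,3)])
    show "1 \<le> max 1 K1" by simp
    show "(\<integral>\<^sup>+\<omega>. ennreal (norm (W n a \<omega> *v w) powr - s) \<partial>S) \<le> ennreal (max 1 K1 * exp (- s * (?l - \<delta>) * real n))"
      if "a \<in> {\<alpha>'..\<beta>'}" "norm w = 1" for a w n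
    proof -
      have "(\<integral>\<^sup>+\<omega>. ennreal (norm (W n a \<omega> *v w) powr - s) \<partial>S) \<le> ennreal (K1 * exp (- s * (?l - \<delta>) * real n))"
        using that sub close by (intro mom) auto
      also have "\<dots> \<le> ennreal (max 1 K1 * exp (- s * (?l - \<delta>) * real n))"
        by (intro ennreal_leI mult_right_mono) auto
      finally show ?thesis .
    qed
  qed
  then obtain c3 K3 where c3: "c3 > 0" and K3: "K3 > 0"
    and common: "\<And>p d. 1 \<le> p \<Longrightarrow> 2 * p \<le> d \<Longrightarrow> \<exists>E\<in>sets S.
      P.prob E \<le> K3 * real (2 * p + 1) ^ 5 * exp (- c3 * real p) \<and>
      (\<forall>\<omega>\<in>space S - E. \<forall>a\<in>{\<alpha>'..\<beta>'}. exp ((?l - \<delta> - 2 * \<delta>) * real (2 * p)) \<le> norm (W (2 * p) a \<omega> *v dir 0) \<or>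
       exp ((?l - \<delta> - 2 * \<delta>) * real (2 * p)) \<le> norm (W (2 * p) a (\<lambda>n. \<omega> (d + n)) *v dir 0))"
    by blast
  define c where "c = min c2 c3"
  define K where "K = max K2 K3"
  have cK: "c > 0" "K > 0" using c2 c3 K2 by (auto simp: c_def K_def)
  have b2: "K2 * exp (- c2 * real p) \<le> K * real (2 * p + 1) ^ 5 * exp (- c * real p)" for p
  proof -
    have "1 \<le> real (2 * p + 1) ^ 5" by (intro one_le_power) simp
    hence "K2 * 1 \<le> K * real (2 * p + 1) ^ 5" using K2 by (intro mult_mono) (auto simp: K_def)
    moreover have "exp (- c2 * real p) \<le> exp (- c * real p)" by (auto simp: c_def intro: mult_right_mono)
    ultimately show ?thesis using K2 cK by (intro mult_mono) auto
  qed
  have b3: "K3 * real (2 * p + 1) ^ 5 * exp (- c3 * real p) \<le> K * real (2 * p + 1) ^ 5 * exp (- c * real p)" for p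
  proof -
    have "exp (- c3 * real p) \<le> exp (- c * real p)" by (auto simp: c_def intro: mult_right_mono)
    thus ?thesis using K3 by (intro mult_mono mult_right_mono) (auto simp: K_def)
  qed
  have upper: "\<exists>E\<in>sets S. P.prob E \<le> K * real (2 * p + 1) ^ 5 * exp (- c * real p) \<and>
      (\<forall>\<omega>\<in>space S - E. \<forall>a\<in>{\<alpha>..\<beta>}. \<bar>a - a0\<bar> < r \<longrightarrow> op_norm (W p a \<omega>) \<le> exp ((?l + \<epsilon>) * real p))" for p
  proof -
    obtain E where E: "E \<in> sets S" "P.prob E \<le> K2 * exp (- c2 * real p)"
      "\<And>\<omega> a. \<omega> \<in> space S - E \<Longrightarrow> a \<in> {\<alpha>..\<beta>} \<Longrightarrow> \<bar>a - a0\<bar> < r2 \<Longrightarrow> op_norm (W p a \<omega>) \<le> exp ((?l + \<epsilon>) * real p)"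
      using up[of p] by blast
    have "r \<le> r2" using r1 r2 by (auto simp: r_def)
    thus ?thesis using E b2[of p] by (intro bexI[of _ E]) auto
  qed
  have two: "\<exists>E\<in>sets S. P.prob E \<le> K * real (2 * p + 1) ^ 5 * exp (- c * real p) \<and>
      (\<forall>\<omega>\<in>space S - E. \<forall>a\<in>{\<alpha>..\<beta>}. \<bar>a - a0\<bar> < r \<longrightarrow>
         exp ((?l - \<epsilon>) * real (2 * p)) \<le> norm (W (2 * p) a \<omega> *v dir 0) \<or>
         exp ((?l - \<epsilon>) * real (2 * p)) \<le> norm (W (2 * p) a (\<lambda>n. \<omega> (d + n)) *v dir 0))"
    if pd: "1 \<le> p" "2 * p \<le> d" for p d
  proof -
    obtain E where E: "E \<in> sets S" "P.prob E \<le> K3 * real (2 * p + 1) ^ 5 * exp (- c3 * real p)"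
      "\<And>\<omega> a. \<omega> \<in> space S - E \<Longrightarrow> a \<in> {\<alpha>'..\<beta>'} \<Longrightarrow>
        exp ((?l - \<delta> - 2 * \<delta>) * real (2 * p)) \<le> norm (W (2 * p) a \<omega> *v dir 0) \<or>
        exp ((?l - \<delta> - 2 * \<delta>) * real (2 * p)) \<le> norm (W (2 * p) a (\<lambda>n. \<omega> (d + n)) *v dir 0)"
      using common[OF pd] by blast
    have le: "exp ((?l - \<epsilon>) * real (2 * p)) \<le> exp ((?l - \<delta> - 2 * \<delta>) * real (2 * p))"
      using \<delta> by (intro iffD2[OF exp_le_cancel_iff] mult_right_mono) auto
    show ?thesis
    proof (intro bexI[OF _ E(1)] conjI ballI impI)
      show "P.prob E \<le> K * real (2 * p + 1) ^ 5 * exp (- c * real p)" using E(2) b3[of p] by linarith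
      fix \<omega> a assume "\<omega> \<in> space S - E" "a \<in> {\<alpha>..\<beta>}" "\<bar>a - a0\<bar> < r"
      thus "exp ((?l - \<epsilon>) * real (2 * p)) \<le> norm (W (2 * p) a \<omega> *v dir 0) \<or>
         exp ((?l - \<epsilon>) * real (2 * p)) \<le> norm (W (2 * p) a (\<lambda>n. \<omega> (d + n)) *v dir 0)"
        using E(3)[OF _ mem] order_trans[OF le] by blast
    qed
  qed
  have bnd: "\<bar>lam a - ?l\<bar> \<le> \<epsilon>" if a: "a \<in> {\<alpha>..\<beta>}" "\<bar>a - a0\<bar> < r" for a
  proof -
    have "AE \<omega> in S. eventually (\<lambda>p. op_norm (W p a \<omega>) \<le> exp ((?l + \<epsilon>) * real p)) sequentially"
    proof (rule P.AE_eventually_if_summable[OF _ summable_poly_exp[OF cK(1), of K]])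
      show "\<exists>E\<in>sets S. P.prob E \<le> K * real (2 * p + 1) ^ 5 * exp (- c * real p) \<and>
        (\<forall>\<omega>\<in>space S - E. op_norm (W p a \<omega>) \<le> exp ((?l + \<epsilon>) * real p))" for p
        using upper[of p] a by blast
    qed
    hence 1: "lam a \<le> ?l + \<epsilon>" by (rule lam_le[OF a(1)])
    have "AE \<omega> in S. eventually (\<lambda>p. exp ((?l - \<epsilon>) * real p) \<le> op_norm (W p a \<omega>)) sequentially"
    proof (rule P.AE_eventually_if_summable)
      show "summable (\<lambda>p. K1 * exp (- (s * \<delta>)) ^ p)" using s \<delta> by (intro summable_mult summable_geometric) simp
      fix p
      define E where "E = {\<omega> \<in> space S. norm (W (0 + p) a \<omega> *v dir 0) < exp ((?l - 2 * \<delta>) * real p) * norm (W 0 a \<omega> *v dir 0)}"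
      note [measurable] = W_meas[OF a(1)]
      have "E \<in> sets S" unfolding E_def by measurable
      moreover have "P.prob E \<le> K1 * exp (- (s * \<delta>)) ^ p"
      proof -
        have "P.prob E \<le> exp ((?l - 2 * \<delta>) * real p) powr s * (K1 * exp (- s * (?l - \<delta>) * real p))"
          unfolding E_def using K1 mom[OF a(1)] close[OF mem[OF a]] R.e_nz
        by (intro prob_small_growth[OF a(1) s(1)]) auto
        also have "\<dots> = K1 * exp (- (s * \<delta>)) ^ p"
          by (simp add: exp_powr_real exp_of_nat_mult[symmetric] exp_add[symmetric] algebra_simps)
        finally show ?thesis .
      qed
      moreover have "exp ((?l - \<epsilon>) * real p) \<le> op_norm (W p a \<omega>)" if "\<omega> \<in> space S - E" for \<omega>
      proof -
        have "exp ((?l - \<epsilon>) * real p) \<le> exp ((?l - 2 * \<delta>) * real p)"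
          using \<delta> by (intro iffD2[OF exp_le_cancel_iff] mult_right_mono) auto
        also have "\<dots> \<le> norm (W p a \<omega> *v dir 0)" using that by (simp add: E_def not_less)
        also have "\<dots> \<le> op_norm (W p a \<omega>)" using norm_mv_le[of "W p a \<omega>" "dir 0"] by simp
        finally show ?thesis .
      qed
      ultimately show "\<exists>E\<in>sets S. P.prob E \<le> K1 * exp (- (s * \<delta>)) ^ p \<and>
        (\<forall>\<omega>\<in>space S - E. exp ((?l - \<epsilon>) * real p) \<le> op_norm (W p a \<omega>))" by (intro bexI[of _ E]) auto
    qed
    hence "?l - \<epsilon> \<le> lam a" by (rule lam_ge[OF a(1)])
    thus ?thesis using 1 by linarith
  qed
  show ?thesis
    using r cK bnd upper two by blast
qed

text \<open>Time is divided into blocks of length \<open>p\<close>, and \<open>\<xi> i\<close> is the future after time \<open>i\<close>. A block pair that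
  starts at \<open>j * p\<close> is exceptional if \<open>dir 0\<close> does not grow at almost full speed; exceptional pairs overlap.\<close>

definition regular_blocks :: "real \<Rightarrow> int set \<Rightarrow> nat \<Rightarrow> real \<Rightarrow> (int \<Rightarrow> nat \<Rightarrow> 'w) \<Rightarrow> bool" where
  "regular_blocks \<epsilon> Js p a \<xi> \<longleftrightarrow>
    (\<forall>j\<in>Js. op_norm (W p a (\<xi> (j * int p))) \<le> exp ((lam a + \<epsilon>) * real p)) \<and>
    (\<forall>j\<in>Js. \<forall>k\<in>Js. j + 2 \<le> k \<longrightarrow>
      exp ((lam a - \<epsilon>) * real (2 * p)) \<le> norm (W (2 * p) a (\<xi> (j * int p)) *v dir 0) \<or>
      exp ((lam a - \<epsilon>) * real (2 * p)) \<le> norm (W (2 * p) a (\<xi> (k * int p)) *v dir 0))"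

text \<open>The sequences \<open>sh j x\<close> are the shifts of a two-sided or one-sided random sequence \<open>x\<close>, so that both
  parts of the theorem are instances. Borel--Cantelli applies to each of the finitely many blocks and
  pairs of blocks.\<close>

lemma AE_blocks_local:
  fixes N :: "'n measure" and sh :: "int \<Rightarrow> 'n \<Rightarrow> nat \<Rightarrow> 'w" and Js Ds :: "int set"
  assumes N: "prob_space N" and sh: "\<And>j. j \<in> Ds \<Longrightarrow> sh j \<in> N \<rightarrow>\<^sub>M S" "\<And>j. j \<in> Ds \<Longrightarrow> distr N S (sh j) = S"
    and add: "\<And>j d x. j \<in> Ds \<Longrightarrow> sh (j + int d) x = (\<lambda>n. sh j x (d + n))"
    and Js: "finite Js" "\<And>j p. j \<in> Js \<Longrightarrow> j * int p \<in> Ds"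
    and a0: "a0 \<in> {\<alpha>..\<beta>}" and \<epsilon>: "\<epsilon> > 0"
  shows "\<exists>r>0. AE x in N. eventually (\<lambda>p. \<forall>a\<in>{\<alpha>..\<beta>}. \<bar>a - a0\<bar> < r \<longrightarrow>
    regular_blocks \<epsilon> Js p a (\<lambda>i. sh i x)) sequentially"
proof -
  interpret N: prob_space N by (rule N)
  have "\<epsilon> / 2 > 0" using \<epsilon> by simp
  from local_estimates[OF a0 this] obtain r c K where r: "r > 0" and c: "c > 0" and "K > 0"
    and lam': "\<forall>a\<in>{\<alpha>..\<beta>}. \<bar>a - a0\<bar> < r \<longrightarrow> \<bar>lam a - lam a0\<bar> \<le> \<epsilon> / 2"
    and up: "\<forall>p. \<exists>E\<in>sets S. P.prob E \<le> K * real (2 * p + 1) ^ 5 * exp (- c * real p) \<and>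
      (\<forall>\<omega>\<in>space S - E. \<forall>a\<in>{\<alpha>..\<beta>}. \<bar>a - a0\<bar> < r \<longrightarrow> op_norm (W p a \<omega>) \<le> exp ((lam a0 + \<epsilon> / 2) * real p))"
    and two: "\<forall>p d. 1 \<le> p \<longrightarrow> 2 * p \<le> d \<longrightarrow> (\<exists>E\<in>sets S. P.prob E \<le> K * real (2 * p + 1) ^ 5 * exp (- c * real p) \<and>
      (\<forall>\<omega>\<in>space S - E. \<forall>a\<in>{\<alpha>..\<beta>}. \<bar>a - a0\<bar> < r \<longrightarrow>
         exp ((lam a0 - \<epsilon> / 2) * real (2 * p)) \<le> norm (W (2 * p) a \<omega> *v dir 0) \<or>
         exp ((lam a0 - \<epsilon> / 2) * real (2 * p)) \<le> norm (W (2 * p) a (\<lambda>n. \<omega> (d + n)) *v dir 0)))"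
    by (elim exE conjE) (rule that)
  have lam: "\<bar>lam a - lam a0\<bar> \<le> \<epsilon> / 2" if "a \<in> {\<alpha>..\<beta>}" "\<bar>a - a0\<bar> < r" for a
    using lam' that by blast
  have pull: "\<exists>E\<in>N.events. N.prob E \<le> b \<and> (\<forall>x\<in>space N - E. Q (sh j x))"
    if ex: "\<exists>E\<in>sets S. P.prob E \<le> b \<and> (\<forall>\<omega>\<in>space S - E. Q \<omega>)" and j: "j \<in> Ds" for j b Q
  proof -
    obtain E where E: "E \<in> sets S" "P.prob E \<le> b" "\<And>\<omega>. \<omega> \<in> space S - E \<Longrightarrow> Q \<omega>" using ex by blast
    have "N.prob (sh j -` E \<inter> space N) = measure (distr N S (sh j)) E"
      by (rule measure_distr[symmetric, OF sh(1)[OF j] E(1)])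
    hence "N.prob (sh j -` E \<inter> space N) \<le> b" using E by (simp add: sh(2)[OF j])
    moreover have "sh j -` E \<inter> space N \<in> N.events" by (rule measurable_sets[OF sh(1)[OF j] E(1)])
    moreover have "Q (sh j x)" if "x \<in> space N - sh j -` E \<inter> space N" for x
      using E(3)[of "sh j x"] measurable_space[OF sh(1)[OF j], of x] that by auto
    ultimately show ?thesis by blast
  qed
  let ?U = "\<lambda>j p x. \<forall>a\<in>{\<alpha>..\<beta>}. \<bar>a - a0\<bar> < r \<longrightarrow> op_norm (W p a (sh (j * int p) x)) \<le> exp ((lam a0 + \<epsilon> / 2) * real p)"
  let ?T = "\<lambda>j k p x. 1 \<le> p \<longrightarrow> j + 2 \<le> k \<longrightarrow> (\<forall>a\<in>{\<alpha>..\<beta>}. \<bar>a - a0\<bar> < r \<longrightarrow>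
      exp ((lam a0 - \<epsilon> / 2) * real (2 * p)) \<le> norm (W (2 * p) a (sh (j * int p) x) *v dir 0) \<or>
      exp ((lam a0 - \<epsilon> / 2) * real (2 * p)) \<le> norm (W (2 * p) a (sh (k * int p) x) *v dir 0))"
  have U: "AE x in N. eventually (\<lambda>p. ?U j p x) sequentially" if j: "j \<in> Js" for j
    by (rule N.AE_eventually_if_summable[OF _ summable_poly_exp[OF c, of K]],
        rule pull[OF spec[OF up] Js(2)[OF j]])
  have T: "AE x in N. eventually (\<lambda>p. ?T j k p x) sequentially" if jk: "j \<in> Js" "k \<in> Js" for j k
  proof (rule N.AE_eventually_if_summable[OF _ summable_poly_exp[OF c, of "max 0 K"]])
    fix p
    let ?b = "max 0 K * real (2 * p + 1) ^ 5 * exp (- c * real p)"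
    have bb: "K * real (2 * p + 1) ^ 5 * exp (- c * real p) \<le> ?b" by (intro mult_right_mono) auto
    show "\<exists>E\<in>N.events. N.prob E \<le> ?b \<and> (\<forall>x\<in>space N - E. ?T j k p x)"
    proof (cases "1 \<le> p \<and> j + 2 \<le> k")
      case False thus ?thesis by (intro bexI[of _ "{}"]) auto
    next
      case True
      define d where "d = nat ((k - j) * int p)"
      have "2 * int p \<le> (k - j) * int p" using True by (intro mult_right_mono) auto
      hence d: "2 * p \<le> d" "k * int p = j * int p + int d" by (auto simp: d_def algebra_simps)
      have eq: "sh (k * int p) x = (\<lambda>n. sh (j * int p) x (d + n))" for x
        unfolding d(2) by (rule add[OF Js(2)[OF jk(1)]])
      define Q where "Q \<omega> \<longleftrightarrow> (\<forall>a\<in>{\<alpha>..\<beta>}. \<bar>a - a0\<bar> < r \<longrightarrow>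
         exp ((lam a0 - \<epsilon> / 2) * real (2 * p)) \<le> norm (W (2 * p) a \<omega> *v dir 0) \<or>
         exp ((lam a0 - \<epsilon> / 2) * real (2 * p)) \<le> norm (W (2 * p) a (\<lambda>n. \<omega> (d + n)) *v dir 0))" for \<omega>
      have "\<exists>E\<in>sets S. P.prob E \<le> K * real (2 * p + 1) ^ 5 * exp (- c * real p) \<and> (\<forall>\<omega>\<in>space S - E. Q \<omega>)"
        unfolding Q_def by (rule two[rule_format, OF conjunct1[OF True] d(1)])
      from pull[OF this Js(2)[OF jk(1), of p]]
      obtain E where E: "E \<in> N.events" "N.prob E \<le> K * real (2 * p + 1) ^ 5 * exp (- c * real p)"
        "\<And>x. x \<in> space N - E \<Longrightarrow> Q (sh (j * int p) x)" by blast
      show ?thesis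
      proof (intro bexI[OF _ E(1)] conjI ballI)
        show "N.prob E \<le> ?b" using E(2) bb by linarith
        fix x assume "x \<in> space N - E"
        from E(3)[OF this, unfolded Q_def] show "?T j k p x" unfolding eq by (intro impI)
      qed
    qed
  qed
  have "AE x in N. (\<forall>j\<in>Js. eventually (\<lambda>p. ?U j p x) sequentially) \<and>
      (\<forall>j\<in>Js. \<forall>k\<in>Js. eventually (\<lambda>p. ?T j k p x) sequentially)"
    using U T Js(1) by (intro AE_conjI AE_finite_allI) auto
  hence "AE x in N. eventually (\<lambda>p. \<forall>a\<in>{\<alpha>..\<beta>}. \<bar>a - a0\<bar> < r \<longrightarrow>
    regular_blocks \<epsilon> Js p a (\<lambda>i. sh i x)) sequentially"
  proof eventually_elim
    case (elim x)
    have u: "eventually (\<lambda>p. \<forall>j\<in>Js. ?U j p x) sequentially"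
      by (rule eventually_ball_finite[OF Js(1) conjunct1[OF elim]])
    have t: "eventually (\<lambda>p. \<forall>j\<in>Js. \<forall>k\<in>Js. ?T j k p x) sequentially"
      by (rule eventually_ball_finite[OF Js(1)], rule ballI, rule eventually_ball_finite[OF Js(1)],
          rule bspec[OF conjunct2[OF elim]])
    have "eventually (\<lambda>p. (\<forall>j\<in>Js. ?U j p x) \<and> (\<forall>j\<in>Js. \<forall>k\<in>Js. ?T j k p x) \<and> 1 \<le> p) sequentially"
      by (intro eventually_conj u t eventually_ge_at_top)
    thus ?case
    proof eventually_elim
      case (elim p)
      show ?case
        unfolding regular_blocks_def
      proof (intro ballI impI conjI)
        fix a j assume a: "a \<in> {\<alpha>..\<beta>}" "\<bar>a - a0\<bar> < r" and j: "j \<in> Js"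
        have "op_norm (W p a (sh (j * int p) x)) \<le> exp ((lam a0 + \<epsilon> / 2) * real p)" using elim a j by blast
        also have "\<dots> \<le> exp ((lam a + \<epsilon>) * real p)"
        proof (intro iffD2[OF exp_le_cancel_iff] mult_right_mono)
          show "lam a0 + \<epsilon> / 2 \<le> lam a + \<epsilon>" using lam[OF a] by linarith
        qed simp
        finally show "op_norm (W p a (sh (j * int p) x)) \<le> exp ((lam a + \<epsilon>) * real p)" .
      next
        fix a j k assume a: "a \<in> {\<alpha>..\<beta>}" "\<bar>a - a0\<bar> < r" and jk: "j \<in> Js" "k \<in> Js" "j + 2 \<le> k"
        have "exp ((lam a - \<epsilon>) * real (2 * p)) \<le> exp ((lam a0 - \<epsilon> / 2) * real (2 * p))"
        proof (intro iffD2[OF exp_le_cancel_iff] mult_right_mono)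
          show "lam a - \<epsilon> \<le> lam a0 - \<epsilon> / 2" using lam[OF a] by linarith
        qed simp
        moreover have "exp ((lam a0 - \<epsilon> / 2) * real (2 * p)) \<le> norm (W (2 * p) a (sh (j * int p) x) *v dir 0) \<or>
          exp ((lam a0 - \<epsilon> / 2) * real (2 * p)) \<le> norm (W (2 * p) a (sh (k * int p) x) *v dir 0)"
          using elim a jk by blast
        ultimately show "exp ((lam a - \<epsilon>) * real (2 * p)) \<le> norm (W (2 * p) a (sh (j * int p) x) *v dir 0) \<or>
          exp ((lam a - \<epsilon>) * real (2 * p)) \<le> norm (W (2 * p) a (sh (k * int p) x) *v dir 0)"
          by linarith
      qed
    qed
  qed
  thus ?thesis using r by blast
qed

text \<open>Finitely many of the neighbourhoods of the local statement cover the compact parameter interval.\<close>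

lemma AE_blocks:
  fixes N :: "'n measure" and sh :: "int \<Rightarrow> 'n \<Rightarrow> nat \<Rightarrow> 'w" and Js Ds :: "int set"
  assumes N: "prob_space N" and sh: "\<And>j. j \<in> Ds \<Longrightarrow> sh j \<in> N \<rightarrow>\<^sub>M S" "\<And>j. j \<in> Ds \<Longrightarrow> distr N S (sh j) = S"
    and add: "\<And>j d x. j \<in> Ds \<Longrightarrow> sh (j + int d) x = (\<lambda>n. sh j x (d + n))"
    and Js: "finite Js" "\<And>j p. j \<in> Js \<Longrightarrow> j * int p \<in> Ds" and \<epsilon>: "\<epsilon> > 0"
  shows "AE x in N. \<forall>a\<in>{\<alpha>..\<beta>}. eventually (\<lambda>p.
    regular_blocks \<epsilon> Js p a (\<lambda>i. sh i x)) sequentially"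
proof -
  let ?Q = "\<lambda>a p x. regular_blocks \<epsilon> Js p a (\<lambda>i. sh i x)"
  have "\<forall>a0\<in>{\<alpha>..\<beta>}. \<exists>r>0. AE x in N. eventually (\<lambda>p. \<forall>a\<in>{\<alpha>..\<beta>}. \<bar>a - a0\<bar> < r \<longrightarrow> ?Q a p x) sequentially"
    using AE_blocks_local[OF N sh add Js _ \<epsilon>] by blast
  from bchoice[OF this] obtain r where r': "\<forall>a0\<in>{\<alpha>..\<beta>}. r a0 > 0 \<and>
    (AE x in N. eventually (\<lambda>p. \<forall>a\<in>{\<alpha>..\<beta>}. \<bar>a - a0\<bar> < r a0 \<longrightarrow> ?Q a p x) sequentially)" ..
  have r1: "r a0 > 0" if "a0 \<in> {\<alpha>..\<beta>}" for a0 using bspec[OF r' that] by (rule conjunct1)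
  have r2: "AE x in N. eventually (\<lambda>p. \<forall>a\<in>{\<alpha>..\<beta>}. \<bar>a - a0\<bar> < r a0 \<longrightarrow> ?Q a p x) sequentially"
    if "a0 \<in> {\<alpha>..\<beta>}" for a0 using bspec[OF r' that] by (rule conjunct2)
  obtain A where A: "A \<subseteq> {\<alpha>..\<beta>}" "finite A" "{\<alpha>..\<beta>} \<subseteq> (\<Union>a0\<in>A. ball a0 (r a0))"
  proof (rule compactE_image[of "{\<alpha>..\<beta>}" "{\<alpha>..\<beta>}" "\<lambda>a0. ball a0 (r a0)"])
    show "{\<alpha>..\<beta>} \<subseteq> (\<Union>a0\<in>{\<alpha>..\<beta>}. ball a0 (r a0))" using r1 by force
  qed auto
  have "AE x in N. \<forall>a0\<in>A. eventually (\<lambda>p. \<forall>a\<in>{\<alpha>..\<beta>}. \<bar>a - a0\<bar> < r a0 \<longrightarrow> ?Q a p x) sequentially"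
    using A r2 by (intro AE_finite_allI) (auto simp only: subset_iff)
  thus ?thesis
  proof eventually_elim
    case (elim x)
    show ?case
    proof
      fix a assume a: "a \<in> {\<alpha>..\<beta>}"
      then obtain a0 where a0: "a0 \<in> A" "\<bar>a - a0\<bar> < r a0"
        using A(3) by (auto simp: dist_real_def abs_minus_commute)
      have "eventually (\<lambda>p. \<forall>a\<in>{\<alpha>..\<beta>}. \<bar>a - a0\<bar> < r a0 \<longrightarrow> ?Q a p x) sequentially" using elim a0(1) by blast
      thus "eventually (\<lambda>p. ?Q a p x) sequentially"
        by (rule eventually_mono) (use a a0(2) in blast)
    qed
  qed
qed

end

section \<open>From blocks to limits\<close>

text \<open>If \<open>w\<close> is not contracted by \<open>A\<close> at almost the maximal rate, then \<open>A w\<close> is nearly parallel to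
  \<open>A e\<close>, which \<open>B\<close> expands at almost the maximal rate.\<close>

lemma expansion_persists:
  assumes A: "det A = 1" "op_norm A \<le> exp ((l + \<epsilon>) * p)" and B: "op_norm B \<le> exp ((l + \<epsilon>) * p)"
    and big: "exp ((l - \<epsilon>) * (2 * p)) \<le> norm (B *v (A *v e))" and e: "norm e = 1"
    and p: "1 \<le> \<epsilon> * p" and w: "norm w * exp (- (l - 4 * \<epsilon>) * p) \<le> norm (A *v w)"
  shows "exp ((l - 4 * \<epsilon>) * p) * norm (A *v w) \<le> norm (B *v (A *v w))"
proof -
  let ?E = "exp ((l + \<epsilon>) * p)"
  have Ae: "norm (A *v e) \<le> ?E" using norm_mv_le[of A e] A e by simp
  have "\<bar>cr (A *v w) (A *v e)\<bar> \<le> norm w" using abs_cr_le[of w e] A e by (simp add: cr_matrix)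
  moreover have "norm w \<le> exp ((l - 4 * \<epsilon>) * p) * norm (A *v w)"
  proof -
    have "norm w * exp (- (l - 4 * \<epsilon>) * p) * exp ((l - 4 * \<epsilon>) * p) \<le> norm (A *v w) * exp ((l - 4 * \<epsilon>) * p)"
      by (intro mult_right_mono w) auto
    moreover have "exp (- (l - 4 * \<epsilon>) * p) * exp ((l - 4 * \<epsilon>) * p) = 1"
      unfolding exp_add[symmetric] by (simp add: algebra_simps)
    ultimately show ?thesis by (simp only: mult.assoc mult_1_right mult.commute[of "norm (A *v w)"])
  qed
  ultimately have cr: "\<bar>cr (A *v w) (A *v e)\<bar> \<le> exp ((l - 4 * \<epsilon>) * p) * norm (A *v w)" by linarith
  have "exp ((l - \<epsilon>) * (2 * p)) * norm (A *v w) \<le> norm (B *v (A *v e)) * norm (A *v w)"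
    by (intro mult_right_mono big) auto
  also have "\<dots> \<le> norm (A *v e) * norm (B *v (A *v w)) + \<bar>cr (A *v w) (A *v e)\<bar> * op_norm B"
    by (rule norm_mv_parallel)
  also have "\<dots> \<le> ?E * norm (B *v (A *v w)) + (exp ((l - 4 * \<epsilon>) * p) * norm (A *v w)) * ?E"
    using Ae B by (intro add_mono mult_mono cr) auto
  also have "\<dots> = ?E * (norm (B *v (A *v w)) + exp ((l - 4 * \<epsilon>) * p) * norm (A *v w))"
    by (simp add: algebra_simps)
  finally have "exp ((l - \<epsilon>) * (2 * p)) * norm (A *v w)
      \<le> ?E * (norm (B *v (A *v w)) + exp ((l - 4 * \<epsilon>) * p) * norm (A *v w))" .
  moreover have "exp ((l - \<epsilon>) * (2 * p)) = ?E * exp ((l - 3 * \<epsilon>) * p)"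
    unfolding exp_add[symmetric] by (simp add: algebra_simps)
  ultimately have 1: "exp ((l - 3 * \<epsilon>) * p) * norm (A *v w)
      \<le> norm (B *v (A *v w)) + exp ((l - 4 * \<epsilon>) * p) * norm (A *v w)" by (simp add: mult.assoc)
  have "2 \<le> exp (\<epsilon> * p)" using exp_ge_add_one_self[of "\<epsilon> * p"] p by linarith
  hence "exp ((l - 4 * \<epsilon>) * p) * 2 \<le> exp ((l - 4 * \<epsilon>) * p) * exp (\<epsilon> * p)" by simp
  also have "\<dots> = exp ((l - 3 * \<epsilon>) * p)" unfolding exp_add[symmetric] by (simp add: algebra_simps)
  finally have "(exp ((l - 4 * \<epsilon>) * p) * 2) * norm (A *v w) \<le> exp ((l - 3 * \<epsilon>) * p) * norm (A *v w)"
    by (intro mult_right_mono) auto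
  with 1 show ?thesis by simp
qed

text \<open>For the logarithmic size \<open>y j\<close> of an orbit after \<open>j\<close> blocks, in units of the block length: unless the
  orbit is maximally contracted in block \<open>j\<close>, it is maximally expanded in block \<open>j + 1\<close>.\<close>

definition no_cancellation :: "real \<Rightarrow> (int \<Rightarrow> real) \<Rightarrow> int \<Rightarrow> bool" where
  "no_cancellation G y j \<longleftrightarrow> (y (j + 1) - y j > - G \<longrightarrow> y (j + 2) - y (j + 1) \<ge> G)"

text \<open>Once the orbit has not fallen at full speed, it climbs at full speed in all later blocks, as long as
  there is no cancellation.\<close>

lemma growth_persists:
  assumes G: "G > 0" and good: "\<And>i. j \<le> i \<Longrightarrow> i \<le> K - 2 \<Longrightarrow> no_cancellation G y i"
    and start: "y (j + 1) - y j > - G" and n: "j + 1 + int n \<le> K"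
  shows "y (j + 1 + int n) \<ge> y (j + 1) + G * real n \<and> y (j + 1 + int n) - y (j + int n) > - G"
  using n
proof (induction n)
  case 0 thus ?case using start by simp
next
  case (Suc n)
  have IH: "y (j + 1 + int n) \<ge> y (j + 1) + G * real n" "y (j + 1 + int n) - y (j + int n) > - G"
    using Suc by auto
  have "no_cancellation G y (j + int n)" using Suc.prems by (intro good) auto
  hence "y (j + int n + 2) - y (j + int n + 1) \<ge> G" using IH(2) by (simp add: no_cancellation_def algebra_simps)
  hence s: "y (j + 1 + int (Suc n)) - y (j + int (Suc n)) \<ge> G" by (simp add: algebra_simps)
  have "y (j + int (Suc n)) = y (j + 1 + int n)" by (simp add: algebra_simps)
  thus ?case using s IH(1) G by (simp add: algebra_simps)
qed

text \<open>If the orbit failed to fall in some block \<open>j \<le> J\<close>, it would climb at speed \<open>G\<close> from there until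
  time \<open>K\<close>, which is so large that the slow bound \<open>g * K\<close> would be violated.\<close>

lemma slow_orbit_contracts:
  assumes G: "G > 0" and good: "\<And>i. m \<le> i \<Longrightarrow> i \<le> K - 2 \<Longrightarrow> no_cancellation G y i"
    and step: "\<And>i. 0 \<le> i \<Longrightarrow> i < K \<Longrightarrow> \<bar>y (i + 1) - y i\<bar> \<le> U" and y0: "\<bar>y 0\<bar> \<le> 1"
    and slow: "y K \<le> g * real_of_int K" and K: "(G - g) * real_of_int K > (U + G) * real_of_int (J + 1) + 1"
    and J: "J < K" and m: "-1 \<le> m" and j: "m \<le> j" "j \<le> J" and U: "U \<ge> 0"
  shows "y (j + 1) - y j \<le> - G"
proof (rule ccontr)
  assume "\<not> ?thesis"
  hence start: "y (j + 1) - y j > - G" by simp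
  have lower: "y (int n) \<ge> y 0 - U * real n" if "int n \<le> K" for n
    using that
  proof (induction n)
    case (Suc n)
    have "\<bar>y (int n + 1) - y (int n)\<bar> \<le> U" using Suc.prems by (intro step) auto
    hence "y (int (Suc n)) \<ge> y (int n) - U" by (simp add: add.commute)
    thus ?case using Suc by (simp add: algebra_simps)
  qed simp
  define n where "n = nat (K - j - 1)"
  have n: "int n = K - j - 1" using j J by (simp add: n_def)
  have nr: "real n = real_of_int K - real_of_int j - 1" using n by (metis of_int_1 of_int_diff of_int_of_nat_eq)
  have eK: "j + 1 + int n = K" using n by simp
  have "y (j + 1 + int n) \<ge> y (j + 1) + G * real n"
    using growth_persists[OF G good start, of K n] j eK by simp
  hence "y K \<ge> y (j + 1) + G * real n" unfolding eK .
  moreover have "y (j + 1) \<ge> y 0 - U * real_of_int (j + 1)"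
    using lower[of "nat (j + 1)"] j m J by simp
  ultimately have "g * real_of_int K \<ge> - 1 - U * (real_of_int j + 1) + G * (real_of_int K - real_of_int j - 1)"
    using slow y0 unfolding nr by simp
  hence "(G - g) * real_of_int K \<le> (U + G) * (real_of_int j + 1) + 1" by (simp add: algebra_simps)
  also have "\<dots> \<le> (U + G) * (real_of_int J + 1) + 1"
    using j G U by (intro add_right_mono mult_left_mono) auto
  finally show False using K by simp
qed

lemma decrease_sum:
  assumes "\<And>j. m \<le> j \<Longrightarrow> j \<le> J \<Longrightarrow> y (j + 1) - y j \<le> - (G::real)" "m \<le> J + 1"
  shows "y (J + 1) \<le> y m - G * real_of_int (J + 1 - m)"
proof -
  have "y (m + int n) \<le> y m - G * real n" if "m + int n \<le> J + 1" for n
    using that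
  proof (induction n)
    case (Suc n)
    have "y (m + int n + 1) - y (m + int n) \<le> - G" using Suc.prems by (intro assms(1)) auto
    thus ?case using Suc by (simp add: algebra_simps)
  qed simp
  from this[of "nat (J + 1 - m)"] show ?thesis using assms(2) by simp
qed

lemma decay_one_sided:
  assumes G: "G > 0" and U: "U \<ge> 0"
    and good: "\<And>i. 2 \<le> i \<Longrightarrow> i \<le> K - 2 \<Longrightarrow> no_cancellation G y i"
    and step: "\<And>i. 0 \<le> i \<Longrightarrow> i < K \<Longrightarrow> \<bar>y (i + 1) - y i\<bar> \<le> U" and y0: "\<bar>y 0\<bar> \<le> 1"
    and slow: "y K \<le> g * real_of_int K" and K: "(G - g) * real_of_int K > (U + G) * real_of_int (J + 1) + 1"
    and J: "1 \<le> J" "J < K"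
  shows "y (J + 1) \<le> 1 + 2 * U - G * real_of_int (J - 1)"
proof -
  have "y (j + 1) - y j \<le> - G" if "2 \<le> j" "j \<le> J" for j
    using slow_orbit_contracts[where m = 2, OF G good step y0 slow K J(2)] that U by simp
  hence "y (J + 1) \<le> y 2 - G * real_of_int (J + 1 - 2)" using J by (intro decrease_sum) auto
  moreover have "y 2 \<le> 1 + 2 * U" using step[of 0] step[of 1] y0 J by simp
  ultimately show ?thesis by simp
qed

text \<open>The implication in the definition becomes its own contrapositive when time is reversed.\<close>

lemma no_cancellation_reflect: "no_cancellation G (\<lambda>j. y (- j)) i \<longleftrightarrow> no_cancellation G y (- i - 2)"
proof -
  have e: "y (- (i + 1)) = y (- i - 2 + 1)" "y (- (i + 2)) = y (- i - 2)" "y (- i) = y (- i - 2 + 2)"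
    by (rule arg_cong[of _ _ y], simp)+
  show ?thesis unfolding no_cancellation_def e by auto
qed

text \<open>Otherwise slowness at time \<open>K\<close> would force the orbit to fall at full speed already in the block before
  time \<open>0\<close>, so that it would be too large at time \<open>-1\<close>.\<close>

lemma cancellation_after_start:
  assumes G: "G > 0" and U: "U \<ge> 0"
    and step: "\<And>i. - K \<le> i \<Longrightarrow> i < K \<Longrightarrow> \<bar>y (i + 1) - y i\<bar> \<le> U" and y0: "\<bar>y 0\<bar> \<le> 1" "\<bar>y 0\<bar> < G - g"
    and slow: "y K \<le> g * real_of_int K" "y (- 1) \<le> g" and K: "(G - g) * real_of_int K > (U + G) * real_of_int (J + 1) + 1"
    and J: "1 \<le> J" "J < K"
  shows "\<exists>i. -1 \<le> i \<and> i \<le> K - 2 \<and> \<not> no_cancellation G y i"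
proof (rule ccontr)
  assume "\<not> ?thesis"
  hence good: "\<And>i. -1 \<le> i \<Longrightarrow> i \<le> K - 2 \<Longrightarrow> no_cancellation G y i" by blast
  have "y (- 1 + 1) - y (- 1) \<le> - G"
    by (rule slow_orbit_contracts[where m = "- 1", OF G good step y0(1) slow(1) K J(2)]) (use J U in auto)
  thus False using slow(2) y0(2) by simp
qed

text \<open>There is a cancellation at an index \<open>\<ge> -1\<close> and, by reflection, one at an index \<open>\<le> -1\<close>. As cancellations
  are closer than \<open>2\<close> to each other, all of them have an index between \<open>-2\<close> and \<open>0\<close>.\<close>

lemma decay_two_sided:
  assumes G: "G > 0" and U: "U \<ge> 0"
    and good: "\<And>i j. - K \<le> i \<Longrightarrow> i + 2 \<le> j \<Longrightarrow> j \<le> K - 2 \<Longrightarrow> no_cancellation G y i \<or> no_cancellation G y j"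
    and step: "\<And>i. - K \<le> i \<Longrightarrow> i < K \<Longrightarrow> \<bar>y (i + 1) - y i\<bar> \<le> U" and y0: "\<bar>y 0\<bar> \<le> 1" "\<bar>y 0\<bar> < G - g"
    and slow: "y K \<le> g * real_of_int K" "y (- K) \<le> g * real_of_int K" "y 1 \<le> g" "y (- 1) \<le> g"
    and K: "(G - g) * real_of_int K > (U + G) * real_of_int (J + 1) + 1" and J: "1 \<le> J" "J < K"
  shows "y (J + 1) \<le> 1 + U - G * real_of_int J" "y (- (J + 1)) \<le> 1 + U - G * real_of_int J"
proof -
  let ?z = "\<lambda>j. y (- j)"
  have zstep: "\<bar>?z (i + 1) - ?z i\<bar> \<le> U" if "- K \<le> i" "i < K" for i
    using step[of "- i - 1"] that by (simp add: abs_minus_commute)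
  obtain i1 where i1: "-1 \<le> i1" "i1 \<le> K - 2" "\<not> no_cancellation G y i1"
    using cancellation_after_start[OF G U step y0 slow(1,4) K J] by blast
  obtain i2 where i2: "-1 \<le> i2" "i2 \<le> K - 2" "\<not> no_cancellation G ?z i2"
    using cancellation_after_start[of G U K ?z g J, OF G U zstep] y0 slow K J by auto
  hence i2': "\<not> no_cancellation G y (- i2 - 2)" by (simp add: no_cancellation_reflect)
  have gy: "no_cancellation G y i" if "1 \<le> i" "i \<le> K - 2" for i
    using good[of "- i2 - 2" i] i2' i2 that by simp
  have gz: "no_cancellation G ?z i" if "1 \<le> i" "i \<le> K - 2" for i
    using good[of "- i - 2" i1] i1 that by (simp add: no_cancellation_reflect)
  have "y (j + 1) - y j \<le> - G" if "1 \<le> j" "j \<le> J" for j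
    using slow_orbit_contracts[where m = 1, OF G gy step y0(1) slow(1) K J(2)] that U J by simp
  hence "y (J + 1) \<le> y 1 - G * real_of_int (J + 1 - 1)" using J by (intro decrease_sum) auto
  moreover have "y 1 \<le> 1 + U" using step[of 0] y0 J by simp
  ultimately show "y (J + 1) \<le> 1 + U - G * real_of_int J" by simp
  have "?z (j + 1) - ?z j \<le> - G" if "1 \<le> j" "j \<le> J" for j
    by (rule slow_orbit_contracts[where m = 1 and y = ?z, OF G gz zstep _ _ K J(2)]) (use that U J y0 slow in auto)
  hence "?z (J + 1) \<le> ?z 1 - G * real_of_int (J + 1 - 1)" using J by (intro decrease_sum) auto
  moreover have "?z 1 \<le> 1 + U" using zstep[of 0] y0 J by simp
  ultimately show "y (- (J + 1)) \<le> 1 + U - G * real_of_int J" by simp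
qed

text \<open>The Lipschitz bound interpolates between the multiples of \<open>L\<close>.\<close>

lemma limit_from_blocks:
  fixes f :: "nat \<Rightarrow> real"
  assumes lip: "\<And>n. \<bar>f (Suc n) - f n\<bar> \<le> c"
    and up: "\<And>\<tau>. \<tau> > 0 \<Longrightarrow> \<exists>L\<ge>1. eventually (\<lambda>p. f (L * p) \<le> (\<tau> - l) * real (L * p)) sequentially"
    and low: "\<And>\<tau>. \<tau> > 0 \<Longrightarrow> eventually (\<lambda>n. f n \<ge> - (l + \<tau>) * real n) sequentially"
  shows "(\<lambda>n. f n / real n) \<longlonglongrightarrow> - l"
proof (rule order_tendstoI)
  fix a assume a: "a < - l"
  define \<tau> where "\<tau> = (- l - a) / 2"
  have t: "\<tau> > 0" "a < - (l + \<tau>)" using a by (auto simp: \<tau>_def field_simps)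
  show "eventually (\<lambda>n. a < f n / real n) sequentially"
    using low[OF t(1)] eventually_gt_at_top[of 0]
  proof eventually_elim
    case (elim n)
    hence "- (l + \<tau>) \<le> f n / real n" by (simp add: field_simps)
    thus ?case using t by linarith
  qed
next
  fix a assume a: "- l < a"
  define \<tau> where "\<tau> = (a + l) / 3"
  have t: "\<tau> > 0" "a = 3 * \<tau> - l" using a by (auto simp: \<tau>_def add_divide_distrib)
  obtain L where L: "L \<ge> 1" "eventually (\<lambda>p. f (L * p) \<le> (\<tau> - l) * real (L * p)) sequentially"
    using up[OF t(1)] by blast
  then obtain p0 where p0: "\<And>p. p \<ge> p0 \<Longrightarrow> f (L * p) \<le> (\<tau> - l) * real (L * p)"
    by (auto simp: eventually_sequentially)
  have c: "c \<ge> 0" using lip[of 0] abs_ge_zero order_trans by blast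
  have near: "f (m + k) \<le> f m + c * real k" for m k
  proof (induction k)
    case (Suc k) thus ?case using lip[of "m + k"] by (simp add: algebra_simps abs_le_iff)
  qed simp
  have "eventually (\<lambda>n. real n > (c + \<bar>\<tau> - l\<bar>) * real L / \<tau>) sequentially"
    using filterlim_real_sequentially by (rule filterlim_at_top_dense[THEN iffD1, rule_format])
  thus "eventually (\<lambda>n. f n / real n < a) sequentially"
    using eventually_ge_at_top[of "L * (p0 + 1)"]
  proof eventually_elim
    case (elim n)
    define p where "p = n div L"
    define k where "k = n mod L"
    have n: "n = L * p + k" "k < L" using L by (auto simp: p_def k_def)
    have "p \<ge> p0 + 1" using elim(2) L unfolding p_def by (metis div_le_mono nonzero_mult_div_cancel_left not_one_le_zero)
    hence "f n \<le> (\<tau> - l) * real (L * p) + c * real k" using p0[of p] near[of "L * p" k] n by simp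
    also have "(\<tau> - l) * real (L * p) = (\<tau> - l) * real n - (\<tau> - l) * real k" by (simp add: n algebra_simps)
    also have "\<dots> + c * real k \<le> (\<tau> - l) * real n + (c + \<bar>\<tau> - l\<bar>) * real L"
    proof -
      have "- ((\<tau> - l) * real k) \<le> \<bar>\<tau> - l\<bar> * real k" by (metis abs_ge_minus_self abs_mult abs_of_nat)
      moreover have "\<bar>\<tau> - l\<bar> * real k \<le> \<bar>\<tau> - l\<bar> * real L" "c * real k \<le> c * real L"
        using n c by (auto intro!: mult_left_mono)
      ultimately show ?thesis by (simp add: algebra_simps)
    qed
    also have "(c + \<bar>\<tau> - l\<bar>) * real L < \<tau> * real n" using elim(1) t by (simp add: field_simps)
    finally have "f n < (\<tau> - l + \<tau>) * real n" by (simp add: algebra_simps)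
    also have "\<dots> \<le> a * real n" unfolding t(2) using t(1) by (intro mult_right_mono) auto
    finally have "f n < a * real n" .
    moreover have "n > 0" using elim(2) L by (cases n) auto
    ultimately show ?case by (simp add: field_simps)
  qed
qed

text \<open>The matrix \<open>P n k\<close> takes the orbit from time \<open>n\<close> to time \<open>n + k\<close>. The estimates in this locale are
  deterministic.\<close>

locale orbit =
  fixes A :: "int \<Rightarrow> real^2^2" and w :: "int \<Rightarrow> real^2" and C l :: real and P :: "int \<Rightarrow> nat \<Rightarrow> real^2^2"
  assumes A_det: "\<And>n. det (A n) = 1" and A_op: "\<And>n. op_norm (A n) \<le> C"
    and w_step: "\<And>n. w (n + 1) = A (n + 1) *v w n" and w_0: "w 0 \<noteq> 0" and l: "l > 0"
  defines "P \<equiv> \<lambda>n k. mprod (\<lambda>i. A (n + 1 + int i)) k"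
begin

lemma w_add: "w (n + int k) = P n k *v w n"
proof (induction k)
  case (Suc k)
  have "w (n + int (Suc k)) = w ((n + int k) + 1)" by (simp add: algebra_simps)
  also have "\<dots> = A (n + 1 + int k) *v w (n + int k)" unfolding w_step by (simp add: algebra_simps)
  finally show ?case unfolding Suc by (simp add: P_def matrix_vector_mul_assoc)
qed (simp add: P_def)

lemma P_double: "P n (2 * p) *v v = P (n + int p) p *v (P n p *v v)"
proof -
  have "2 * p = p + p" by simp
  thus ?thesis unfolding P_def by (simp only: mprod_add_mv) (simp add: algebra_simps)
qed

lemma P_det: "det (P n k) = 1" unfolding P_def by (intro det_mprod A_det)

lemma w_nz: "w n \<noteq> 0"
proof (cases "n \<ge> 0")
  case True
  thus ?thesis using w_add[of 0 "nat n"] mv_nonzero[OF P_det w_0] by simp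
next
  case False
  hence "w 0 = P n (nat (- n)) *v w n" using w_add[of n "nat (- n)"] by simp
  thus ?thesis using w_0 by auto
qed

lemma C_ge_1: "1 \<le> C" using op_norm_ge_1[OF A_det] A_op order_trans by blast

lemma log_lipschitz: "\<bar>ln (norm (w (n + 1))) - ln (norm (w n))\<bar> \<le> ln C"
proof -
  have p: "norm (w n) > 0" "norm (w (n + 1)) > 0" using w_nz by simp_all
  have "norm (w (n + 1)) \<le> C * norm (w n)" unfolding w_step
    using norm_mv_le[of "A (n + 1)" "w n"] A_op[of "n + 1"] by (meson mult_right_mono norm_ge_zero order_trans)
  hence "ln (norm (w (n + 1))) \<le> ln (C * norm (w n))" using p by (intro ln_mono) auto
  moreover have "norm (w n) \<le> C * norm (w (n + 1))" unfolding w_step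
    using norm_le_op_norm_mv[OF A_det, of "w n" "n + 1"] A_op[of "n + 1"] by (meson mult_right_mono norm_ge_zero order_trans)
  hence "ln (norm (w n)) \<le> ln (C * norm (w (n + 1)))" using p by (intro ln_mono) auto
  ultimately show ?thesis using p C_ge_1 by (simp add: ln_mult abs_le_iff)
qed

definition big :: "real \<Rightarrow> nat \<Rightarrow> int \<Rightarrow> bool" where
  "big \<epsilon> p j \<longleftrightarrow> exp ((l - \<epsilon>) * real (2 * p)) \<le> norm (P (j * int p) (2 * p) *v dir 0)"

definition regular :: "real \<Rightarrow> int set \<Rightarrow> nat \<Rightarrow> bool" where
  "regular \<epsilon> Js p \<longleftrightarrow> (\<forall>j\<in>Js. op_norm (P (j * int p) p) \<le> exp ((l + \<epsilon>) * real p)) \<and>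
     (\<forall>j\<in>Js. \<forall>k\<in>Js. j + 2 \<le> k \<longrightarrow> big \<epsilon> p j \<or> big \<epsilon> p k)"

definition size :: "nat \<Rightarrow> int \<Rightarrow> real" where
  "size p j = ln (norm (w (j * int p))) / real p"

lemma block: "w ((j + 1) * int p) = P (j * int p) p *v w (j * int p)"
  using w_add[of "j * int p" p] by (simp add: algebra_simps)

lemma size_step:
  assumes reg: "regular \<epsilon> Js p" and j: "j \<in> Js" and p: "p \<ge> 1"
  shows "\<bar>size p (j + 1) - size p j\<bar> \<le> l + \<epsilon>"
proof -
  let ?u = "w (j * int p)" and ?v = "w ((j + 1) * int p)"
  have n: "norm ?u > 0" "norm ?v > 0" using w_nz by simp_all
  have op: "op_norm (P (j * int p) p) \<le> exp ((l + \<epsilon>) * real p)" using reg j by (simp add: regular_def)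
  have "norm ?v \<le> exp ((l + \<epsilon>) * real p) * norm ?u" unfolding block
    using norm_mv_le[of "P (j * int p) p" ?u] op by (meson mult_right_mono norm_ge_zero order_trans)
  hence "ln (norm ?v) \<le> ln (exp ((l + \<epsilon>) * real p) * norm ?u)" using n by (intro ln_mono) auto
  hence 1: "ln (norm ?v) \<le> (l + \<epsilon>) * real p + ln (norm ?u)" using n by (simp add: ln_mult)
  have "norm ?u \<le> exp ((l + \<epsilon>) * real p) * norm ?v" unfolding block
    using norm_le_op_norm_mv[OF P_det, of ?u "j * int p" p] op by (meson mult_right_mono norm_ge_zero order_trans)
  hence "ln (norm ?u) \<le> ln (exp ((l + \<epsilon>) * real p) * norm ?v)" using n by (intro ln_mono) auto
  hence 2: "ln (norm ?u) \<le> (l + \<epsilon>) * real p + ln (norm ?v)" using n by (simp add: ln_mult)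
  have "\<bar>ln (norm ?v) - ln (norm ?u)\<bar> \<le> (l + \<epsilon>) * real p" using 1 2 by linarith
  hence "\<bar>(ln (norm ?v) - ln (norm ?u)) / real p\<bar> \<le> l + \<epsilon>" using p by (simp add: field_simps)
  thus ?thesis by (simp add: size_def diff_divide_distrib)
qed

lemma no_cancellation_if_big:
  assumes reg: "regular \<epsilon> Js p" and j: "j \<in> Js" "j + 1 \<in> Js" and big: "big \<epsilon> p j"
    and p: "p \<ge> 1" "1 \<le> \<epsilon> * real p"
  shows "no_cancellation (l - 4 * \<epsilon>) (size p) j"
  unfolding no_cancellation_def
proof
  let ?G = "l - 4 * \<epsilon>"
  let ?u = "w (j * int p)" and ?v = "w ((j + 1) * int p)" and ?z = "w ((j + 2) * int p)"
  have n: "norm ?u > 0" "norm ?v > 0" "norm ?z > 0" using w_nz by simp_all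
  have z: "?z = P ((j + 1) * int p) p *v ?v" using block[of "j + 1" p] by (simp add: algebra_simps)
  assume "- ?G < size p (j + 1) - size p j"
  hence "- ?G < (ln (norm ?v) - ln (norm ?u)) / real p" by (simp add: size_def diff_divide_distrib)
  hence "- ?G * real p < ln (norm ?v) - ln (norm ?u)" using p by (simp add: field_simps)
  hence "exp (ln (norm ?u) + - ?G * real p) \<le> exp (ln (norm ?v))" by (subst exp_le_cancel_iff) linarith
  hence c: "norm ?u * exp (- ?G * real p) \<le> norm (P (j * int p) p *v ?u)"
    using n by (simp add: exp_add block[symmetric])
  have "exp (?G * real p) * norm (P (j * int p) p *v ?u) \<le> norm (P ((j + 1) * int p) p *v (P (j * int p) p *v ?u))"
  proof (rule expansion_persists[where l = l and \<epsilon> = \<epsilon> and e = "dir 0"])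
    show "op_norm (P (j * int p) p) \<le> exp ((l + \<epsilon>) * real p)"
         "op_norm (P ((j + 1) * int p) p) \<le> exp ((l + \<epsilon>) * real p)" using reg j by (simp_all add: regular_def)
    have "j * int p + int p = (j + 1) * int p" by (simp add: algebra_simps)
    thus "exp ((l - \<epsilon>) * (2 * real p)) \<le> norm (P ((j + 1) * int p) p *v (P (j * int p) p *v dir 0))"
      using big P_double[of "j * int p" p "dir 0"] by (simp add: big_def)
  qed (use P_det p c in auto)
  hence "exp (?G * real p) * norm ?v \<le> norm ?z" unfolding z block .
  hence "ln (exp (?G * real p) * norm ?v) \<le> ln (norm ?z)" using n by (intro ln_mono) auto
  hence "?G * real p \<le> ln (norm ?z) - ln (norm ?v)" using n by (simp add: ln_mult)
  hence "?G \<le> (ln (norm ?z) - ln (norm ?v)) / real p" using p by (simp add: field_simps)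
  thus "?G \<le> size p (j + 2) - size p (j + 1)" by (simp add: size_def diff_divide_distrib)
qed

lemma lower_bounds:
  assumes reg: "\<And>\<epsilon>. \<epsilon> > 0 \<Longrightarrow> eventually (\<lambda>p. op_norm (Q p) \<le> exp ((l + \<epsilon>) * real p)) sequentially"
    and Q: "\<And>p. norm (w 0) \<le> op_norm (Q p) * norm (w (f p))" and \<tau>: "\<tau> > 0"
  shows "eventually (\<lambda>p. ln (norm (w (f p))) \<ge> - (l + \<tau>) * real p) sequentially"
proof -
  have "\<tau> / 2 > 0" using \<tau> by simp
  have "eventually (\<lambda>p. real p > - ln (norm (w 0)) / (\<tau> / 2)) sequentially"
    using filterlim_real_sequentially by (rule filterlim_at_top_dense[THEN iffD1, rule_format])
  with reg[OF \<open>\<tau> / 2 > 0\<close>] show ?thesis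
  proof eventually_elim
    case (elim p)
    have n: "norm (w 0) > 0" "norm (w (f p)) > 0" using w_nz by simp_all
    have "norm (w 0) \<le> exp ((l + \<tau> / 2) * real p) * norm (w (f p))"
      using Q[of p] elim(1) by (meson mult_right_mono norm_ge_zero order_trans)
    hence "ln (norm (w 0)) \<le> ln (exp ((l + \<tau> / 2) * real p) * norm (w (f p)))" using n by (intro ln_mono) auto
    hence "ln (norm (w 0)) \<le> (l + \<tau> / 2) * real p + ln (norm (w (f p)))" using n by (simp add: ln_mult)
    moreover have "- ln (norm (w 0)) < \<tau> / 2 * real p" using elim(2) \<tau> by (simp add: field_simps)
    ultimately show ?case by (simp add: algebra_simps)
  qed
qed

text \<open>The tolerance \<open>\<epsilon>\<close> is small compared with the gap \<open>\<sigma>\<close>; then \<open>J\<close> is so large that the first blocks do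
  not matter for the rate, and finally \<open>K\<close> is so large that climbing from block \<open>J\<close> on would be noticed.\<close>

lemma choose_constants:
  fixes \<tau> \<sigma> :: real assumes "\<tau> > 0" "\<sigma> > 0"
  obtains \<epsilon> and J K :: nat where "\<epsilon> > 0" "4 * \<epsilon> < l" "6 * \<epsilon> < \<sigma>" "1 \<le> J" "J < K"
    "(\<sigma> - 4 * \<epsilon>) * real K > ((l + \<epsilon>) + (l - 4 * \<epsilon>)) * real (J + 1) + 1"
    "1 + 2 * (l + \<epsilon>) - (l - 4 * \<epsilon>) * (real J - 1) \<le> (\<tau> - l) * real (J + 1)"
    "1 + (l + \<epsilon>) - (l - 4 * \<epsilon>) * real J \<le> (\<tau> - l) * real (J + 1)"
proof -
  define \<epsilon> where "\<epsilon> = min (l / 8) (min (\<sigma> / 16) (\<tau> / 8))"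
  have e: "\<epsilon> > 0" "4 * \<epsilon> \<le> l / 2" "4 * \<epsilon> \<le> \<sigma> / 4" "4 * \<epsilon> \<le> \<tau> / 2" using l assms by (auto simp: \<epsilon>_def)
  obtain J :: nat where J: "real J > (2 + 8 * l) / \<tau> + 1" using reals_Archimedean2 by blast
  have "(2 + 8 * l) / \<tau> > 0" using l assms by simp
  hence J1: "1 \<le> J" using J by linarith
  have "(2 + 8 * l) / \<tau> < real (J + 1)" using J by simp
  hence "1 + 4 * l < \<tau> / 2 * real (J + 1)" using assms by (simp add: field_simps)
  also have "\<dots> \<le> (\<tau> - 4 * \<epsilon>) * real (J + 1)" using e by (intro mult_right_mono) auto
  finally have a: "1 + 4 * l \<le> (\<tau> - 4 * \<epsilon>) * real (J + 1)" by simp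
  obtain K :: nat where K: "real K > (((l + \<epsilon>) + (l - 4 * \<epsilon>)) * real (J + 1) + 1) / (\<sigma> / 2) + real J"
    using reals_Archimedean2 by blast
  have pos: "0 \<le> ((l + \<epsilon>) + (l - 4 * \<epsilon>)) * real (J + 1) + 1" using e l by (intro add_nonneg_nonneg mult_nonneg_nonneg) auto
  hence "0 \<le> (((l + \<epsilon>) + (l - 4 * \<epsilon>)) * real (J + 1) + 1) / (\<sigma> / 2)" using assms by (intro divide_nonneg_nonneg) auto
  hence JK: "J < K" using K by linarith
  have "(((l + \<epsilon>) + (l - 4 * \<epsilon>)) * real (J + 1) + 1) / (\<sigma> / 2) < real K" using K by linarith
  hence "((l + \<epsilon>) + (l - 4 * \<epsilon>)) * real (J + 1) + 1 < \<sigma> / 2 * real K"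
    using assms by (simp only: pos_divide_less_eq[of "\<sigma> / 2"] half_gt_zero mult.commute)
  also have "\<dots> \<le> (\<sigma> - 4 * \<epsilon>) * real K" using e by (intro mult_right_mono) auto
  finally have k: "((l + \<epsilon>) + (l - 4 * \<epsilon>)) * real (J + 1) + 1 < (\<sigma> - 4 * \<epsilon>) * real K" .
  show ?thesis
  proof (rule that[of \<epsilon> J K])
    show "1 + 2 * (l + \<epsilon>) - (l - 4 * \<epsilon>) * (real J - 1) \<le> (\<tau> - l) * real (J + 1)"
      using a e by (simp add: algebra_simps)
    show "1 + (l + \<epsilon>) - (l - 4 * \<epsilon>) * real J \<le> (\<tau> - l) * real (J + 1)"
      using a e l by (simp add: algebra_simps)
  qed (use e l assms J1 JK k in auto)
qed

text \<open>Since \<open>w\<close> starts at \<open>dir 0\<close>, its slowness says that the block pair at time \<open>0\<close> is exceptional.\<close>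

lemma decay_forward:
  assumes reg: "\<And>\<epsilon> K. \<epsilon> > 0 \<Longrightarrow> eventually (regular \<epsilon> {0..int K}) sequentially" and w0: "w 0 = dir 0"
    and slow: "\<sigma> > 0" "eventually (\<lambda>n. ln (norm (w (int n))) \<le> (l - \<sigma>) * real n) sequentially"
  shows "(\<lambda>n. ln (norm (w (int n))) / real n) \<longlonglongrightarrow> - l"
proof (rule limit_from_blocks[where c = "ln C"])
  show "\<bar>ln (norm (w (int (Suc n)))) - ln (norm (w (int n)))\<bar> \<le> ln C" for n
    using log_lipschitz[of "int n"] by (simp add: add.commute)
  show "eventually (\<lambda>n. ln (norm (w (int n))) \<ge> - (l + \<tau>) * real n) sequentially" if "\<tau> > 0" for \<tau>
  proof (rule lower_bounds[where Q = "\<lambda>p. P 0 p", OF _ _ that])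
    show "eventually (\<lambda>p. op_norm (P 0 p) \<le> exp ((l + \<epsilon>) * real p)) sequentially" if "\<epsilon> > 0" for \<epsilon>
      using reg[OF that, of 0] by eventually_elim (simp add: regular_def)
    show "norm (w 0) \<le> op_norm (P 0 p) * norm (w (int p))" for p
      using norm_le_op_norm_mv[OF P_det, of "w 0" 0 p] w_add[of 0 p] by simp
  qed
  fix \<tau> :: real assume \<tau>: "\<tau> > 0"
  obtain \<epsilon> and J K :: nat where c: "\<epsilon> > 0" "4 * \<epsilon> < l" "6 * \<epsilon> < \<sigma>" "1 \<le> J" "J < K"
    "(\<sigma> - 4 * \<epsilon>) * real K > ((l + \<epsilon>) + (l - 4 * \<epsilon>)) * real (J + 1) + 1"
    "1 + 2 * (l + \<epsilon>) - (l - 4 * \<epsilon>) * (real J - 1) \<le> (\<tau> - l) * real (J + 1)"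
    by (rule choose_constants[OF \<tau> slow(1)])
  obtain n1 where n1: "\<And>n. n \<ge> n1 \<Longrightarrow> ln (norm (w (int n))) \<le> (l - \<sigma>) * real n"
    using slow(2) by (auto simp: eventually_sequentially)
  have "eventually (\<lambda>p. real p > 1 / \<epsilon>) sequentially"
    using filterlim_real_sequentially by (rule filterlim_at_top_dense[THEN iffD1, rule_format])
  hence "eventually (\<lambda>p. ln (norm (w (int ((J + 1) * p)))) \<le> (\<tau> - l) * real ((J + 1) * p)) sequentially"
    using reg[OF c(1), of K] eventually_ge_at_top[of "max 1 n1"]
  proof eventually_elim
    case (elim p)
    have p: "p \<ge> 1" "p \<ge> n1" using elim by auto
    have ep: "1 \<le> \<epsilon> * real p" using elim(1) c(1) by (simp add: field_simps)
    have sz: "size p (int k) \<le> (l - \<sigma>) * real k" if "k \<ge> 1" for k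
    proof -
      have "1 * p \<le> k * p" using that by (intro mult_right_mono) auto
      hence "n1 \<le> k * p" using p by linarith
      hence "ln (norm (w (int (k * p)))) \<le> (l - \<sigma>) * real (k * p)" by (rule n1)
      thus ?thesis using p by (simp add: size_def field_simps)
    qed
    have not_big: "\<not> big \<epsilon> p 0"
    proof
      assume "big \<epsilon> p 0"
      hence "exp ((l - \<epsilon>) * real (2 * p)) \<le> norm (w (int (2 * p)))"
        using w_add[of 0 "2 * p"] w0 by (simp add: big_def)
      hence "(l - \<epsilon>) * real (2 * p) \<le> ln (norm (w (int (2 * p))))" using w_nz by (subst ln_ge_iff) auto
      also have "\<dots> \<le> (l - \<sigma>) * real (2 * p)" using p by (intro n1) simp
      finally have "(\<sigma> - \<epsilon>) * real (2 * p) \<le> 0" by (simp add: algebra_simps)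
      moreover have "(\<sigma> - \<epsilon>) * real (2 * p) > 0" using c p by simp
      ultimately show False by simp
    qed
    have "size p (int J + 1) \<le> 1 + 2 * (l + \<epsilon>) - (l - 4 * \<epsilon>) * real_of_int (int J - 1)"
    proof (rule decay_one_sided[where K = "int K" and g = "l - \<sigma>"])
      show "no_cancellation (l - 4 * \<epsilon>) (size p) i" if "2 \<le> i" "i \<le> int K - 2" for i
      proof (rule no_cancellation_if_big[OF elim(2) _ _ _ p(1) ep])
        have "big \<epsilon> p 0 \<or> big \<epsilon> p i" using elim(2) that by (auto simp: regular_def)
        thus "big \<epsilon> p i" using not_big by blast
      qed (use that in auto)
      show "\<bar>size p (i + 1) - size p i\<bar> \<le> l + \<epsilon>" if "0 \<le> i" "i < int K" for i
        using that by (intro size_step[OF elim(2) _ p(1)]) auto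
      show "\<bar>size p 0\<bar> \<le> 1" by (simp add: size_def w0)
      show "size p (int K) \<le> (l - \<sigma>) * real_of_int (int K)" using sz[of K] c by simp
    qed (use c l in \<open>auto simp: algebra_simps\<close>)
    also have "\<dots> \<le> (\<tau> - l) * real (J + 1)" using c(7) by simp
    finally have "ln (norm (w (int (J + 1) * int p))) \<le> (\<tau> - l) * real (J + 1) * real p"
      using p by (simp add: size_def field_simps)
    thus ?case by (simp only: of_nat_mult mult.assoc minus_mult_left simp_thms)
  qed
  moreover have "J + 1 \<ge> 1" by simp
  ultimately show "\<exists>L\<ge>1. eventually (\<lambda>p. ln (norm (w (int (L * p)))) \<le> (\<tau> - l) * real (L * p)) sequentially"
    by blast
qed

lemma decay_both_directions:
  assumes reg: "\<And>\<epsilon> K. \<epsilon> > 0 \<Longrightarrow> eventually (regular \<epsilon> {- int K..int K}) sequentially"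
    and slow: "\<sigma> > 0" "eventually (\<lambda>n. ln (norm (w (int n))) \<le> (l - \<sigma>) * real n) sequentially"
      "eventually (\<lambda>n. ln (norm (w (- int n))) \<le> (l - \<sigma>) * real n) sequentially"
  shows "(\<lambda>n. ln (norm (w (int n))) / real n) \<longlonglongrightarrow> - l" "(\<lambda>n. ln (norm (w (- int n))) / real n) \<longlonglongrightarrow> - l"
proof -
  have up: "\<exists>L\<ge>1. eventually (\<lambda>p. ln (norm (w (int (L * p)))) \<le> (\<tau> - l) * real (L * p) \<and>
     ln (norm (w (- int (L * p)))) \<le> (\<tau> - l) * real (L * p)) sequentially" if \<tau>: "\<tau> > 0" for \<tau>
  proof -
    obtain \<epsilon> and J K :: nat where c: "\<epsilon> > 0" "4 * \<epsilon> < l" "6 * \<epsilon> < \<sigma>" "1 \<le> J" "J < K"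
      "(\<sigma> - 4 * \<epsilon>) * real K > ((l + \<epsilon>) + (l - 4 * \<epsilon>)) * real (J + 1) + 1"
      "1 + (l + \<epsilon>) - (l - 4 * \<epsilon>) * real J \<le> (\<tau> - l) * real (J + 1)"
      by (rule choose_constants[OF \<tau> slow(1)])
    obtain n1 where n1: "\<And>n. n \<ge> n1 \<Longrightarrow> ln (norm (w (int n))) \<le> (l - \<sigma>) * real n"
      using slow(2) by (auto simp: eventually_sequentially)
    obtain n2 where n2: "\<And>n. n \<ge> n2 \<Longrightarrow> ln (norm (w (- int n))) \<le> (l - \<sigma>) * real n"
      using slow(3) by (auto simp: eventually_sequentially)
    define b where "b = min \<epsilon> 1"
    have b: "b > 0" "b \<le> 1" "b \<le> \<epsilon>" using c by (auto simp: b_def)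
    have "eventually (\<lambda>p. real p > 1 / \<epsilon>) sequentially" "eventually (\<lambda>p. real p > \<bar>ln (norm (w 0))\<bar> / b) sequentially"
      using filterlim_real_sequentially by (rule filterlim_at_top_dense[THEN iffD1, rule_format])+
    hence "eventually (\<lambda>p. ln (norm (w (int ((J + 1) * p)))) \<le> (\<tau> - l) * real ((J + 1) * p) \<and>
        ln (norm (w (- int ((J + 1) * p)))) \<le> (\<tau> - l) * real ((J + 1) * p)) sequentially"
      using reg[OF c(1), of K] eventually_ge_at_top[of "max 1 (max n1 n2)"]
    proof eventually_elim
      case (elim p)
      have p: "p \<ge> 1" "p \<ge> n1" "p \<ge> n2" using elim by auto
      have ep: "1 \<le> \<epsilon> * real p" using elim(1) c(1) by (simp add: field_simps)
      have sz: "size p (int k) \<le> (l - \<sigma>) * real k" "size p (- int k) \<le> (l - \<sigma>) * real k" if "k \<ge> 1" for k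
      proof -
        have kp: "1 * p \<le> k * p" using that by (intro mult_right_mono) auto
        hence nk: "n1 \<le> k * p" "n2 \<le> k * p" using p by linarith+
        have "ln (norm (w (int (k * p)))) \<le> (l - \<sigma>) * real (k * p)" using nk(1) by (rule n1)
        thus "size p (int k) \<le> (l - \<sigma>) * real k" using p by (simp add: size_def field_simps)
        have "ln (norm (w (- int (k * p)))) \<le> (l - \<sigma>) * real (k * p)" using nk(2) by (rule n2)
        thus "size p (- int k) \<le> (l - \<sigma>) * real k" using p by (simp add: size_def field_simps)
      qed
      have s0: "\<bar>size p 0\<bar> < b"
        using elim(2) p b by (simp add: size_def abs_divide field_simps)
      have canc: "no_cancellation (l - 4 * \<epsilon>) (size p) i \<or> no_cancellation (l - 4 * \<epsilon>) (size p) j"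
        if "- int K \<le> i" "i + 2 \<le> j" "j \<le> int K - 2" for i j
      proof -
        have "big \<epsilon> p i \<or> big \<epsilon> p j" using elim(3) that by (auto simp: regular_def)
        moreover have "no_cancellation (l - 4 * \<epsilon>) (size p) k" if "big \<epsilon> p k" "- int K \<le> k" "k \<le> int K - 2" for k
          by (rule no_cancellation_if_big[OF elim(3) _ _ that(1) p(1) ep]) (use that in auto)
        ultimately show ?thesis using that by auto
      qed
      have st: "\<bar>size p (i + 1) - size p i\<bar> \<le> l + \<epsilon>" if "- int K \<le> i" "i < int K" for i
        using that by (intro size_step[OF elim(3) _ p(1)]) auto
      have K: "(l - 4 * \<epsilon> - (l - \<sigma>)) * real_of_int (int K) > (l + \<epsilon> + (l - 4 * \<epsilon>)) * real_of_int (int J + 1) + 1"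
        using c(6) by (simp add: algebra_simps)
      have slow': "size p (int K) \<le> (l - \<sigma>) * real_of_int (int K)" "size p (- int K) \<le> (l - \<sigma>) * real_of_int (int K)"
        "size p 1 \<le> l - \<sigma>" "size p (- 1) \<le> l - \<sigma>"
        using sz[of K] sz[of 1] c by simp_all
      have G: "l - 4 * \<epsilon> > 0" "l + \<epsilon> \<ge> 0" "1 \<le> int J" "int J < int K" "\<bar>size p 0\<bar> \<le> 1" "\<bar>size p 0\<bar> < l - 4 * \<epsilon> - (l - \<sigma>)"
        using c l s0 b by auto
      have "size p (int J + 1) \<le> 1 + (l + \<epsilon>) - (l - 4 * \<epsilon>) * real_of_int (int J)"
           "size p (- (int J + 1)) \<le> 1 + (l + \<epsilon>) - (l - 4 * \<epsilon>) * real_of_int (int J)"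
        using decay_two_sided[OF G(1,2) canc st G(5,6) slow' K G(3,4)] by blast+
      hence "size p (int J + 1) \<le> (\<tau> - l) * real (J + 1)" "size p (- (int J + 1)) \<le> (\<tau> - l) * real (J + 1)"
        using c(7) by simp_all
      hence "ln (norm (w (int (J + 1) * int p))) \<le> (\<tau> - l) * real (J + 1) * real p"
        "ln (norm (w (- int (J + 1) * int p))) \<le> (\<tau> - l) * real (J + 1) * real p"
        using p by (simp_all add: size_def field_simps)
      thus ?case by (simp only: of_nat_mult mult.assoc minus_mult_left simp_thms)
    qed
    moreover have "J + 1 \<ge> 1" by simp
    ultimately show ?thesis by blast
  qed
  show "(\<lambda>n. ln (norm (w (int n))) / real n) \<longlonglongrightarrow> - l"
  proof (rule limit_from_blocks[where c = "ln C"])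
    show "\<bar>ln (norm (w (int (Suc n)))) - ln (norm (w (int n)))\<bar> \<le> ln C" for n
      using log_lipschitz[of "int n"] by (simp add: add.commute)
    show "\<exists>L\<ge>1. eventually (\<lambda>p. ln (norm (w (int (L * p)))) \<le> (\<tau> - l) * real (L * p)) sequentially" if "\<tau> > 0" for \<tau>
      using up[OF that] by (auto elim: eventually_mono)
    show "eventually (\<lambda>n. ln (norm (w (int n))) \<ge> - (l + \<tau>) * real n) sequentially" if "\<tau> > 0" for \<tau>
    proof (rule lower_bounds[where Q = "\<lambda>p. P 0 p", OF _ _ that])
      show "eventually (\<lambda>p. op_norm (P 0 p) \<le> exp ((l + \<epsilon>) * real p)) sequentially" if "\<epsilon> > 0" for \<epsilon>
        using reg[OF that, of 0] by eventually_elim (simp add: regular_def)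
      show "norm (w 0) \<le> op_norm (P 0 p) * norm (w (int p))" for p
        using norm_le_op_norm_mv[OF P_det, of "w 0" 0 p] w_add[of 0 p] by simp
    qed
  qed
  show "(\<lambda>n. ln (norm (w (- int n))) / real n) \<longlonglongrightarrow> - l"
  proof (rule limit_from_blocks[where c = "ln C"])
    show "\<bar>ln (norm (w (- int (Suc n)))) - ln (norm (w (- int n)))\<bar> \<le> ln C" for n
      using log_lipschitz[of "- int (Suc n)"] by (simp add: abs_minus_commute)
    show "\<exists>L\<ge>1. eventually (\<lambda>p. ln (norm (w (- int (L * p)))) \<le> (\<tau> - l) * real (L * p)) sequentially" if "\<tau> > 0" for \<tau>
      using up[OF that] by (auto elim: eventually_mono)
    show "eventually (\<lambda>n. ln (norm (w (- int n))) \<ge> - (l + \<tau>) * real n) sequentially" if "\<tau> > 0" for \<tau>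
    proof (rule lower_bounds[where Q = "\<lambda>p. P (- int p) p", OF _ _ that])
      show "eventually (\<lambda>p. op_norm (P (- int p) p) \<le> exp ((l + \<epsilon>) * real p)) sequentially" if "\<epsilon> > 0" for \<epsilon>
        using reg[OF that, of 1] by eventually_elim (auto simp: regular_def dest!: bspec[where x = "- 1"])
      show "norm (w 0) \<le> op_norm (P (- int p) p) * norm (w (- int p))" for p
        using norm_mv_le[of "P (- int p) p" "w (- int p)"] w_add[of "- int p" p] by simp
    qed
  qed
qed

end

section \<open>Consequences of the hypotheses\<close>

lemma eq_dir_if_is_Arg:
  assumes "is_Arg (Complex (v $ 1) (v $ 2)) t" shows "(v::real^2) = norm v *\<^sub>R dir t"
proof -
  have n: "cmod (Complex (v $ 1) (v $ 2)) = norm v"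
    by (simp add: complex_norm norm_vec_def L2_set_def sum_2)
  have "Complex (v $ 1) (v $ 2) = of_real (norm v) * exp (\<i> * of_real t)"
    using assms unfolding is_Arg_def n .
  hence "v $ 1 = norm v * cos t" "v $ 2 = norm v * sin t"
    by (simp_all add: complex_eq_iff Re_exp Im_exp)
  thus ?thesis by (simp add: vec2_eq_iff)
qed

text \<open>Differentiate the identity \<open>cos \<theta> * z\<^sub>2 - sin \<theta> * z\<^sub>1 = 0\<close>.\<close>

lemma area_of_derivative:
  fixes z :: "real \<Rightarrow> real^2"
  assumes ab: "\<alpha> < \<beta>" and a: "a \<in> {\<alpha>..\<beta>}"
    and pol: "\<And>x. x \<in> {\<alpha>..\<beta>} \<Longrightarrow> z x = norm (z x) *\<^sub>R dir (\<theta> x)"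
    and \<theta>: "(\<theta> has_real_derivative d) (at a within {\<alpha>..\<beta>})"
    and z: "(z has_vector_derivative z') (at a within {\<alpha>..\<beta>})"
  shows "cr (z a) z' = (norm (z a))\<^sup>2 * d"
proof -
  have zi: "((\<lambda>x. z x $ i) has_real_derivative z' $ i) (at a within {\<alpha>..\<beta>})" for i
    using bounded_linear.has_vector_derivative[OF bounded_linear_vec_nth z]
    by (simp add: has_real_derivative_iff_has_vector_derivative)
  let ?\<phi> = "\<lambda>x. cos (\<theta> x) * z x $ 2 - sin (\<theta> x) * z x $ 1"
  let ?D = "(- sin (\<theta> a) * d) * z a $ 2 + cos (\<theta> a) * z' $ 2 - ((cos (\<theta> a) * d) * z a $ 1 + sin (\<theta> a) * z' $ 1)"
  have "(?\<phi> has_real_derivative ?D) (at a within {\<alpha>..\<beta>})"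
    by (auto intro!: derivative_eq_intros zi \<theta>)
  moreover have "(?\<phi> has_real_derivative 0) (at a within {\<alpha>..\<beta>})"
  proof (rule has_field_derivative_transform_within[where d = 1 and f = "\<lambda>_. 0"])
    fix x assume "x \<in> {\<alpha>..\<beta>}"
    hence "z x $ 1 = norm (z x) * cos (\<theta> x)" "z x $ 2 = norm (z x) * sin (\<theta> x)"
      using arg_cong[OF pol, of x "\<lambda>v. v $ 1"] arg_cong[OF pol, of x "\<lambda>v. v $ 2"] by simp_all
    hence "?\<phi> x = cos (\<theta> x) * (norm (z x) * sin (\<theta> x)) - sin (\<theta> x) * (norm (z x) * cos (\<theta> x))"
      by (simp only:)
    also have "\<dots> = 0" by (simp add: algebra_simps)
    finally show "0 = ?\<phi> x" by simp
  qed (use a in auto)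
  ultimately have "?D = 0"
    using vector_derivative_unique_within_closed_interval[of \<alpha> \<beta> a ?\<phi> ?D 0] ab a
    by (simp add: has_real_derivative_iff_has_vector_derivative)
  hence 1: "cos (\<theta> a) * z' $ 2 - sin (\<theta> a) * z' $ 1 = d * (cos (\<theta> a) * z a $ 1 + sin (\<theta> a) * z a $ 2)"
    by (simp add: algebra_simps)
  define r where "r = norm (z a)"
  have za: "z a $ 1 = r * cos (\<theta> a)" "z a $ 2 = r * sin (\<theta> a)"
    using arg_cong[OF pol[OF a], of "\<lambda>v. v $ 1"] arg_cong[OF pol[OF a], of "\<lambda>v. v $ 2"] by (simp_all add: r_def)
  have "cr (z a) z' = r * (cos (\<theta> a) * z' $ 2 - sin (\<theta> a) * z' $ 1)" by (simp add: cr_def za algebra_simps)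
  also have "\<dots> = r * (d * (r * ((cos (\<theta> a))\<^sup>2 + (sin (\<theta> a))\<^sup>2)))"
    unfolding 1 za by algebra
  also have "\<dots> = r\<^sup>2 * d" by (simp add: power2_eq_square)
  finally show ?thesis by (simp add: r_def)
qed

lemma has_vector_derivative_mv:
  fixes v :: "real^2" and f' :: "real^2^2"
  assumes "(f has_vector_derivative f') G"
  shows "((\<lambda>x. f x *v v) has_vector_derivative f' *v v) G"
proof -
  have "linear (\<lambda>A :: real^2^2. A *v v)"
    by (rule linearI) (simp_all add: matrix_vector_mult_add_rdistrib scaleR_matrix_vector_assoc)
  hence "bounded_linear (\<lambda>A :: real^2^2. A *v v)" by (simp add: linear_linear)
  thus ?thesis using assms by (rule bounded_linear.has_vector_derivative)
qed

lemma lipschitz_if_derivative_bounded: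
  assumes d: "\<And>a. a \<in> {\<alpha>..\<beta>} \<Longrightarrow> (f has_vector_derivative f' a) (at a within {\<alpha>..\<beta>})"
    and C: "\<And>a. a \<in> {\<alpha>..\<beta>} \<Longrightarrow> op_norm (f' a) \<le> C" and ab: "a \<in> {\<alpha>..\<beta>}" "b \<in> {\<alpha>..\<beta>}"
  shows "op_norm (f a - f b) \<le> C * \<bar>a - b\<bar>"
proof (rule op_norm_le)
  fix v :: "real^2"
  have "norm (f a *v v - f b *v v) \<le> (C * norm v) * norm (a - b)"
  proof (rule differentiable_bound[where S = "{\<alpha>..\<beta>}" and f' = "\<lambda>x h. h *\<^sub>R (f' x *v v)"])
    fix x assume x: "x \<in> {\<alpha>..\<beta>}"
    show "((\<lambda>x. f x *v v) has_derivative (\<lambda>h. h *\<^sub>R (f' x *v v))) (at x within {\<alpha>..\<beta>})"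
      using has_vector_derivative_mv[OF d[OF x]] unfolding has_vector_derivative_def .
    show "onorm (\<lambda>h. h *\<^sub>R (f' x *v v)) \<le> C * norm v"
    proof (rule onorm_le)
      fix h :: real
      have "norm (f' x *v v) \<le> C * norm v"
        using norm_mv_le[of "f' x" v] C[OF x] by (meson mult_right_mono norm_ge_zero order_trans)
      hence "\<bar>h\<bar> * norm (f' x *v v) \<le> \<bar>h\<bar> * (C * norm v)" by (intro mult_left_mono) auto
      thus "norm (h *\<^sub>R (f' x *v v)) \<le> C * norm v * norm h" by (simp add: mult.commute)
    qed
  qed (use ab in auto)
  thus "norm ((f a - f b) *v v) \<le> C * \<bar>a - b\<bar> * norm v"
    by (simp add: matrix_vector_mult_diff_rdistrib mult.assoc mult.commute mult.left_commute)
qed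

lemma span_image_line: "(\<lambda>v. A *v v) ` span {u} = span {A *v u}" for A :: "real^2^2"
  unfolding span_singleton image_image by (simp add: matrix_vector_mult_scaleR)

lemma span_singleton_neq_UNIV: "span {u} \<noteq> (UNIV :: (real^2) set)"
proof
  assume u: "span {u} = (UNIV :: (real^2) set)"
  show False
  proof (cases "u = 0")
    case True
    have "dir 0 \<in> span {u}" using u by simp
    hence "dir 0 = 0" using True by simp
    thus False using norm_dir[of 0] by (auto simp del: norm_dir)
  next
    case False
    have "rot u \<in> span {u}" using u by simp
    then obtain c where "rot u = c *\<^sub>R u" by (auto simp: span_singleton)
    hence "cr u (rot u) = 0" by simp
    thus False using False by simp
  qed
qed

text \<open>Mapping the union of finitely many lines into itself is a closed condition, so it passes from
  almost every matrix to the support; an invertible matrix then permutes the lines.\<close>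

lemma line_irreducible_if_furstenberg:
  assumes walk: "sl2_walk M G C"
    and irr: "\<And>\<V>. finite \<V> \<Longrightarrow> \<V> \<noteq> {} \<Longrightarrow> (\<And>V. V \<in> \<V> \<Longrightarrow> subspace V \<and> V \<noteq> {0} \<and> V \<noteq> UNIV) \<Longrightarrow>
      \<exists>A\<in>measure_support (distr M borel G). (\<lambda>v. A *v v) ` (\<Union>\<V>) \<noteq> \<Union>\<V>"
  shows "sl2_walk.line_irreducible M G"
  unfolding sl2_walk.line_irreducible_def[OF walk]
proof (intro allI impI notI)
  interpret sl2_walk M G C "\<lambda>n \<omega>. mprod (\<lambda>i. G (\<omega> i)) n" by (rule walk)
  fix V :: "(real^2) set set"
  assume V: "finite V \<and> V \<noteq> {} \<and> (\<forall>L\<in>V. \<exists>v. v \<noteq> 0 \<and> L = span {v})"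
    and AE: "AE x in M. \<forall>v. v \<noteq> 0 \<longrightarrow> span {v} \<in> V \<longrightarrow> span {G x *v v} \<in> V"
  define r where "r L = (SOME v. v \<noteq> 0 \<and> L = span {v})" for L :: "(real^2) set"
  have r: "r L \<noteq> 0 \<and> L = span {r L}" if "L \<in> V" for L
    unfolding r_def by (rule someI_ex) (use V that in blast)
  define Z where "Z = {A :: real^2^2. det A = 1} \<inter> (\<Inter>L\<in>V. (\<lambda>A. A *v r L) -` \<Union>V)"
  have cV: "closed (\<Union>V)"
  proof (rule closed_Union)
    show "\<forall>L\<in>V. closed L"
    proof
      fix L assume "L \<in> V"
      hence "L = span {r L}" using r by blast
      thus "closed L" using closed_span[of "{r L}"] by simp
    qed
  qed (use V in blast)
  have "continuous_on UNIV (\<lambda>A :: real^2^2. A *v r L)" for L by (intro continuous_intros)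
  hence "closed ((\<lambda>A. A *v r L) -` \<Union>V)" for L using cV by (intro closed_vimage)
  moreover have "continuous_on UNIV (\<lambda>A :: real^2^2. det A)"
    unfolding det_2 by (intro continuous_intros)
  hence "closed {A :: real^2^2. det A = 1}" by (intro closed_Collect_eq continuous_on_const)
  ultimately have Zc: "closed Z" unfolding Z_def by (intro closed_Int closed_INT ballI)
  have GZ: "AE x in M. G x \<in> Z"
    using AE AE_space
  proof eventually_elim
    case (elim x)
    have "G x *v r L \<in> \<Union>V" if L: "L \<in> V" for L
    proof -
      have "span {G x *v r L} \<in> V" using elim(1) r[OF L] L by metis
      thus ?thesis using span_base[of "G x *v r L" "{G x *v r L}"] by blast
    qed
    thus ?case using elim G_det by (auto simp: Z_def)
  qed
  obtain A where A: "A \<in> measure_support (distr M borel G)" "(\<lambda>v. A *v v) ` (\<Union>V) \<noteq> \<Union>V"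
  proof (rule bexE[OF irr[of V]])
    show "subspace L \<and> L \<noteq> {0} \<and> L \<noteq> UNIV" if "L \<in> V" for L
    proof -
      have L: "r L \<noteq> 0" "L = span {r L}" using r[OF that] by auto
      have "r L \<in> L" using L(2) span_base[of "r L" "{r L}"] by simp
      hence "L \<noteq> {0}" using L(1) by blast
      thus ?thesis using L(2) subspace_span[of "{r L}"] span_singleton_neq_UNIV[of "r L"] by metis
    qed
  qed (use V in auto)
  have "A \<in> Z"
  proof (rule ccontr)
    assume "A \<notin> Z"
    hence "emeasure (distr M borel G) (- Z) > 0"
      using A(1) Zc by (auto simp: measure_support_def)
    moreover have "emeasure (distr M borel G) (- Z) = emeasure M (G -` (- Z) \<inter> space M)"
      using Zc by (intro emeasure_distr) auto
    moreover have "\<dots> = 0"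
      using GZ Zc by (subst AE_iff_measurable[symmetric, where P = "\<lambda>x. G x \<in> Z"]) auto
    ultimately show False by simp
  qed
  hence dA: "det A = 1" and AV: "\<And>L. L \<in> V \<Longrightarrow> A *v r L \<in> \<Union>V" by (auto simp: Z_def)
  have into: "(\<lambda>v. A *v v) ` L \<in> V" if L: "L \<in> V" for L
  proof -
    obtain L' where L': "L' \<in> V" "A *v r L \<in> L'" using AV[OF L] by blast
    have nz: "A *v r L \<noteq> 0" using r[OF L] mv_nonzero[OF dA] by blast
    have "A *v r L \<in> span {r L'}" using L' r[OF L'(1)] by metis
    then obtain c where c: "A *v r L = c *\<^sub>R r L'" by (auto simp: span_singleton)
    hence "c \<noteq> 0" using nz by auto
    hence "span {r L'} = span {A *v r L}" using span_singleton_eq_iff[of "r L'" "A *v r L"] r[OF L'(1)] nz c by blast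
    moreover have "(\<lambda>v. A *v v) ` L = span {A *v r L}" using span_image_line[of A "r L"] r[OF L] by metis
    ultimately show ?thesis using L'(1) r[OF L'(1)] by metis
  qed
  have inj: "inj (\<lambda>v. A *v v)"
  proof (rule injI)
    fix x y assume "A *v x = A *v y"
    hence "A *v (x - y) = 0" by (simp add: matrix_vector_mult_diff_distrib)
    thus "x = y" using mv_nonzero[OF dA, of "x - y"] by auto
  qed
  have "((`) (\<lambda>v. A *v v)) ` V = V"
  proof (rule endo_inj_surj)
    show "finite V" using V by blast
    show "((`) (\<lambda>v. A *v v)) ` V \<subseteq> V" using into by blast
    show "inj_on ((`) (\<lambda>v. A *v v)) V" using inj_image_eq_iff[OF inj] by (auto simp: inj_on_def)
  qed
  hence "(\<lambda>v. A *v v) ` (\<Union>V) = \<Union>V" by (simp add: image_Union)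
  thus False using A(2) by blast
qed

lemma distr_shift:
  fixes M :: "'w measure" and f :: "'j \<Rightarrow> 'i"
  assumes M: "prob_space M" and f: "inj f" "range f \<subseteq> I"
  shows "(\<lambda>\<omega> j. \<omega> (f j)) \<in> PiM I (\<lambda>_. M) \<rightarrow>\<^sub>M PiM UNIV (\<lambda>_. M)"
    "distr (PiM I (\<lambda>_. M)) (PiM UNIV (\<lambda>_. M)) (\<lambda>\<omega> j. \<omega> (f j)) = PiM UNIV (\<lambda>_. M)"
proof -
  show "(\<lambda>\<omega> j. \<omega> (f j)) \<in> PiM I (\<lambda>_. M) \<rightarrow>\<^sub>M PiM UNIV (\<lambda>_. M)"
    using f(2) by (intro measurable_PiM_single' measurable_component_singleton) (auto simp: space_PiM)
  have "distr (PiM I (\<lambda>_. M)) (PiM UNIV (\<lambda>_. M)) (\<lambda>\<omega>. \<lambda>j\<in>UNIV. \<omega> (f j)) = PiM UNIV (\<lambda>_. M)"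
    using f M by (intro distr_PiM_reindex) auto
  thus "distr (PiM I (\<lambda>_. M)) (PiM UNIV (\<lambda>_. M)) (\<lambda>\<omega> j. \<omega> (f j)) = PiM UNIV (\<lambda>_. M)" by (simp add: restrict_def)
qed

lemma eventually_if_limsup_less:
  fixes f :: "nat \<Rightarrow> real"
  assumes "limsup (\<lambda>n. ereal (f n / real n)) < ereal l"
  obtains \<sigma> where "\<sigma> > 0" "eventually (\<lambda>n. f n \<le> (l - \<sigma>) * real n) sequentially"
proof -
  obtain z where z: "limsup (\<lambda>n. ereal (f n / real n)) < z" "z < ereal l" using assms dense by blast
  then obtain b where b: "z = ereal b" by (cases z) auto
  have "eventually (\<lambda>n. ereal (f n / real n) < z) sequentially" using z(1) by (rule Limsup_lessD)
  hence "eventually (\<lambda>n. f n \<le> (l - (l - b)) * real n) sequentially"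
    using eventually_gt_at_top[of 0]
    by eventually_elim (simp add: b field_simps)
  thus ?thesis using that[of "l - b"] z(2) b by simp
qed

context furstenberg_family
begin

text \<open>Countably many tolerances \<open>1 / (m + 1)\<close> suffice.\<close>

lemma AE_regular:
  fixes N :: "'n measure" and sh :: "int \<Rightarrow> 'n \<Rightarrow> nat \<Rightarrow> 'w" and Ds :: "int set" and Js :: "nat \<Rightarrow> int set"
  assumes N: "prob_space N" and sh: "\<And>j. j \<in> Ds \<Longrightarrow> sh j \<in> N \<rightarrow>\<^sub>M S" "\<And>j. j \<in> Ds \<Longrightarrow> distr N S (sh j) = S"
    and add: "\<And>j d x. j \<in> Ds \<Longrightarrow> sh (j + int d) x = (\<lambda>n. sh j x (d + n))"
    and Js: "\<And>K. finite (Js K)" "\<And>K j p. j \<in> Js K \<Longrightarrow> j * int p \<in> Ds"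
  shows "AE x in N. \<forall>a\<in>{\<alpha>..\<beta>}. \<forall>K. \<forall>\<epsilon>>0. eventually (\<lambda>p.
    regular_blocks \<epsilon> (Js K) p a (\<lambda>i. sh i x)) sequentially"
proof -
  let ?Q = "\<lambda>\<epsilon> K x a p. regular_blocks \<epsilon> (Js K) p a (\<lambda>i. sh i x)"
  have "AE x in N. \<forall>K m :: nat. \<forall>a\<in>{\<alpha>..\<beta>}. eventually (?Q (1 / real (Suc m)) K x a) sequentially"
    unfolding AE_all_countable using AE_blocks[OF N sh add Js] by simp
  thus ?thesis
  proof eventually_elim
    case (elim x)
    show ?case
    proof (intro ballI allI impI)
      fix a K and \<epsilon> :: real assume a: "a \<in> {\<alpha>..\<beta>}" and \<epsilon>: "\<epsilon> > 0"
      obtain m where m: "1 / real (Suc m) < \<epsilon>"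
        using reals_Archimedean[OF \<epsilon>] by (auto simp: inverse_eq_divide)
      have "eventually (?Q (1 / real (Suc m)) K x a) sequentially" using elim a by blast
      thus "eventually (?Q \<epsilon> K x a) sequentially"
      proof (rule eventually_mono)
        fix p assume "?Q (1 / real (Suc m)) K x a p"
        note Q = this[unfolded regular_blocks_def]
        have "exp ((lam a + 1 / real (Suc m)) * real p) \<le> exp ((lam a + \<epsilon>) * real p)"
          "exp ((lam a - \<epsilon>) * real (2 * p)) \<le> exp ((lam a - 1 / real (Suc m)) * real (2 * p))"
          using m by (auto intro!: mult_right_mono)
        note le = this
        show "?Q \<epsilon> K x a p"
          unfolding regular_blocks_def
        proof (intro conjI ballI impI)
          fix j assume "j \<in> Js K"
          with Q have "op_norm (W p a (sh (j * int p) x)) \<le> exp ((lam a + 1 / real (Suc m)) * real p)" by blast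
          thus "op_norm (W p a (sh (j * int p) x)) \<le> exp ((lam a + \<epsilon>) * real p)" using le(1) by linarith
        next
          fix j k assume "j \<in> Js K" "k \<in> Js K" "j + 2 \<le> k"
          with Q have "exp ((lam a - 1 / real (Suc m)) * real (2 * p)) \<le> norm (W (2 * p) a (sh (j * int p) x) *v dir 0) \<or>
            exp ((lam a - 1 / real (Suc m)) * real (2 * p)) \<le> norm (W (2 * p) a (sh (k * int p) x) *v dir 0)" by blast
          thus "exp ((lam a - \<epsilon>) * real (2 * p)) \<le> norm (W (2 * p) a (sh (j * int p) x) *v dir 0) \<or>
            exp ((lam a - \<epsilon>) * real (2 * p)) \<le> norm (W (2 * p) a (sh (k * int p) x) *v dir 0)" using le(2) by linarith
        qed
      qed
    qed
  qed
qed

end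

text \<open>Monotonicity of the angle is rephrased as positivity of the area spanned by \<open>F x a v\<close> and its
  derivative. The same area bounds the speed of the angle of \<open>F x a e\<close> by \<open>C\<^sup>2\<close>, hence its total
  rotation.\<close>

lemma furstenberg_family_if_hypotheses:
  fixes M :: "'w measure" and F :: "'w \<Rightarrow> real \<Rightarrow> real^2^2"
  assumes M: "prob_space M" and ab: "\<alpha> < \<beta>" and J: "J = {\<alpha>..\<beta>}"
    and SL2: "SL2_family M J F" and furst: "furstenberg_condition M J F" and C1: "C1_bounded M J F"
    and mono: "monotone_in_parameter M J F" and lam: "\<forall>a\<in>J. furstenberg_exponent M F a (lam a)"
  shows "\<exists>C D \<Theta>. furstenberg_family M F \<alpha> \<beta> C D \<Theta> lam"
proof -
  interpret M: prob_space M by (rule M)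
  have seq: "sequence_space M" by (rule sequence_space_if_prob_space[OF M])
  obtain C0 where C0: "C0 > 0" "\<forall>x\<in>space M. \<exists>F'. continuous_on J F' \<and>
        (\<forall>a\<in>J. (F x has_vector_derivative F' a) (at a within J) \<and> op_norm (F x a) \<le> C0 \<and> op_norm (F' a) \<le> C0)"
    using C1 unfolding C1_bounded_def by blast
  from bchoice[OF C0(2)] obtain D where D: "\<forall>x\<in>space M. continuous_on J (D x) \<and>
        (\<forall>a\<in>J. (F x has_vector_derivative D x a) (at a within J) \<and> op_norm (F x a) \<le> C0 \<and> op_norm (D x a) \<le> C0)" ..
  define C where "C = max 1 C0"
  define \<Theta> where "\<Theta> = C\<^sup>2 * (\<beta> - \<alpha>)"
  have C: "C \<ge> 1" by (simp add: C_def)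
  have det: "det (F x a) = 1" if "x \<in> space M" "a \<in> {\<alpha>..\<beta>}" for x a
    using SL2 that by (auto simp: SL2_family_def SL2_def J)
  have deriv: "(F x has_vector_derivative D x a) (at a within {\<alpha>..\<beta>})" if "x \<in> space M" "a \<in> {\<alpha>..\<beta>}" for x a
    using D that by (auto simp: J)
  have op: "op_norm (F x a) \<le> C" "op_norm (D x a) \<le> C" if "x \<in> space M" "a \<in> {\<alpha>..\<beta>}" for x a
  proof -
    have "op_norm (F x a) \<le> C0 \<and> op_norm (D x a) \<le> C0" using D that unfolding J by blast
    thus "op_norm (F x a) \<le> C" "op_norm (D x a) \<le> C" by (auto simp: C_def)
  qed
  have meas: "(\<lambda>x. F x a) \<in> borel_measurable M" if a: "a \<in> {\<alpha>..\<beta>}" for a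
  proof -
    have "(\<lambda>x. (x, a)) \<in> M \<rightarrow>\<^sub>M M \<Otimes>\<^sub>M restrict_space borel J"
      by (intro measurable_Pair measurable_ident_sets measurable_const) (use a in \<open>auto simp: space_restrict_space J\<close>)
    from measurable_compose[OF this, of "\<lambda>(x, a). F x a" borel] show ?thesis
      using SL2 by (simp add: SL2_family_def)
  qed
  have walk: "sl2_walk M (\<lambda>x. F x a) C" if a: "a \<in> {\<alpha>..\<beta>}" for a
    by (intro sl2_walk.intro seq sl2_walk_axioms.intro meas det op C) (use a in auto)
  obtain \<delta> where \<delta>: "\<delta> > 0" "\<And>x v. x \<in> space M \<Longrightarrow> v \<noteq> 0 \<Longrightarrow> \<exists>\<theta>. continuous_on J \<theta> \<and>
           (\<forall>a\<in>J. is_Arg (Complex ((F x a *v v) $ 1) ((F x a *v v) $ 2)) (\<theta> a)) \<and>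
           (\<forall>a\<in>J. \<exists>d>\<delta>. (\<theta> has_real_derivative d) (at a within J))"
    using mono unfolding monotone_in_parameter_def by blast
  have lift: "\<exists>\<theta> d. continuous_on {\<alpha>..\<beta>} \<theta> \<and> (\<forall>a\<in>{\<alpha>..\<beta>}. F x a *v v = norm (F x a *v v) *\<^sub>R dir (\<theta> a)) \<and>
     (\<forall>a\<in>{\<alpha>..\<beta>}. d a > 0 \<and> (\<theta> has_real_derivative d a) (at a within {\<alpha>..\<beta>}) \<and>
       cr (F x a *v v) (D x a *v v) = (norm (F x a *v v))\<^sup>2 * d a)"
    if x: "x \<in> space M" and v: "v \<noteq> 0" for x v
  proof -
    obtain \<theta> where th: "continuous_on {\<alpha>..\<beta>} \<theta>"
      "\<And>a. a \<in> {\<alpha>..\<beta>} \<Longrightarrow> is_Arg (Complex ((F x a *v v) $ 1) ((F x a *v v) $ 2)) (\<theta> a)"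
      "\<forall>a\<in>{\<alpha>..\<beta>}. \<exists>d>\<delta>. (\<theta> has_real_derivative d) (at a within {\<alpha>..\<beta>})"
      using \<delta>(2)[OF x v] unfolding J by blast
    from bchoice[OF th(3)] obtain d where d: "\<forall>a\<in>{\<alpha>..\<beta>}. \<delta> < d a \<and> (\<theta> has_real_derivative d a) (at a within {\<alpha>..\<beta>})" ..
    have pol: "F x a *v v = norm (F x a *v v) *\<^sub>R dir (\<theta> a)" if "a \<in> {\<alpha>..\<beta>}" for a
      by (rule eq_dir_if_is_Arg[OF th(2)[OF that]])
    have "cr (F x a *v v) (D x a *v v) = (norm (F x a *v v))\<^sup>2 * d a" if a: "a \<in> {\<alpha>..\<beta>}" for a
      by (rule area_of_derivative[OF ab a pol _ has_vector_derivative_mv[OF deriv[OF x a]]]) (use d a in auto)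
    moreover have "d a > 0" if "a \<in> {\<alpha>..\<beta>}" for a using d \<delta>(1) that by force
    ultimately show ?thesis using th(1) pol d by (intro exI[of _ \<theta>] exI[of _ d]) auto
  qed
  have e0: "dir 0 \<noteq> (0 :: real^2)" using norm_dir[of 0] by (auto simp del: norm_dir)
  have "furstenberg_family M F \<alpha> \<beta> C D \<Theta> lam"
  proof (intro furstenberg_family.intro matrix_family.intro seq matrix_family_axioms.intro furstenberg_family_axioms.intro)
    show "op_norm (F x a - F x b) \<le> C * \<bar>a - b\<bar>" if "x \<in> space M" "a \<in> {\<alpha>..\<beta>}" "b \<in> {\<alpha>..\<beta>}" for x a b
      by (rule lipschitz_if_derivative_bounded[OF deriv op(2)]) (use that in auto)
    show "cr (F x a *v v) (D x a *v v) > 0" if xav: "x \<in> space M" "a \<in> {\<alpha>..\<beta>}" "v \<noteq> 0" for x a v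
    proof -
      from lift[OF xav(1,3)] obtain d where "\<forall>a\<in>{\<alpha>..\<beta>}. d a > 0 \<and>
          cr (F x a *v v) (D x a *v v) = (norm (F x a *v v))\<^sup>2 * d a" by blast
      from bspec[OF this xav(2)] show ?thesis using mv_nonzero[OF det[OF xav(1,2)] xav(3)] by simp
    qed
    show "\<exists>\<theta>. continuous_on {\<alpha>'..\<beta>'} \<theta> \<and>
          (\<forall>a\<in>{\<alpha>'..\<beta>'}. F x a *v dir 0 = norm (F x a *v dir 0) *\<^sub>R dir (\<theta> a)) \<and> \<theta> \<beta>' - \<theta> \<alpha>' \<le> \<Theta>"
      if x: "x \<in> space M" and ab': "\<alpha> \<le> \<alpha>'" "\<alpha>' < \<beta>'" "\<beta>' \<le> \<beta>" for x \<alpha>' \<beta>'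
    proof -
      obtain \<theta> d where th: "continuous_on {\<alpha>..\<beta>} \<theta>"
        "\<forall>a\<in>{\<alpha>..\<beta>}. F x a *v dir 0 = norm (F x a *v dir 0) *\<^sub>R dir (\<theta> a)"
        "\<forall>a\<in>{\<alpha>..\<beta>}. d a > 0 \<and> (\<theta> has_real_derivative d a) (at a within {\<alpha>..\<beta>}) \<and>
          cr (F x a *v dir 0) (D x a *v dir 0) = (norm (F x a *v dir 0))\<^sup>2 * d a"
        using lift[OF x e0] by blast
      have sub: "{\<alpha>'..\<beta>'} \<subseteq> {\<alpha>..\<beta>}" using ab' by auto
      have "\<exists>a\<in>{\<alpha>'<..<\<beta>'}. \<theta> \<beta>' - \<theta> \<alpha>' = (*) (d a) (\<beta>' - \<alpha>')"
      proof (rule mvt_simple[OF ab'(2)])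
        fix a assume "\<alpha>' \<le> a" "a \<le> \<beta>'"
        hence "a \<in> {\<alpha>..\<beta>}" using ab' by auto
        hence "(\<theta> has_real_derivative d a) (at a within {\<alpha>..\<beta>})" using th(3) by blast
        hence "(\<theta> has_real_derivative d a) (at a within {\<alpha>'..\<beta>'})" using sub by (rule DERIV_subset)
        thus "(\<theta> has_derivative (*) (d a)) (at a within {\<alpha>'..\<beta>'})" by (simp add: has_field_derivative_def)
      qed
      then obtain a where a0: "a \<in> {\<alpha>'<..<\<beta>'}" and a1: "\<theta> \<beta>' - \<theta> \<alpha>' = d a * (\<beta>' - \<alpha>')" ..
      have a: "a \<in> {\<alpha>..\<beta>}" "\<theta> \<beta>' - \<theta> \<alpha>' = d a * (\<beta>' - \<alpha>')" using a0 a1 ab' by simp_all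
      have "d a \<le> C\<^sup>2"
      proof -
        let ?z = "F x a *v dir 0"
        have z: "norm ?z > 0" using mv_nonzero[OF det[OF x a(1)] e0] by simp
        have "1 \<le> C * norm ?z"
          using norm_le_op_norm_mv[OF det[OF x a(1)], of "dir 0"] op(1)[OF x a(1)] mult_right_mono[of "op_norm (F x a)" C "norm ?z"] by simp
        have "(norm ?z)\<^sup>2 * d a = cr ?z (D x a *v dir 0)" using th(3) a(1) by simp
        also have "\<dots> \<le> norm ?z * norm (D x a *v dir 0)" using abs_cr_le abs_le_D1 by blast
        also have "\<dots> \<le> norm ?z * C"
          using norm_mv_le[of "D x a" "dir 0"] op(2)[OF x a(1)] by (intro mult_left_mono) auto
        also have "\<dots> \<le> norm ?z * (C * (C * norm ?z))"
          using \<open>1 \<le> C * norm ?z\<close> C mult_left_mono[of 1 "C * norm ?z" C] by (intro mult_left_mono) auto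
        also have "\<dots> = (norm ?z)\<^sup>2 * C\<^sup>2" by (simp add: power2_eq_square)
        finally show ?thesis using z by simp
      qed
      hence "d a * (\<beta>' - \<alpha>') \<le> C\<^sup>2 * (\<beta> - \<alpha>)" using ab' by (intro mult_mono) auto
      thus ?thesis using th(1,2) sub a(2) unfolding \<Theta>_def
        by (intro exI[of _ \<theta>]) (auto intro: continuous_on_subset)
    qed
    show "0 \<le> \<Theta>" using ab by (simp add: \<Theta>_def)
    show "sl2_walk.line_irreducible M (\<lambda>x. F x a)" if a: "a \<in> {\<alpha>..\<beta>}" for a
    proof (rule line_irreducible_if_furstenberg[OF walk[OF a]])
      fix \<V> :: "(real^2) set set"
      assume \<V>: "finite \<V>" "\<V> \<noteq> {}" "\<And>V. V \<in> \<V> \<Longrightarrow> subspace V \<and> V \<noteq> {0} \<and> V \<noteq> UNIV"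
      let ?S = "measure_support (distr M borel (\<lambda>x. F x a))"
      have "\<forall>V\<in>\<V>. subspace V \<and> V \<noteq> {0} \<and> V \<noteq> UNIV" by (rule ballI) (rule \<V>(3))
      with \<V>(1,2) have "(\<forall>A\<in>?S. (\<lambda>v. A *v v) ` (\<Union>\<V>) = \<Union>\<V>) \<Longrightarrow> False"
        using bspec[OF furst[unfolded furstenberg_condition_def Let_def J] a, THEN conjunct2, unfolded not_ex, THEN spec, of \<V>]
        by simp
      thus "\<exists>A\<in>?S. (\<lambda>v. A *v v) ` (\<Union>\<V>) \<noteq> \<Union>\<V>" by blast
    qed
    show "AE \<omega> in PiM UNIV (\<lambda>_. M). (\<lambda>n. ln (op_norm (mprod (\<lambda>i. F (\<omega> i) a) n)) / real n) \<longlonglongrightarrow> lam a"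
      if a: "a \<in> {\<alpha>..\<beta>}" for a
    proof -
      let ?N = "PiM {1::nat..} (\<lambda>_. M)" and ?f = "\<lambda>\<omega>. \<lambda>n\<in>{1::nat..}. \<omega> (n - 1)"
      have d: "distr (PiM (UNIV :: nat set) (\<lambda>_. M)) ?N ?f = ?N"
        by (rule distr_PiM_reindex) (use M in \<open>auto simp: inj_on_def\<close>)
      have m: "?f \<in> PiM (UNIV :: nat set) (\<lambda>_. M) \<rightarrow>\<^sub>M ?N"
        by (intro measurable_restrict measurable_component_singleton) auto
      have "AE \<omega> in ?N. (\<lambda>n. ln (op_norm (T F a \<omega> n)) / real n) \<longlonglongrightarrow> lam a"
        using lam a by (auto simp: furstenberg_exponent_def J)
      hence "AE \<omega> in distr (PiM UNIV (\<lambda>_. M)) ?N ?f. (\<lambda>n. ln (op_norm (T F a \<omega> n)) / real n) \<longlonglongrightarrow> lam a"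
        unfolding d .
      from AE_distrD[OF m this] show ?thesis by (simp add: T_eq_mprod)
    qed
    show "lam a > 0" if "a \<in> {\<alpha>..\<beta>}" for a using lam that by (auto simp: furstenberg_exponent_def J)
  qed (use meas det op C ab deriv in auto)
  thus ?thesis by blast
qed

lemma dir_0_eq: "dir 0 = vector [1, 0]" by (simp add: dir_def)

context furstenberg_family
begin

text \<open>The first factor of \<open>T\<close> is that of \<open>\<omega> 1\<close>, so the future after time \<open>j\<close> starts with the entry \<open>j + 1\<close>.\<close>

lemma dichotomy_one_sided:
  "AE \<omega> in PiM {1::nat..} (\<lambda>_. M). \<forall>a\<in>{\<alpha>..\<beta>}.
     limsup (\<lambda>n. ereal (ln (norm (T F a \<omega> n *v dir 0)) / real n)) < ereal (lam a) \<longrightarrow>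
     (\<lambda>n. ln (norm (T F a \<omega> n *v dir 0)) / real n) \<longlonglongrightarrow> - lam a"
proof -
  let ?N = "PiM {1::nat..} (\<lambda>_. M)"
  let ?sh = "\<lambda>j \<omega> n. \<omega> (nat (j + 1 + int n)) :: 'w"
  have M: "prob_space M" by (rule M.prob_space_axioms)
  have sh: "?sh j \<in> ?N \<rightarrow>\<^sub>M S" "distr ?N S (?sh j) = S" if "j \<in> {0..}" for j
    using that by (intro distr_shift[OF M]; force simp: inj_on_def)+
  have "AE \<omega> in ?N. \<forall>a\<in>{\<alpha>..\<beta>}. \<forall>K. \<forall>\<epsilon>>0. eventually (\<lambda>p.
    regular_blocks \<epsilon> {0..int K} p a (\<lambda>i. ?sh i \<omega>)) sequentially"
  proof (rule AE_regular[where Ds = "{0..}" and Js = "\<lambda>K. {0..int K}", OF _ sh])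
    show "prob_space ?N" by (intro prob_space_PiM M)
    show "?sh (j + int d) x = (\<lambda>n. ?sh j x (d + n))" for j d x
      by (rule ext, rule arg_cong[of _ _ "\<lambda>k. x (nat k)"]) simp
  qed auto
  moreover have "AE \<omega> in ?N. \<omega> \<in> space ?N" by (rule AE_space)
  ultimately show ?thesis
  proof eventually_elim
    case (elim \<omega>)
    show ?case
    proof (intro ballI impI)
      fix a assume a: "a \<in> {\<alpha>..\<beta>}" and
        less: "limsup (\<lambda>n. ereal (ln (norm (T F a \<omega> n *v dir 0)) / real n)) < ereal (lam a)"
      \<comment> \<open>the orbit is extended to negative times by standing still\<close>
      define A where "A n = (if n \<ge> 1 then F (\<omega> (nat n)) a else mat 1)" for n :: int
      define w where "w n = (if n \<ge> 0 then T F a \<omega> (nat n) *v dir 0 else dir 0)" for n :: int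
      have mem: "\<omega> i \<in> space M" if "i \<ge> 1" for i using elim(2) that by (auto simp: space_PiM)
      have orb: "orbit A w C (lam a)"
      proof
        show "det (A n) = 1" for n using mem F_det a by (simp add: A_def)
        show "op_norm (A n) \<le> C" for n using mem F_bd a C1 op_norm_mat_1 by (auto simp: A_def)
        show "w (n + 1) = A (n + 1) *v w n" for n
        proof (cases "n \<ge> 0")
          case True
          hence "nat (n + 1) = Suc (nat n)" by simp
          thus ?thesis using True by (simp add: w_def A_def matrix_vector_mul_assoc)
        next
          case False
          thus ?thesis by (cases "n = -1") (simp_all add: w_def A_def)
        qed
        show "w 0 \<noteq> 0" using norm_dir[of 0] by (auto simp: w_def simp del: norm_dir)
        show "0 < lam a" by (rule lam_pos[OF a])
      qed
      interpret orbit A w C "lam a" "\<lambda>n k. mprod (\<lambda>i. A (n + 1 + int i)) k" by (rule orb)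
      have P: "W k a (?sh n \<omega>) = mprod (\<lambda>i. A (n + 1 + int i)) k" if "n \<ge> 0" for n k
        unfolding W_def using that by (intro mprod_cong) (simp add: A_def)
      have reg: "eventually (regular \<epsilon> {0..int K}) sequentially" if "\<epsilon> > 0" for \<epsilon> K
        using elim(1)[rule_format, OF a that, of K]
      proof eventually_elim
        case (elim p)
        thus ?case unfolding regular_blocks_def regular_def big_def by (simp add: P)
      qed
      have f: "ln (norm (w (int n))) = ln (norm (T F a \<omega> n *v dir 0))" for n by (simp add: w_def)
      obtain \<sigma> where "\<sigma> > 0" "eventually (\<lambda>n. ln (norm (T F a \<omega> n *v dir 0)) \<le> (lam a - \<sigma>) * real n) sequentially"
        by (rule eventually_if_limsup_less[OF less])
      hence "(\<lambda>n. ln (norm (w (int n))) / real n) \<longlonglongrightarrow> - lam a"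
        by (intro decay_forward[OF reg, of \<sigma>]) (simp_all add: f, simp_all add: w_def)
      thus "(\<lambda>n. ln (norm (T F a \<omega> n *v dir 0)) / real n) \<longlonglongrightarrow> - lam a" by (simp add: f)
    qed
  qed
qed

text \<open>\<open>T\<close> and \<open>T_neg\<close> describe one orbit over \<open>\<int>\<close>, in which \<open>T_neg F a \<omega> n\<close> leads from time \<open>0\<close> to time
  \<open>- (n + 1)\<close>.\<close>

lemma dichotomy_two_sided:
  "AE \<omega> in PiM (UNIV :: int set) (\<lambda>_. M). \<forall>a\<in>{\<alpha>..\<beta>}. \<forall>v. v \<noteq> 0 \<longrightarrow>
     limsup (\<lambda>n. ereal (ln (norm (T F a (\<lambda>k. \<omega> (int k)) n *v v)) / real n)) < ereal (lam a) \<longrightarrow>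
     limsup (\<lambda>n. ereal (ln (norm (T_neg F a \<omega> n *v v)) / real n)) < ereal (lam a) \<longrightarrow>
     (\<lambda>n. ln (norm (T F a (\<lambda>k. \<omega> (int k)) n *v v)) / real n) \<longlonglongrightarrow> - lam a \<and>
     (\<lambda>n. ln (norm (T_neg F a \<omega> n *v v)) / real n) \<longlonglongrightarrow> - lam a"
proof -
  let ?N = "PiM (UNIV :: int set) (\<lambda>_. M)"
  let ?sh = "\<lambda>j \<omega> n. \<omega> (j + 1 + int n) :: 'w"
  have M: "prob_space M" by (rule M.prob_space_axioms)
  have sh: "?sh j \<in> ?N \<rightarrow>\<^sub>M S" "distr ?N S (?sh j) = S" for j
    by (intro distr_shift[OF M]; force simp: inj_on_def)+
  have "AE \<omega> in ?N. \<forall>a\<in>{\<alpha>..\<beta>}. \<forall>K. \<forall>\<epsilon>>0. eventually (\<lambda>p.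
    regular_blocks \<epsilon> {- int K..int K} p a (\<lambda>i. ?sh i \<omega>)) sequentially"
  proof (rule AE_regular[where Ds = UNIV and Js = "\<lambda>K. {- int K..int K}", OF _ sh])
    show "prob_space ?N" by (intro prob_space_PiM M)
    show "?sh (j + int d) x = (\<lambda>n. ?sh j x (d + n))" for j d x
      by (rule ext, rule arg_cong[of _ _ x]) simp
  qed auto
  moreover have "AE \<omega> in ?N. \<omega> \<in> space ?N" by (rule AE_space)
  ultimately show ?thesis
  proof eventually_elim
    case (elim \<omega>)
    show ?case
    proof (intro ballI allI impI)
      fix a and v :: "real^2" assume a: "a \<in> {\<alpha>..\<beta>}" and v: "v \<noteq> 0" and
        less: "limsup (\<lambda>n. ereal (ln (norm (T F a (\<lambda>k. \<omega> (int k)) n *v v)) / real n)) < ereal (lam a)"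
          "limsup (\<lambda>n. ereal (ln (norm (T_neg F a \<omega> n *v v)) / real n)) < ereal (lam a)"
      let ?T = "T F a (\<lambda>k. \<omega> (int k))" and ?R = "T_neg F a \<omega>"
      define A where "A n = F (\<omega> n) a" for n :: int
      define w where "w n = (if n \<ge> 0 then ?T (nat n) *v v else ?R (nat (- n - 1)) *v v)" for n :: int
      have mem: "\<omega> i \<in> space M" for i using elim(2) by (auto simp: space_PiM)
      have det: "det (A n) = 1" for n using mem F_det a by (simp add: A_def)
      have inv: "A n *v (matrix_inv (A n) *v u) = u" for n u
      proof -
        have "invertible (A n)" using det[of n] by (simp add: invertible_det_nz)
        hence "A n ** matrix_inv (A n) = mat 1"
          unfolding invertible_def matrix_inv_def by (rule someI2_ex) simp
        thus ?thesis by (simp add: matrix_vector_mul_assoc)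
      qed
      have orb: "orbit A w C (lam a)"
      proof
        show "det (A n) = 1" for n by (rule det)
        show "op_norm (A n) \<le> C" for n using mem F_bd a by (simp add: A_def)
        show "w (n + 1) = A (n + 1) *v w n" for n
        proof (cases "n \<ge> 0")
          case True
          hence "nat (n + 1) = Suc (nat n)" by simp
          thus ?thesis using True by (simp add: w_def A_def matrix_vector_mul_assoc add.commute)
        next
          case False
          show ?thesis
          proof (cases "n = -1")
            case True
            thus ?thesis using inv[of 0 v] by (simp add: w_def A_def)
          next
            case neq: False
            define m where "m = nat (- n - 2)"
            have m: "n = - int (Suc m) - 1" using False neq by (simp add: m_def)
            have "nat (- n - 1) = Suc m" "\<not> 0 \<le> n" by (simp_all add: m)
            hence "w n = ?R (Suc m) *v v" by (simp only: w_def if_False)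
            hence "w n = matrix_inv (A (- int (Suc m))) *v (?R m *v v)"
              by (simp only: T_neg.simps(2) A_def matrix_vector_mul_assoc)
            moreover have "w (n + 1) = ?R m *v v" by (simp add: w_def m)
            moreover have "n + 1 = - int (Suc m)" by (simp add: m)
            ultimately show ?thesis by (simp only: inv)
          qed
        qed
        show "w 0 \<noteq> 0" using v by (simp add: w_def)
        show "0 < lam a" by (rule lam_pos[OF a])
      qed
      interpret orbit A w C "lam a" "\<lambda>n k. mprod (\<lambda>i. A (n + 1 + int i)) k" by (rule orb)
      have P: "W k a (?sh n \<omega>) = mprod (\<lambda>i. A (n + 1 + int i)) k" for n k
        unfolding W_def by (simp add: A_def)
      have reg: "eventually (regular \<epsilon> {- int K..int K}) sequentially" if "\<epsilon> > 0" for \<epsilon> K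
        using elim(1)[rule_format, OF a that, of K]
      proof eventually_elim
        case (elim p)
        thus ?case unfolding regular_blocks_def regular_def big_def by (simp only: P simp_thms)
      qed
      have f: "ln (norm (w (int n))) = ln (norm (?T n *v v))" for n by (simp add: w_def)
      have g: "ln (norm (w (- int (Suc n)))) = ln (norm (?R n *v v))" for n by (simp add: w_def)
      obtain \<sigma>1 where s1: "\<sigma>1 > 0" "eventually (\<lambda>n. ln (norm (?T n *v v)) \<le> (lam a - \<sigma>1) * real n) sequentially"
        by (rule eventually_if_limsup_less[OF less(1)])
      obtain \<sigma>2 where s2: "\<sigma>2 > 0" "eventually (\<lambda>n. ln (norm (?R n *v v)) \<le> (lam a - \<sigma>2) * real n) sequentially"
        by (rule eventually_if_limsup_less[OF less(2)])
      define \<sigma> where "\<sigma> = min \<sigma>1 (\<sigma>2 / 2)"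
      have \<sigma>: "\<sigma> > 0" "\<sigma> \<le> \<sigma>1" "2 * \<sigma> \<le> \<sigma>2" using s1 s2 by (auto simp: \<sigma>_def)
      have fwd: "eventually (\<lambda>n. ln (norm (w (int n))) \<le> (lam a - \<sigma>) * real n) sequentially"
        using s1(2)
      proof eventually_elim
        case (elim n)
        have "(lam a - \<sigma>1) * real n \<le> (lam a - \<sigma>) * real n" using \<sigma> by (intro mult_right_mono) auto
        thus ?case using elim by (simp add: f)
      qed
      \<comment> \<open>\<open>\<sigma>2\<close> was halved to absorb the extra factor in \<open>T_neg\<close>\<close>
      have "eventually (\<lambda>n. ln (norm (w (- int (Suc n)))) \<le> (lam a - \<sigma>) * real (Suc n)) sequentially"
        using s2(2) eventually_ge_at_top[of 1]
      proof eventually_elim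
        case (elim n)
        have "(lam a - \<sigma>2) * real n \<le> (lam a - 2 * \<sigma>) * real n" using \<sigma> by (intro mult_right_mono) auto
        also have "\<dots> \<le> (lam a - \<sigma>) * real (Suc n)"
        proof -
          have "\<sigma> * 1 \<le> \<sigma> * real n" using elim \<sigma> by (intro mult_left_mono) auto
          thus ?thesis using lam_pos[OF a] by (simp add: algebra_simps)
        qed
        finally show ?case using elim(1) unfolding g by linarith
      qed
      hence bwd: "eventually (\<lambda>n. ln (norm (w (- int n))) \<le> (lam a - \<sigma>) * real n) sequentially"
        by (subst (asm) eventually_sequentially_Suc)
      have "(\<lambda>n. ln (norm (w (int n))) / real n) \<longlonglongrightarrow> - lam a"
        by (rule decay_both_directions(1)[OF reg \<sigma>(1) fwd bwd])
      hence 1: "(\<lambda>n. ln (norm (?T n *v v)) / real n) \<longlonglongrightarrow> - lam a" by (simp add: f)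
      have "(\<lambda>n. ln (norm (w (- int n))) / real n) \<longlonglongrightarrow> - lam a"
        by (rule decay_both_directions(2)[OF reg \<sigma>(1) fwd bwd])
      hence "(\<lambda>n. ln (norm (w (- int (Suc n)))) / real (Suc n)) \<longlonglongrightarrow> - lam a" by (rule LIMSEQ_Suc)
      hence "(\<lambda>n. ln (norm (?R n *v v)) / real (Suc n) * (real (Suc n) / real n)) \<longlonglongrightarrow> - lam a * 1"
        unfolding g by (intro tendsto_mult LIMSEQ_Suc_n_over_n)
      hence "(\<lambda>n. ln (norm (?R n *v v)) / real n) \<longlonglongrightarrow> - lam a" by simp
      with 1 show "(\<lambda>n. ln (norm (?T n *v v)) / real n) \<longlonglongrightarrow> - lam a \<and>
         (\<lambda>n. ln (norm (?R n *v v)) / real n) \<longlonglongrightarrow> - lam a" by blast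
    qed
  qed
qed

end

theorem theorem1p13:
  fixes M :: "'w measure" and \<alpha> \<beta> :: real and J :: "real set"
    and F :: "'w \<Rightarrow> real \<Rightarrow> real^2^2" and lam :: "real \<Rightarrow> real"
  assumes "prob_space M"
    and "\<alpha> < \<beta>" and "J = {\<alpha>..\<beta>}"
    and "SL2_family M J F"
    and "furstenberg_condition M J F"
    and "C1_bounded M J F"
    and "nowhere_uniformly_hyperbolic M J F"
    and "monotone_in_parameter M J F"
    and "\<forall>a\<in>J. furstenberg_exponent M F a (lam a)"
  shows
    "(AE \<omega> in PiM {1::nat..} (\<lambda>_. M). \<forall>a\<in>J.
        limsup (\<lambda>n. ereal (ln (norm (T F a \<omega> n *v vector [1, 0])) / real n)) < ereal (lam a) \<longrightarrow>
        (\<lambda>n. ln (norm (T F a \<omega> n *v vector [1, 0])) / real n) \<longlonglongrightarrow> - lam a)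
     \<and>
     (AE \<omega> in PiM (UNIV :: int set) (\<lambda>_. M). \<forall>a\<in>J. \<forall>v. v \<noteq> 0 \<longrightarrow>
        limsup (\<lambda>n. ereal (ln (norm (T F a (\<lambda>k. \<omega> (int k)) n *v v)) / real n)) < ereal (lam a) \<longrightarrow>
        limsup (\<lambda>n. ereal (ln (norm (T_neg F a \<omega> n *v v)) / real n)) < ereal (lam a) \<longrightarrow>
        (\<lambda>n. ln (norm (T F a (\<lambda>k. \<omega> (int k)) n *v v)) / real n) \<longlonglongrightarrow> - lam a \<and>
        (\<lambda>n. ln (norm (T_neg F a \<omega> n *v v)) / real n) \<longlonglongrightarrow> - lam a)"
proof -
  obtain C D \<Theta> where fam: "furstenberg_family M F \<alpha> \<beta> C D \<Theta> lam"
    using furstenberg_family_if_hypotheses[OF assms(1-6,8,9)] by blast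
  show ?thesis
    using furstenberg_family.dichotomy_one_sided[OF fam] furstenberg_family.dichotomy_two_sided[OF fam]
    unfolding \<open>J = {\<alpha>..\<beta>}\<close> dir_0_eq by blast
qed

end
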